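(* Let $0<H_0<H_1$ and let $(k^H)_{H\in[H_0,H_1]}$ be a family of functions on $[0,1]^2$ such that: for every $H\in[H_0,H_1]$, $k^H$ is the covariance function of a continuous self-similar centered Gaussian process with exponent $H$; the map $H\mapsto k^H(s,t)$ is continuous $[H_0,H_1]\to\mathbb R$ for every $s,t\in[0,1]$; and there exist constants $C>0,\beta>0$ such that for every $H\in[H_0,H_1]$ and $0\le s,t\le1$ $$k^H(t,t)+k^H(s,s)-2k^H(s,t)\le C\,|t-s|^\beta.$$ Let $\mu$ be a finite measure on $[H_0,H_1]$ such that $H_0$ belongs to the support of $\mu$, and let $X=(X_t)_{t\in[0,1]}$ be a continuous centered Gaussian process with covariance function $k(s,t)=\int_{H_0}^{H_1}k^H(s,t)\,d\mu(H)$. Let $X^\varepsilon_t=X_{\varepsilon t}$ and $$g(\varepsilon)=\Bigl(\int_{H_0}^{H_1}\varepsilon^{2H}\,d\mu(H)\Bigr)^{-1}.$$ Then the family $(g(\varepsilon)^{1/2}X^\varepsilon)_\varepsilon$ is tight and converges in law in $\mathcal C([0,1],\mathbb R)$, as $\varepsilon\to0$, to the self-similar process $X^{H_0}$ with covariance function $k^{H_0}$, and the family $(X^\varepsilon)_{\varepsilon}$ satisfies, as $\varepsilon\to0$, an LDP on $\mathcal C([0,1],\mathbb R)$ with speed $g$ and rate function $$I(h)=\begin{cases}\frac12|h|^2_{\mathcal Y^0}&h\in\mathcal Y^0\\+\infty&\text{otherwise,}\end{cases}$$ where $\mathcal Y^0$, $|\cdot|_{\mathcal Y^0}$ are the RKHS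 and its norm associated to the covariance function $k^{H_0}$.
   Context: A centered Gaussian process with covariance $k^H$ is self-similar with exponent (Hurst index) $H$ if $k^H(\lambda s,\lambda t)=\lambda^{2H}k^H(s,t)$ for all $\lambda>0$ and $s,t$ such that all times lie in $[0,1]$. $\mathcal C([0,1],\mathbb R)$ carries the supremum norm. A rate function on a topological space $E$ is a lower semicontinuous $I:E\to[0,+\infty]$ with compact level sets. A family of $E$-valued random variables with laws $(\mu_\varepsilon)_\varepsilon$ satisfies a Large Deviations Principle (LDP) as $\varepsilon\to0$ with speed $g$ (where $g(\varepsilon)\to+\infty$ as $\varepsilon\to0$) and rate function $I$ if $\limsup_{\varepsilon\to0}\frac1{g(\varepsilon)}\log\mu_\varepsilon(F)\le-\inf_FI$ for every closed $F\subset E$ and $\liminf_{\varepsilon\to0}\frac1{g(\varepsilon)}\log\mu_\varepsilon(G)\ge-\inf_GI$ for every open $G\subset E$. The RKHS (Cameron–Martin space) of a centered Gaussian random variable $Z$ with values in a separable Banach space $E$: let $\mathcal H_Z$ be the closure in $L^2$ of $\{\langle\alpha,Z\rangle:\alpha\in E'\}$; the RKHS is $\{\mathbb E[\xi Z]:\xi\in\mathcal H_Z\}\subset E$ with norm $|\mathbb E[\xi Z]|=\|\xi\|_{L^2}$. *)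

theory Defs
  imports "HOL-Probability.Probability"
begin

section \<open>The Banach space of continuous functions on the unit interval\<close>

typedef unit_interval = "{0..1::real}"
  morphisms val01 Unit_interval
  by auto

setup_lifting type_definition_unit_interval

instantiation unit_interval :: metric_space
begin

lift_definition dist_unit_interval :: "unit_interval \<Rightarrow> unit_interval \<Rightarrow> real" is dist .

definition uniformity_unit_interval :: "(unit_interval \<times> unit_interval) filter"
  where "uniformity_unit_interval = (INF e\<in>{0 <..}. principal {(x, y). dist x y < e})"

definition open_unit_interval :: "unit_interval set \<Rightarrow> bool"
  where "open_unit_interval S = (\<forall>x\<in>S. \<forall>\<^sub>F (x', y) in uniformity. x' = x \<longrightarrow> y \<in> S)"

instance
proof
  fix x y z :: unit_interval
  show "dist x y = 0 \<longleftrightarrow> x = y" by transfer simp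
  show "dist x y \<le> dist x z + dist y z" by transfer (rule dist_triangle2)
qed (rule open_unit_interval_def uniformity_unit_interval_def)+

end

text \<open>
  Bochner integrals of \<open>C([0,1])\<close>-valued functions require that space to be an instance of
  \<open>second_countable_topology\<close>. The instance below is proved for compact metric domains; the
  class is needed because instances are indexed by sorts.
\<close>

class compact_metric_space = metric_space +
  assumes compact_UNIV_metric: "compact (UNIV :: 'a set)"

instance unit_interval :: compact_metric_space
proof
  have "continuous_on {0..1} Unit_interval"
    unfolding continuous_on_iff
    by (auto simp: dist_unit_interval.rep_eq Unit_interval_inverse)
  then have "compact (Unit_interval ` {0..1})"
    by (rule compact_continuous_image) simp
  moreover have "Unit_interval ` {0..1} = UNIV"
    by (metis (no_types) type_definition.Abs_image type_definition_unit_interval)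
  ultimately show "compact (UNIV :: unit_interval set)" by simp
qed

lemma separable_metric_imp_second_countable:
  fixes D :: "'a::metric_space set"
  assumes cD: "countable D" and dense: "\<And>x e. 0 < e \<Longrightarrow> \<exists>d\<in>D. dist d x < e"
  shows "\<exists>B::'a set set. countable B \<and> open = generate_topology B"
proof -
  define B where "B = (\<lambda>(d, n::nat). ball d (1 / real (Suc n))) ` (D \<times> UNIV)"
  have cB: "countable B" unfolding B_def using cD by auto
  have "topological_basis B"
  proof (rule topological_basisI)
    show "open b" if "b \<in> B" for b using that by (auto simp: B_def)
    fix S :: "'a set" and x assume "open S" "x \<in> S"
    then obtain e where e: "0 < e" "ball x e \<subseteq> S"
      by (auto simp: open_contains_ball)
    obtain n where n: "1 / real (Suc n) < e / 2"
      by (rule nat_approx_posE[of "e/2"]) (use e(1) in auto)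
    obtain d where d: "d \<in> D" "dist d x < 1 / real (Suc n)"
      using dense[of "1 / real (Suc n)" x] by auto
    have "ball d (1 / real (Suc n)) \<subseteq> ball x e"
    proof
      fix y assume "y \<in> ball d (1 / real (Suc n))"
      then have "dist x y < e"
        using d(2) n dist_triangle[of x y d] by (simp add: dist_commute)
      then show "y \<in> ball x e" by simp
    qed
    then have "x \<in> ball d (1 / real (Suc n))" "ball d (1 / real (Suc n)) \<subseteq> S"
      using d(2) e(2) by auto
    moreover have "ball d (1 / real (Suc n)) \<in> B" unfolding B_def using d(1) by force
    ultimately show "\<exists>b\<in>B. x \<in> b \<and> b \<subseteq> S" by blast
  qed
  then show ?thesis
    using cB by (metis topological_basis_imp_subbasis)
qed

instance bcontfun ::
  (compact_metric_space, "{metric_space, second_countable_topology}") second_countable_topology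
proof
  have net: "\<exists>F::'a set. finite F \<and> (\<forall>x. \<exists>y\<in>F. dist x y < 1 / real (Suc m))" for m
  proof -
    have "0 < 1 / real (Suc m)" by simp
    then obtain F :: "'a set"
      where F: "finite F" "UNIV \<subseteq> (\<Union>y\<in>F. ball y (1 / real (Suc m)))"
      using compact_UNIV_metric[where 'a='a] unfolding compact_eq_totally_bounded by blast
    have "\<exists>y\<in>F. dist x y < 1 / real (Suc m)" for x
      using subsetD[OF F(2), of x] by (auto simp: dist_commute)
    then show ?thesis using F(1) by blast
  qed
  then obtain F :: "nat \<Rightarrow> 'a set"
    where F: "\<And>m. finite (F m)" "\<And>m x. \<exists>y\<in>F m. dist x y < 1 / real (Suc m)"
    by metis
  define x where "x m = (SOME l. set l = F m)" for m
  have x: "set (x m) = F m" for m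
    unfolding x_def using finite_list[OF F(1)] by (rule someI_ex)
  define r :: "nat \<Rightarrow> ('a \<Rightarrow>\<^sub>C 'b) \<Rightarrow> nat \<Rightarrow> 'b"
    where "r m f i = apply_bcontfun f (x m ! i)" for m f i
  define C :: "nat \<Rightarrow> nat \<Rightarrow> ('a \<Rightarrow>\<^sub>C 'b) set"
    where "C m n = {f. \<forall>s t. dist s t < 1 / real (Suc m) \<longrightarrow>
      dist (apply_bcontfun f s) (apply_bcontfun f t) < 1 / real (Suc n)}" for m n
  have "\<exists>T. countable T \<and> T \<subseteq> C m n \<and> r m ` C m n \<subseteq> closure (r m ` T)" for m n
  proof -
    obtain T where T: "countable T" "T \<subseteq> r m ` C m n" "r m ` C m n \<subseteq> closure T"
      using separable by blast
    from T(1,2) obtain T' where "countable T'" "T' \<subseteq> C m n" "T = r m ` T'"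
      using countable_subset_image by metis
    with T show ?thesis by blast
  qed
  then obtain T where T: "\<And>m n. countable (T m n)" "\<And>m n. T m n \<subseteq> C m n"
      "\<And>m n. r m ` C m n \<subseteq> closure (r m ` T m n)"
    by metis
  define D where "D = (\<Union>m n. T m n)"
  have "countable D" unfolding D_def using T(1) by auto
  moreover have "\<exists>d\<in>D. dist d f < e" if "0 < e" for f e
  proof -
    from that have "0 < e / 4" by simp
    then obtain n where n: "1 / real (Suc n) < e / 4"
      by (rule nat_approx_posE)
    define \<delta> where "\<delta> = 1 / real (Suc n)"
    have \<delta>: "0 < \<delta>" "\<delta> < e / 4" using n by (auto simp: \<delta>_def)
    have "uniformly_continuous_on UNIV (apply_bcontfun f)"
      by (intro compact_uniformly_continuous compact_UNIV_metric) auto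
    then obtain \<eta> where \<eta>: "0 < \<eta>"
      "\<And>s t. dist s t < \<eta> \<Longrightarrow> dist (apply_bcontfun f s) (apply_bcontfun f t) < \<delta>"
      unfolding uniformly_continuous_on_def using \<delta>(1) by (auto simp: dist_commute)
    obtain m where m: "1 / real (Suc m) < \<eta>"
      by (rule nat_approx_posE[OF \<eta>(1)])
    have f: "f \<in> C m n" using \<eta>(2) m by (auto simp: C_def \<delta>_def)
    define U where "U = Pi\<^sub>E UNIV (\<lambda>i. if i < length (x m) then ball (r m f i) \<delta> else UNIV)"
    have "open U" unfolding U_def
      by (rule open_PiE) (auto intro: finite_subset[of _ "{..<length (x m)}"] split: if_splits)
    moreover have "r m f \<in> U" using \<delta>(1) by (auto simp: U_def)
    moreover have "r m f \<in> closure (r m ` T m n)" using T(3) f by blast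
    ultimately have "U \<inter> r m ` T m n \<noteq> {}"
      using open_Int_closure_eq_empty[of U "r m ` T m n"] by blast
    then obtain d where d: "d \<in> T m n" "r m d \<in> U" by blast
    have dC: "d \<in> C m n" using d(1) T(2) by blast
    have "dist (apply_bcontfun d t) (apply_bcontfun f t) \<le> 3 * \<delta>" for t
    proof -
      obtain y where y: "y \<in> F m" "dist t y < 1 / real (Suc m)" using F(2) by blast
      then obtain i where i: "i < length (x m)" "y = x m ! i"
        using x by (metis in_set_conv_nth)
      have "r m d i \<in> (if i < length (x m) then ball (r m f i) \<delta> else UNIV)"
        using d(2) unfolding U_def by (rule PiE_mem) simp
      then have "dist (apply_bcontfun f y) (apply_bcontfun d y) < \<delta>"
        using i by (simp add: r_def)
      moreover have "dist (apply_bcontfun d t) (apply_bcontfun d y) < \<delta>"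
        using dC y(2) by (auto simp: C_def \<delta>_def)
      moreover have "dist (apply_bcontfun f t) (apply_bcontfun f y) < \<delta>"
        using f y(2) by (auto simp: C_def \<delta>_def)
      ultimately show ?thesis
        using dist_triangle[of "apply_bcontfun d t" "apply_bcontfun f t" "apply_bcontfun d y"]
          dist_triangle[of "apply_bcontfun d y" "apply_bcontfun f t" "apply_bcontfun f y"]
        by (simp add: dist_commute)
    qed
    then have "dist d f \<le> 3 * \<delta>" by (rule dist_bound)
    then have "dist d f < e" using \<delta> by simp
    then show ?thesis using d(1) by (auto simp: D_def)
  qed
  ultimately show "\<exists>B::('a \<Rightarrow>\<^sub>C 'b) set set. countable B \<and> open = generate_topology B"
    by (rule separable_metric_imp_second_countable)
qed

instance bcontfun :: (metric_space, banach) banach ..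

type_synonym C01 = "unit_interval \<Rightarrow>\<^sub>C real"

text \<open>
  Processes are indexed by real times but only their values at times in \<open>[0,1]\<close> matter.
  \<open>sample_path X \<omega>\<close> is meaningful whenever \<open>t \<mapsto> X t \<omega>\<close> is continuous on \<open>[0,1]\<close>.
\<close>

definition sample_path :: "(real \<Rightarrow> 'a \<Rightarrow> real) \<Rightarrow> 'a \<Rightarrow> C01" where
  "sample_path X \<omega> = Bcontfun (\<lambda>t. X (val01 t) \<omega>)"

definition path_law :: "'a measure \<Rightarrow> (real \<Rightarrow> 'a \<Rightarrow> real) \<Rightarrow> C01 measure" where
  "path_law M X = distr M borel (sample_path X)"

lemma apply_sample_path:
  assumes "continuous_on {0..1} (\<lambda>t. X t \<omega>)"
  shows "apply_bcontfun (sample_path X \<omega>) u = X (val01 u) \<omega>"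
proof -
  have cval: "continuous_on UNIV val01"
    unfolding continuous_on_iff by (auto simp: dist_unit_interval.rep_eq)
  have "continuous_on UNIV (\<lambda>t. X (val01 t) \<omega>)"
    by (rule continuous_on_compose2[OF assms cval]) (use val01 in auto)
  moreover from this have "bounded (range (\<lambda>t. X (val01 t) \<omega>))"
    by (intro compact_imp_bounded compact_continuous_image compact_UNIV_metric)
  ultimately show ?thesis
    unfolding sample_path_def by (subst Bcontfun_inverse) (auto simp: bcontfun_def)
qed


section \<open>Gaussian processes\<close>

definition normal_law :: "real \<Rightarrow> real \<Rightarrow> real measure" where
  "normal_law m \<sigma> =
    (if \<sigma> = 0 then return borel m else density lborel (\<lambda>x. ennreal (normal_density m \<sigma> x)))"

definition gaussian_rv :: "'a measure \<Rightarrow> ('a \<Rightarrow> real) \<Rightarrow> bool" where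
  "gaussian_rv M Y \<longleftrightarrow>
    Y \<in> borel_measurable M \<and> (\<exists>m \<sigma>. 0 \<le> \<sigma> \<and> distr M borel Y = normal_law m \<sigma>)"

definition gaussian_process :: "'a measure \<Rightarrow> (real \<Rightarrow> 'a \<Rightarrow> real) \<Rightarrow> bool" where
  "gaussian_process M X \<longleftrightarrow>
    (\<forall>T a. finite T \<and> T \<subseteq> {0..1} \<longrightarrow> gaussian_rv M (\<lambda>\<omega>. \<Sum>t\<in>T. a t * X t \<omega>))"

definition continuous_centered_gaussian_process ::
    "'a measure \<Rightarrow> (real \<Rightarrow> 'a \<Rightarrow> real) \<Rightarrow> (real \<Rightarrow> real \<Rightarrow> real) \<Rightarrow> bool" where
  "continuous_centered_gaussian_process M X k \<longleftrightarrow>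
    prob_space M \<and>
    gaussian_process M X \<and>
    (\<forall>\<omega>\<in>space M. continuous_on {0..1} (\<lambda>t. X t \<omega>)) \<and>
    (\<forall>t\<in>{0..1}. (\<integral>\<omega>. X t \<omega> \<partial>M) = 0) \<and>
    (\<forall>s\<in>{0..1}. \<forall>t\<in>{0..1}. (\<integral>\<omega>. X s \<omega> * X t \<omega> \<partial>M) = k s t)"

definition self_similar_cov :: "real \<Rightarrow> (real \<Rightarrow> real \<Rightarrow> real) \<Rightarrow> bool" where
  "self_similar_cov H k \<longleftrightarrow>
    (\<forall>c>0. \<forall>s\<in>{0..1}. \<forall>t\<in>{0..1}. c * s \<in> {0..1} \<longrightarrow> c * t \<in> {0..1} \<longrightarrow>
      k (c * s) (c * t) = c powr (2 * H) * k s t)"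

definition measure_support :: "'a::topological_space measure \<Rightarrow> 'a set" where
  "measure_support \<mu> =
    {x \<in> space \<mu>. \<forall>U. open U \<longrightarrow> x \<in> U \<longrightarrow> 0 < emeasure \<mu> (U \<inter> space \<mu>)}"


section \<open>Reproducing kernel Hilbert space of a Gaussian random variable\<close>

definition gaussian_L2_closure ::
    "'a measure \<Rightarrow> ('a \<Rightarrow> 'e::real_normed_vector) \<Rightarrow> ('a \<Rightarrow> real) set" where
  "gaussian_L2_closure M Z =
    {\<xi> \<in> borel_measurable M. integrable M (\<lambda>\<omega>. (\<xi> \<omega>)\<^sup>2) \<and>
      (\<forall>e>0. \<exists>\<alpha> :: 'e \<Rightarrow>\<^sub>L real.
        (\<integral>\<^sup>+\<omega>. ennreal ((\<xi> \<omega> - blinfun_apply \<alpha> (Z \<omega>))\<^sup>2) \<partial>M) < ennreal e)}"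

definition rkhs ::
    "'a measure \<Rightarrow> ('a \<Rightarrow> 'e::{banach, second_countable_topology}) \<Rightarrow> 'e set" where
  "rkhs M Z = {\<integral>\<omega>. \<xi> \<omega> *\<^sub>R Z \<omega> \<partial>M | \<xi>. \<xi> \<in> gaussian_L2_closure M Z}"

text \<open>
  The norm is well defined because \<open>\<xi> \<mapsto> E[\<xi> Z]\<close> is injective (modulo almost sure equality)
  on the \<open>L\<^sup>2\<close>-closure.
\<close>

definition rkhs_norm ::
    "'a measure \<Rightarrow> ('a \<Rightarrow> 'e::{banach, second_countable_topology}) \<Rightarrow> 'e \<Rightarrow> real" where
  "rkhs_norm M Z h =
    (THE r. \<exists>\<xi>\<in>gaussian_L2_closure M Z.
      h = (\<integral>\<omega>. \<xi> \<omega> *\<^sub>R Z \<omega> \<partial>M) \<and> r = sqrt (\<integral>\<omega>. (\<xi> \<omega>)\<^sup>2 \<partial>M))"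


section \<open>Tightness, convergence in law and large deviations\<close>

definition tight_family :: "'i set \<Rightarrow> ('i \<Rightarrow> 'e::topological_space measure) \<Rightarrow> bool" where
  "tight_family A \<nu> \<longleftrightarrow>
    (\<forall>\<eta>>0. \<exists>K. compact K \<and> (\<forall>i\<in>A. measure (\<nu> i) (- K) \<le> \<eta>))"

definition weakly_converges ::
    "('i \<Rightarrow> 'e::topological_space measure) \<Rightarrow> 'e measure \<Rightarrow> 'i filter \<Rightarrow> bool" where
  "weakly_converges \<nu> \<nu>0 F \<longleftrightarrow>
    (\<forall>\<phi> :: 'e \<Rightarrow>\<^sub>C real. ((\<lambda>i. \<integral>x. apply_bcontfun \<phi> x \<partial>\<nu> i) \<longlongrightarrow> (\<integral>x. apply_bcontfun \<phi> x \<partial>\<nu>0)) F)"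

definition log_prob :: "real \<Rightarrow> ereal" where
  "log_prob p = (if p \<le> 0 then -\<infinity> else ereal (ln p))"

definition rate_function :: "('e::topological_space \<Rightarrow> ennreal) \<Rightarrow> bool" where
  "rate_function I \<longleftrightarrow>
    (\<forall>a. closed {x. I x \<le> a}) \<and> (\<forall>a<\<infinity>. compact {x. I x \<le> a})"

definition satisfies_LDP ::
    "(real \<Rightarrow> 'e::topological_space measure) \<Rightarrow> (real \<Rightarrow> real) \<Rightarrow> ('e \<Rightarrow> ennreal) \<Rightarrow> bool" where
  "satisfies_LDP \<nu> g I \<longleftrightarrow>
    rate_function I \<and>
    filterlim g at_top (at_right 0) \<and>
    (\<forall>F. closed F \<longrightarrow>
      Limsup (at_right 0) (\<lambda>\<epsilon>. ereal (1 / g \<epsilon>) * log_prob (measure (\<nu> \<epsilon>) F))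
        \<le> - (INF x\<in>F. enn2ereal (I x))) \<and>
    (\<forall>G. open G \<longrightarrow>
      Liminf (at_right 0) (\<lambda>\<epsilon>. ereal (1 / g \<epsilon>) * log_prob (measure (\<nu> \<epsilon>) G))
        \<ge> - (INF x\<in>G. enn2ereal (I x)))"

end

(*
  By self-similarity the rescaled process Z_eps = g(eps)^{1/2} X(eps .) has covariance
  g(eps) \<integral> eps^{2H} k^H(s,t) d\<mu>(H), an average of k^H(s,t) over probability measures which
  concentrate at H_0 as eps \<rightarrow> 0; hence it converges to k^{H_0}, and the increment bound with
  constants C, \<beta> holds uniformly in eps.

  One chaining estimate, P(Z outside the Hoelder ball of radius D l) \<le> A exp(-l^2/4C), valid for every
  process with sub-Gaussian increments, gives tightness, exponential tightness and square
  integrability of the norm.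

  Weak convergence: on a Hoelder ball (a compact set) a bounded continuous functional is uniformly
  approximated by trigonometric polynomials in the point evaluations (Stone--Weierstrass), whose
  expectations depend on the covariance only and so converge.

  Large deviations: the rate is h \<mapsto> sup_\<alpha> (\<alpha>(h) - Var \<alpha>(Z_0) / 2), \<alpha> ranging over finite
  combinations of evaluations. It equals |h|^2/2 on the RKHS and is infinite elsewhere: since the
  quadratic part is strictly convex, a maximizing sequence is Cauchy in L^2 and its limit represents h.
  The upper bound is Chernoff's bound on a finite cover of a compact set. For the lower bound near
  h = E[\<alpha>(Z_0) Z_0], tilt by exp(s \<alpha>(Z_eps) - s^2 Var/2) with s = g(eps)^{1/2}. Under the tilted
  measure Z_eps - s E[\<alpha>(Z_eps) Z_eps] has increments which are sub-Gaussian with the same constants,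
  as the real moment generating function shows, so the chaining estimate applies to it again and no
  Cameron--Martin theorem is needed.
*)
theory Submission
  imports Defs "HOL-Complex_Analysis.Great_Picard"
begin

section \<open>Centered Gaussian variables and point evaluations\<close>

text \<open>A Gaussian process prescribes only the laws of finite combinations of its values,
  whereas the RKHS is defined through the whole dual of C([0,1]). Probabilistic information is
  therefore stated for \<open>eval_span\<close>, and a general functional is reached by composing it
  with Bernstein operators: they use finitely many values, do not increase the norm and converge
  strongly, so square integrability of the norm turns them into an L^2 approximation. Finite
  combinations also make every variance a quadratic form in the kernel, so the limit eps -> 0 only
  has to supply convergence of the kernel at pairs of times. The increment bound suggests Hoelder
  exponents below \<beta>/2. The choice \<beta>/4 leaves, at dyadic level n, a threshold that
  exceeds the standard deviation by a factor of order 2^(n \<beta>/4), so all levels together cost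
  only a constant. Since X^eps is Z_eps divided by g(eps)^{1/2}, a radius l for X^eps is a radius
  g(eps)^{1/2} l for Z_eps, and the Gaussian tail in the radius becomes decay at speed g.\<close>

lemma nn_integral_normal_density_exp:
  assumes "0 < \<sigma>"
  shows "(\<integral>\<^sup>+x. ennreal (normal_density 0 \<sigma> x * exp x) \<partial>lborel) = ennreal (exp (\<sigma>\<^sup>2 / 2))"
proof -
  \<comment> \<open>Completing the square: the exponential weight moves the mean from 0 to the
    variance, and what remains is the total mass of a shifted normal density.\<close>
  have "normal_density 0 \<sigma> x * exp x = exp (\<sigma>\<^sup>2 / 2) * normal_density (\<sigma>\<^sup>2) \<sigma> x" for x
  proof -
    have "- (x - 0)\<^sup>2 / (2 * \<sigma>\<^sup>2) + x = \<sigma>\<^sup>2 / 2 + - (x - \<sigma>\<^sup>2)\<^sup>2 / (2 * \<sigma>\<^sup>2)"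
      using assms by (simp add: field_simps power2_eq_square)
    then show ?thesis
      unfolding normal_density_def by (simp add: exp_add[symmetric] mult.left_commute)
  qed
  then show ?thesis
    using prob_space.emeasure_space_1[OF prob_space_normal_density[OF assms, of "\<sigma>\<^sup>2"]]
    by (simp add: ennreal_mult nn_integral_cmult emeasure_density)
qed

text \<open>All formulas are written through the second moment, so that they cover the degenerate
  case \<sigma> = 0 too. There \<open>normal_law\<close> is a point mass without density, which is
  why that case is treated separately.\<close>

lemma centered_gaussian_rv:
  assumes M: "prob_space M" and Y: "gaussian_rv M Y" and mean: "(\<integral>w. Y w \<partial>M) = 0"
  shows centered_gaussian_rv_integrable: "integrable M (\<lambda>w. (Y w)\<^sup>2)"
    and centered_gaussian_rv_exp:
      "(\<integral>\<^sup>+w. ennreal (exp (Y w)) \<partial>M) = ennreal (exp ((\<integral>w. (Y w)\<^sup>2 \<partial>M) / 2))"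
    and centered_gaussian_rv_cos: "(\<integral>w. cos (Y w) \<partial>M) = exp (- (\<integral>w. (Y w)\<^sup>2 \<partial>M) / 2)"
    and centered_gaussian_rv_sin: "(\<integral>w. sin (Y w) \<partial>M) = 0"
proof -
  interpret prob_space M by fact
  from Y obtain m \<sigma> where [measurable]: "Y \<in> borel_measurable M" and "0 \<le> \<sigma>"
    and d: "distr M borel Y = normal_law m \<sigma>"
    unfolding gaussian_rv_def by blast
  have "integrable M (\<lambda>w. (Y w)\<^sup>2) \<and>
      (\<integral>\<^sup>+w. ennreal (exp (Y w)) \<partial>M) = ennreal (exp ((\<integral>w. (Y w)\<^sup>2 \<partial>M) / 2)) \<and>
      (\<integral>w. cos (Y w) \<partial>M) = exp (- (\<integral>w. (Y w)\<^sup>2 \<partial>M) / 2) \<and> (\<integral>w. sin (Y w) \<partial>M) = 0"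
  proof (cases "\<sigma> = 0")
    case True
    then have d: "distr M borel Y = return borel m" using d by (simp add: normal_law_def)
    have "AE y in distr M borel Y. y = m"
      unfolding d by (subst AE_return) auto
    then have ae: "AE w in M. Y w = m" by (subst (asm) AE_distr_iff) auto
    have "(\<integral>w. Y w \<partial>M) = (\<integral>w. m \<partial>M)" by (rule integral_cong_AE) (use ae in auto)
    then have "m = 0" using mean by (simp add: prob_space)
    with ae have ae: "AE w in M. Y w = 0" by simp
    have 1: "(\<integral>w. (Y w)\<^sup>2 \<partial>M) = (\<integral>w. 0 \<partial>M)"
      "(\<integral>w. cos (Y w) \<partial>M) = (\<integral>w. 1 \<partial>M)" "(\<integral>w. sin (Y w) \<partial>M) = (\<integral>w. 0 \<partial>M)"
      by (rule integral_cong_AE; use ae in auto)+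
    have 2: "integrable M (\<lambda>w. (Y w)\<^sup>2) \<longleftrightarrow> integrable M (\<lambda>w. 0::real)"
      by (rule integrable_cong_AE) (use ae in auto)
    have 3: "(\<integral>\<^sup>+w. ennreal (exp (Y w)) \<partial>M) = (\<integral>\<^sup>+w. 1 \<partial>M)"
      by (rule nn_integral_cong_AE) (use ae in auto)
    show ?thesis
      unfolding 1 2 3 by (simp add: prob_space emeasure_space_1)
  next
    case False
    then have \<sigma>: "0 < \<sigma>" and D: "distributed M lborel Y (normal_density m \<sigma>)"
      using d \<open>0 \<le> \<sigma>\<close> by (auto simp: normal_law_def distributed_def cong: distr_cong)
    have "m = 0" using normal_distributed_expectation[OF \<sigma> D] mean by simp
    note D = D[unfolded this]
    have v: "(\<integral>w. (Y w)\<^sup>2 \<partial>M) = \<sigma>\<^sup>2"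
      using normal_distributed_variance[OF \<sigma> D] mean by simp
    \<comment> \<open>The integral of a non-integrable function is 0 by convention, so the positive
      value found in \<open>v\<close> already forces integrability.\<close>
    have i: "integrable M (\<lambda>w. (Y w)\<^sup>2)"
      by (rule ccontr) (use v \<sigma> in \<open>auto dest: not_integrable_integral_eq\<close>)
    have e: "(\<integral>\<^sup>+w. ennreal (exp (Y w)) \<partial>M) = ennreal (exp (\<sigma>\<^sup>2 / 2))"
      using distributed_nn_integral[OF D, of "\<lambda>x. ennreal (exp x)"]
        nn_integral_normal_density_exp[OF \<sigma>]
      by (simp add: ennreal_mult)
    \<comment> \<open>The cosine and sine integrals are the real and imaginary part of the standard
      normal characteristic function at the point \<sigma>.\<close>
    have "distributed M lborel (\<lambda>w. (Y w - 0) / \<sigma>) std_normal_density"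
      using D normal_standard_normal_convert[OF \<sigma>] by blast
    then have "distr M borel (\<lambda>w. Y w / \<sigma>) = std_normal_distribution"
      by (simp add: distributed_def cong: distr_cong)
    then have "char (distr M borel (\<lambda>w. Y w / \<sigma>)) \<sigma> = exp (- (\<sigma>\<^sup>2) / 2)"
      by (simp add: char_std_normal_distribution)
    also have "char (distr M borel (\<lambda>w. Y w / \<sigma>)) \<sigma> = (CLINT w|M. iexp (Y w))"
      unfolding char_def using \<sigma> by (subst integral_distr) auto
    finally have c: "(CLINT w|M. iexp (Y w)) = complex_of_real (exp (- (\<sigma>\<^sup>2) / 2))" .
    have int: "integrable M (\<lambda>w. iexp (Y w))"
      by (rule integrable_const_bound[where B=1]) auto
    have "(\<integral>w. Re (iexp (Y w)) \<partial>M) = exp (- (\<sigma>\<^sup>2) / 2)"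
      "(\<integral>w. Im (iexp (Y w)) \<partial>M) = 0"
      using integral_Re[OF int] integral_Im[OF int] unfolding c by (simp_all add: Re_exp Im_exp)
    then show ?thesis
      using i e by (simp add: v Re_exp Im_exp)
  qed
  then show "integrable M (\<lambda>w. (Y w)\<^sup>2)"
    "(\<integral>\<^sup>+w. ennreal (exp (Y w)) \<partial>M) = ennreal (exp ((\<integral>w. (Y w)\<^sup>2 \<partial>M) / 2))"
    "(\<integral>w. cos (Y w) \<partial>M) = exp (- (\<integral>w. (Y w)\<^sup>2 \<partial>M) / 2)" "(\<integral>w. sin (Y w) \<partial>M) = 0"
    by blast+
qed

section \<open>Finite combinations of point evaluations\<close>

definition evaluation :: "unit_interval \<Rightarrow> C01 \<Rightarrow>\<^sub>L real" where
  "evaluation u = Blinfun (\<lambda>f. apply_bcontfun f u)"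

lemma evaluation_apply [simp]: "blinfun_apply (evaluation u) f = apply_bcontfun f u"
proof -
  have "bounded_linear (\<lambda>f :: C01. apply_bcontfun f u)"
    by (rule bounded_linear_intro[where K = 1]) (use norm_bounded[of f u for f :: C01] in auto)
  then show ?thesis unfolding evaluation_def by (simp add: bounded_linear_Blinfun_apply)
qed

text \<open>The functionals whose law the definition of a Gaussian process gives directly; the rest
  of the dual is reached by approximation.\<close>

definition eval_span :: "(C01 \<Rightarrow>\<^sub>L real) set" where
  "eval_span = span (range evaluation)"

lemma evaluation_in_span [simp, intro]: "evaluation u \<in> eval_span"
  unfolding eval_span_def by (auto intro: span_base)

lemma eval_span_closed [simp, intro]:
  "0 \<in> eval_span"
  "\<alpha> \<in> eval_span \<Longrightarrow> \<beta> \<in> eval_span \<Longrightarrow> \<alpha> + \<beta> \<in> eval_span"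
  "\<alpha> \<in> eval_span \<Longrightarrow> \<beta> \<in> eval_span \<Longrightarrow> \<alpha> - \<beta> \<in> eval_span"
  "\<alpha> \<in> eval_span \<Longrightarrow> c *\<^sub>R \<alpha> \<in> eval_span"
  "(\<And>i. i \<in> I \<Longrightarrow> f i \<in> eval_span) \<Longrightarrow> sum f I \<in> eval_span"
  unfolding eval_span_def
  by (auto intro: span_zero span_add span_diff span_scale span_sum)

lemma eval_span_as_sum:
  assumes "\<alpha> \<in> eval_span"
  obtains T a where "finite T" "T \<subseteq> {0..1}"
    "\<And>f. blinfun_apply \<alpha> f = (\<Sum>t\<in>T. a t * apply_bcontfun f (Unit_interval t))"
proof -
  from assms obtain S r where S: "finite S" "S \<subseteq> range evaluation" and \<alpha>: "\<alpha> = (\<Sum>\<delta>\<in>S. r \<delta> *\<^sub>R \<delta>)"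
    unfolding eval_span_def span_explicit by blast
  \<comment> \<open>One time is selected for each functional in the support, so that the sum over
    functionals becomes a sum over a set of times without repetition.\<close>
  from S obtain U where U: "finite U" "S = evaluation ` U" "inj_on evaluation U"
    by (metis finite_subset_image finite_image_iff subset_image_inj)
  have inj: "inj_on val01 U" by (simp add: val01_inject inj_on_def)
  have "blinfun_apply \<alpha> f =
      (\<Sum>t\<in>val01 ` U. r (evaluation (Unit_interval t)) * apply_bcontfun f (Unit_interval t))" for f
    unfolding \<alpha> U(2)
    by (simp add: sum.reindex inj U(3) blinfun.sum_left blinfun.scaleR_left val01_inverse)
  then show thesis
    using U(1) val01 by (intro that[of "val01 ` U"]) auto
qed

lemma borel_measurable_blinfun_apply [measurable (raw)]:
  fixes Z :: "'a \<Rightarrow> 'e::real_normed_vector" and \<alpha> :: "'e \<Rightarrow>\<^sub>L 'f::real_normed_vector"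
  assumes "Z \<in> borel_measurable M"
  shows "(\<lambda>w. blinfun_apply \<alpha> (Z w)) \<in> borel_measurable M"
  using borel_measurable_continuous_onI[OF linear_continuous_on[OF blinfun.bounded_linear_right]] assms
  by (rule measurable_compose_rev)

section \<open>Borel measurability of random paths\<close>

lemma le_on_rationals_imp_le:
  fixes f :: "unit_interval \<Rightarrow> real"
  assumes "continuous_on UNIV f"
    and "\<And>q::rat. of_rat q \<in> {0..1::real} \<Longrightarrow> f (Unit_interval (of_rat q)) \<le> b"
  shows "f u \<le> b"
proof (rule ccontr)
  assume "\<not> f u \<le> b"
  then have "u \<in> f -` {b<..}" by simp
  moreover have "open (f -` {b<..})"
    using assms(1) by (simp add: continuous_on_open_vimage)
  ultimately obtain e where e: "0 < e" "\<And>v. dist v u < e \<Longrightarrow> b < f v"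
    unfolding open_dist by auto
  have u: "val01 u \<in> {0..1}" by (rule val01)
  have "max 0 (val01 u - e) < min 1 (val01 u + e)" using e(1) u by auto
  then obtain q where q: "max 0 (val01 u - e) < of_rat q" "of_rat q < min 1 (val01 u + e)"
    using of_rat_dense by blast
  then have "of_rat q \<in> {0..1::real}" "dist (Unit_interval (of_rat q)) u < e"
    by (auto simp: dist_unit_interval.rep_eq Unit_interval_inverse dist_real_def)
  then show False using e(2) assms(2) by (metis linorder_not_less)
qed

text \<open>By continuity a closed ball of the supremum norm is described by countably many
  conditions, one for each rational time; by separability every open set is a countable union of
  such balls.\<close>

lemma borel_measurable_C01I:
  fixes Z :: "'a \<Rightarrow> C01"
  assumes [measurable]: "\<And>u. (\<lambda>w. apply_bcontfun (Z w) u) \<in> borel_measurable M"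
  shows "Z \<in> borel_measurable M"
proof -
  have cb: "Z -` cball f r \<inter> space M \<in> sets M" for f r
  proof -
    define P where "P w q \<longleftrightarrow> of_rat q \<in> {0..1::real} \<longrightarrow>
      \<bar>apply_bcontfun f (Unit_interval (of_rat q)) - apply_bcontfun (Z w) (Unit_interval (of_rat q))\<bar> \<le> r"
      for w and q :: rat
    have "Z -` cball f r \<inter> space M = {w \<in> space M. \<forall>q. P w q}"
    proof (intro set_eqI iffI)
      fix w assume "w \<in> Z -` cball f r \<inter> space M"
      then show "w \<in> {w \<in> space M. \<forall>q. P w q}"
        using order_trans[OF dist_bounded[of f _ "Z w"]] by (auto simp: dist_real_def P_def)
    next
      fix w assume w: "w \<in> {w \<in> space M. \<forall>q. P w q}"
      have "\<bar>apply_bcontfun f u - apply_bcontfun (Z w) u\<bar> \<le> r" for u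
        by (rule le_on_rationals_imp_le[where f="\<lambda>u. \<bar>apply_bcontfun f u - apply_bcontfun (Z w) u\<bar>"])
          (use w in \<open>auto simp: P_def intro!: continuous_intros\<close>)
      then have "dist f (Z w) \<le> r" by (intro dist_bound) (simp add: dist_real_def)
      then show "w \<in> Z -` cball f r \<inter> space M" using w by simp
    qed
    also have "\<dots> \<in> sets M" unfolding P_def by measurable
    finally show ?thesis .
  qed
  show ?thesis
  proof (rule borel_measurableI)
    fix S :: "C01 set" assume "open S"
    obtain D :: "C01 set" where D: "countable D" "\<And>X. open X \<Longrightarrow> X \<noteq> {} \<Longrightarrow> \<exists>d\<in>D. d \<in> X"
      using countable_dense_exists by metis
    define B where "B = {(d, n). d \<in> D \<and> cball d (1 / real (Suc n)) \<subseteq> S}"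
    have "countable B"
      using D(1) by (rule countable_subset[rotated, OF countable_SIGMA[of D "\<lambda>_. UNIV"]]) (auto simp: B_def)
    have "S \<subseteq> (\<Union>(d, n)\<in>B. cball d (1 / real (Suc n)))"
    proof
      fix f assume "f \<in> S"
      with \<open>open S\<close> obtain e where e: "0 < e" "ball f e \<subseteq> S" by (auto simp: open_contains_ball)
      obtain n where n: "1 / real (Suc n) < e / 2"
        by (rule nat_approx_posE[of "e/2"]) (use e(1) in auto)
      obtain d where d: "d \<in> D" "d \<in> ball f (1 / real (Suc n))"
        using D(2)[of "ball f (1 / real (Suc n))"] by auto
      have "cball d (1 / real (Suc n)) \<subseteq> ball f e"
      proof
        fix y assume "y \<in> cball d (1 / real (Suc n))"
        then show "y \<in> ball f e" using d(2) n dist_triangle[of f y d] by simp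
      qed
      then have "(d, n) \<in> B" "f \<in> cball d (1 / real (Suc n))"
        using d e(2) by (auto simp: B_def dist_commute)
      then show "f \<in> (\<Union>(d, n)\<in>B. cball d (1 / real (Suc n)))" by blast
    qed
    moreover have "(\<Union>(d, n)\<in>B. cball d (1 / real (Suc n))) \<subseteq> S" unfolding B_def by blast
    ultimately have "S = (\<Union>(d, n)\<in>B. cball d (1 / real (Suc n)))" by (rule equalityI)
    then have "Z -` S \<inter> space M = (\<Union>(d, n)\<in>B. Z -` cball d (1 / real (Suc n)) \<inter> space M)"
      by (simp only:) blast
    also have "\<dots> \<in> sets M" using \<open>countable B\<close> cb by (intro sets.countable_UN') auto
    finally show "Z -` S \<inter> space M \<in> sets M" .
  qed
qed

section \<open>Hoelder sets and the chaining estimate\<close>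

text \<open>Each time is approached by its binary truncations, and the increments along them form a
  geometric series. Times at distance about 2^-m have truncations at level m that are at most one
  grid step apart. The constant collects this one step, the two tails 1 / (1 - q), and the factor
  \<open>2 powr \<gamma>\<close> lost by comparing the distance with 2^-(m+1).\<close>

lemma dyadic_increments_imp_hoelder:
  fixes f :: "real \<Rightarrow> real"
  assumes cont: "continuous_on {0..1} f" and "0 < \<gamma>" and "0 \<le> L"
    and q: "q = 2 powr (- \<gamma>)"
    and incr: "\<And>n k. k < 2 ^ n \<Longrightarrow> \<bar>f (real (Suc k) / 2 ^ n) - f (real k / 2 ^ n)\<bar> \<le> L * q ^ n"
    and s: "s \<in> {0..1}" and t: "t \<in> {0..1}"
  shows "\<bar>f t - f s\<bar> \<le> L * (2 powr \<gamma> * (1 + 2 / (1 - q))) * \<bar>t - s\<bar> powr \<gamma>"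
proof -
  have q01: "0 < q" "q < 1" using \<open>0 < \<gamma>\<close> unfolding q by (auto simp: powr_minus field_simps)
  define r where "r n u = nat \<lfloor>u * 2 ^ n\<rfloor>" for n and u :: real
  define d where "d n u = real (r n u) / 2 ^ n" for n u
  have r: "real (r n u) \<le> u * 2 ^ n" "u * 2 ^ n < real (r n u) + 1" "r n u \<le> 2 ^ n"
    if "u \<in> {0..1}" for n u
  proof -
    have "0 \<le> \<lfloor>u * 2 ^ n\<rfloor>" using that by simp
    then show *: "real (r n u) \<le> u * 2 ^ n" "u * 2 ^ n < real (r n u) + 1"
      unfolding r_def by (simp_all add: floor_correct of_nat_nat)
    have "u * 2 ^ n \<le> 2 ^ n" using that by (simp add: mult_left_le_one_le)
    with *(1) have "real (r n u) \<le> 2 ^ n" by linarith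
    then show "r n u \<le> 2 ^ n" by (metis of_nat_le_iff of_nat_numeral of_nat_power)
  qed
  have close: "\<bar>d n u - u\<bar> \<le> (1/2) ^ n" "d n u \<in> {0..1}" if "u \<in> {0..1}" for n u
  proof -
    have "real (r n u) \<le> 2 ^ n" using r(3)[OF that, of n] of_nat_le_iff[of "r n u" "2 ^ n", where 'a=real] by simp
    then show "d n u \<in> {0..1}" by (auto simp: d_def)
    have "d n u \<le> u" "u \<le> (real (r n u) + 1) / 2 ^ n"
      using r(1,2)[OF that, of n] by (simp_all add: d_def divide_le_eq le_divide_eq)
    then show "\<bar>d n u - u\<bar> \<le> (1/2) ^ n"
      by (simp add: d_def add_divide_distrib power_one_over)
  qed
  have step: "\<bar>f (d (Suc n) u) - f (d n u)\<bar> \<le> L * q ^ Suc n" if u: "u \<in> {0..1}" for n u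
  proof -
    \<comment> \<open>Passing from level n to n + 1 appends one binary digit: the numerator is
      doubled or doubled plus one.\<close>
    have "real (r (Suc n) u) < 2 * real (r n u) + 2" "2 * real (r n u) < real (r (Suc n) u) + 1"
      using r(1,2)[OF u, of n] r(1,2)[OF u, of "Suc n"] by auto
    then have "r (Suc n) u = 2 * r n u \<or> r (Suc n) u = Suc (2 * r n u)" by linarith
    then show ?thesis
    proof
      assume "r (Suc n) u = 2 * r n u"
      then have "d (Suc n) u = d n u" by (simp add: d_def)
      then show ?thesis using \<open>0 \<le> L\<close> q01 by simp
    next
      assume *: "r (Suc n) u = Suc (2 * r n u)"
      have "d n u = real (2 * r n u) / 2 ^ Suc n" by (simp add: d_def)
      moreover have "2 * r n u < 2 ^ Suc n" using r(3)[OF u, of "Suc n"] * by simp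
      ultimately show ?thesis using incr[of "2 * r n u" "Suc n"] * by (simp add: d_def)
    qed
  qed
  have tele: "\<bar>f (d (m + j) u) - f (d m u)\<bar> \<le> L * q ^ m / (1 - q)" if u: "u \<in> {0..1}" for m j u
  proof -
    have "\<bar>f (d (m + j) u) - f (d m u)\<bar> \<le> (\<Sum>i<j. L * q ^ m * q ^ i)"
    proof (induction j)
      case (Suc j)
      have "L * q ^ Suc (m + j) \<le> L * q ^ m * q ^ j"
        using q01 \<open>0 \<le> L\<close> mult_left_le_one_le[of "L * q ^ m * q ^ j" q]
        by (simp add: power_add mult_ac)
      then show ?case using Suc step[OF u, of "m + j"] by simp
    qed simp
    also have "\<dots> = L * q ^ m * (\<Sum>i<j. q ^ i)" by (simp add: sum_distrib_left)
    also have "(\<Sum>i<j. q ^ i) \<le> (\<Sum>i. q ^ i)"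
      using q01 by (intro sum_le_suminf) auto
    also have "\<dots> = 1 / (1 - q)" using q01 by (intro suminf_geometric) auto
    finally show ?thesis using \<open>0 \<le> L\<close> q01 by (simp add: mult_left_mono)
  qed
  have lim: "\<bar>f u - f (d m u)\<bar> \<le> L * q ^ m / (1 - q)" if u: "u \<in> {0..1}" for m u
  proof -
    have "(\<lambda>j. (1/2::real) ^ (m + j)) \<longlonglongrightarrow> 0"
      by (subst add.commute, rule LIMSEQ_ignore_initial_segment) (auto intro: LIMSEQ_power_zero)
    then have "(\<lambda>j. d (m + j) u - u) \<longlonglongrightarrow> 0"
      by (rule Lim_null_comparison[rotated]) (use close[OF u] in auto)
    then have "(\<lambda>j. d (m + j) u) \<longlonglongrightarrow> u" by (simp add: LIM_zero_iff)
    then have "(\<lambda>j. f (d (m + j) u)) \<longlonglongrightarrow> f u"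
      by (rule continuous_on_tendsto_compose[OF cont]) (use u close[OF u] in auto)
    then have "(\<lambda>j. \<bar>f (d (m + j) u) - f (d m u)\<bar>) \<longlonglongrightarrow> \<bar>f u - f (d m u)\<bar>"
      by (intro tendsto_intros)
    then show ?thesis by (rule LIMSEQ_le_const2) (use tele[OF u] in auto)
  qed
  show ?thesis
  proof (cases "s = t")
    case False
    define \<delta> where "\<delta> = \<bar>t - s\<bar>"
    have \<delta>: "0 < \<delta>" "\<delta> \<le> 1" using False s t by (auto simp: \<delta>_def)
    \<comment> \<open>The level adapted to the distance: 2^-(m+1) < \<delta> \<le> 2^-m. The upper
      bound makes the two truncations neighbours, the lower one turns \<open>q ^ m\<close> into a
      power of \<delta>.\<close>
    define m where "m = (LEAST n. (1/2) ^ Suc n < \<delta>)"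
    have "\<exists>n. (1/2) ^ n < \<delta>" using \<delta>(1) by (intro real_arch_pow_inv) auto
    then obtain n where "(1/2) ^ n < \<delta>" ..
    moreover have "(1/2::real) ^ Suc n \<le> (1/2) ^ n" by simp
    ultimately have "(1/2) ^ Suc n < \<delta>" by linarith
    then have m1: "(1/2) ^ Suc m < \<delta>" unfolding m_def by (rule LeastI)
    have m2: "\<delta> \<le> (1/2) ^ m"
    proof (cases m)
      case (Suc m')
      then have "\<not> (1/2) ^ Suc m' < \<delta>" unfolding m_def by (intro not_less_Least) auto
      then show ?thesis using Suc by simp
    qed (use \<delta> in simp)
    have "\<bar>t * 2 ^ m - s * 2 ^ m\<bar> \<le> 1"
    proof -
      have "\<bar>t * 2 ^ m - s * 2 ^ m\<bar> = \<delta> * 2 ^ m"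
        by (simp add: \<delta>_def abs_mult left_diff_distrib[symmetric])
      also have "\<dots> \<le> 1" using m2 by (simp add: power_divide field_simps)
      finally show ?thesis .
    qed
    then have "real (r m t) < real (r m s) + 2" "real (r m s) < real (r m t) + 2"
      using r(1,2)[OF s, of m] r(1,2)[OF t, of m] by linarith+
    then have "r m t = r m s \<or> r m t = Suc (r m s) \<or> r m s = Suc (r m t)" by linarith
    then have mid: "\<bar>f (d m t) - f (d m s)\<bar> \<le> L * q ^ m"
      using incr[of "r m s" m] incr[of "r m t" m] r(3)[OF s, of m] r(3)[OF t, of m] \<open>0 \<le> L\<close> q01
      by (auto simp: d_def abs_minus_commute)
    have "\<bar>f t - f s\<bar> \<le> L * q ^ m + 2 * (L * q ^ m / (1 - q))"
      using lim[OF s, of m] lim[OF t, of m] mid by linarith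
    also have "\<dots> = L * (1 + 2 / (1 - q)) * q ^ m" by (simp add: algebra_simps)
    also have "q ^ m \<le> 2 powr \<gamma> * \<delta> powr \<gamma>"
    proof -
      have "q ^ m = ((1/2) ^ m) powr \<gamma>"
        unfolding q by (simp add: powr_realpow[symmetric] powr_powr powr_minus powr_divide power_divide inverse_eq_divide mult.commute)
      also have "\<dots> \<le> (2 * \<delta>) powr \<gamma>" using m1 \<open>0 < \<gamma>\<close> by (intro powr_mono2) auto
      also have "\<dots> = 2 powr \<gamma> * \<delta> powr \<gamma>" by (simp add: powr_mult)
      finally show ?thesis .
    qed
    then have "L * (1 + 2 / (1 - q)) * q ^ m \<le> L * (1 + 2 / (1 - q)) * (2 powr \<gamma> * \<delta> powr \<gamma>)"
      using \<open>0 \<le> L\<close> q01 by (intro mult_left_mono) auto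
    finally show ?thesis by (simp add: \<delta>_def mult_ac)
  qed simp
qed

section \<open>Compact Hoelder sets\<close>

definition hoelder_set :: "real \<Rightarrow> real \<Rightarrow> C01 set" where
  "hoelder_set \<gamma> L = {f. apply_bcontfun f (Unit_interval 0) = 0 \<and>
    (\<forall>s t. \<bar>apply_bcontfun f s - apply_bcontfun f t\<bar> \<le> L * dist s t powr \<gamma>)}"

lemma scaleR_hoelder_set:
  assumes "0 < c"
  shows "c *\<^sub>R f \<in> hoelder_set \<gamma> (c * L) \<longleftrightarrow> f \<in> hoelder_set \<gamma> L"
proof -
  have "\<bar>c * a - c * b\<bar> \<le> c * L * e \<longleftrightarrow> \<bar>a - b\<bar> \<le> L * e" for a b e :: real
    using assms by (simp add: right_diff_distrib[symmetric] abs_mult mult.assoc)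
  then show ?thesis using assms by (simp add: hoelder_set_def)
qed

lemma dist_unit_interval_le_1: "dist (s :: unit_interval) t \<le> 1"
  using val01[of s] val01[of t] by (auto simp: dist_unit_interval.rep_eq dist_real_def)

text \<open>Paths in the set vanish at 0 and the interval has length 1, so the Hoelder constant also
  bounds the norm.\<close>

lemma hoelder_set_norm_le:
  assumes "f \<in> hoelder_set \<gamma> L" "0 \<le> \<gamma>" "0 \<le> L"
  shows "norm f \<le> L"
proof (rule norm_bound)
  fix u
  have "\<bar>apply_bcontfun f u - apply_bcontfun f (Unit_interval 0)\<bar> \<le> L * dist u (Unit_interval 0) powr \<gamma>"
    using assms(1) unfolding hoelder_set_def by blast
  also have "\<dots> \<le> L * 1"
    using dist_unit_interval_le_1 assms by (intro mult_left_mono powr_le1) auto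
  finally show "norm (apply_bcontfun f u) \<le> L" using assms(1) by (simp add: hoelder_set_def)
qed

lemma continuous_on_evaluation [continuous_intros]:
  "continuous_on S (\<lambda>f. apply_bcontfun (f :: C01) u)"
  using linear_continuous_on[OF blinfun.bounded_linear_right[of "evaluation u"]] by simp

lemma closed_hoelder_set: "closed (hoelder_set \<gamma> L)"
  unfolding hoelder_set_def
  by (intro closed_Collect_conj closed_Collect_all closed_Collect_le closed_Collect_eq continuous_intros)

text \<open>Arzela-Ascoli is applied on the real interval, where its limit \<open>g\<close> is a
  mere function. Instead of turning \<open>g\<close> into a path, the subsequence is shown to be
  Cauchy in the supremum norm; completeness and closedness then supply a limit inside the
  set.\<close>

lemma compact_hoelder_set:
  assumes "0 < \<gamma>" "0 \<le> L"
  shows "compact (hoelder_set \<gamma> L)"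
  unfolding compact_eq_seq_compact_metric
proof (rule seq_compactI)
  fix f :: "nat \<Rightarrow> C01" assume f: "\<forall>n. f n \<in> hoelder_set \<gamma> L"
  define F where "F n t = apply_bcontfun (f n) (Unit_interval t)" for n t
  have incr: "norm (F n s - F n t) \<le> L * \<bar>s - t\<bar> powr \<gamma>" if "s \<in> {0..1}" "t \<in> {0..1}" for n s t
  proof -
    have "\<bar>F n s - F n t\<bar> \<le> L * dist (Unit_interval s) (Unit_interval t) powr \<gamma>"
      using f unfolding hoelder_set_def F_def by blast
    then show ?thesis
      using that by (simp add: dist_unit_interval.rep_eq Unit_interval_inverse dist_real_def)
  qed
  have "\<exists>r g. strict_mono (r :: nat \<Rightarrow> nat) \<and>
    (\<forall>e>0. \<exists>N. \<forall>n x. n \<ge> N \<and> x \<in> {0..1} \<longrightarrow> norm (F (r n) x - g x) < e)"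
  proof (rule Arzela_Ascoli[of "{0..1::real}" F L])
    show "norm (F n x) \<le> L" if "x \<in> {0..1}" for n x
      using f hoelder_set_norm_le[of "f n" \<gamma> L] norm_bounded[of "f n" "Unit_interval x"] assms
      by (fastforce simp: F_def)
    show "\<exists>d>0. \<forall>n y. y \<in> {0..1} \<and> norm (x - y) < d \<longrightarrow> norm (F n x - F n y) < e"
      if x: "x \<in> {0..1}" and "0 < e" for x e
    proof (intro exI conjI allI impI)
      show d: "0 < (e / (L + 1)) powr (1 / \<gamma>)" using \<open>0 < e\<close> assms by simp
      fix n y assume y: "y \<in> {0..1} \<and> norm (x - y) < (e / (L + 1)) powr (1 / \<gamma>)"
      then have "norm (F n x - F n y) \<le> L * \<bar>x - y\<bar> powr \<gamma>" using incr x by blast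
      also have "\<dots> \<le> L * ((e / (L + 1)) powr (1 / \<gamma>)) powr \<gamma>"
        using y assms by (intro mult_left_mono powr_mono2) auto
      also have "\<dots> = L * (e / (L + 1))" using assms \<open>0 < e\<close> by (simp add: powr_powr)
      also have "\<dots> < e" using assms \<open>0 < e\<close> by (simp add: field_simps)
      finally show "norm (F n x - F n y) < e" .
    qed
  qed (simp, blast)
  then obtain r and g where r: "strict_mono (r :: nat \<Rightarrow> nat)" and
    g: "\<And>e. 0 < e \<Longrightarrow> \<exists>N. \<forall>n x. n \<ge> N \<and> x \<in> {0..1} \<longrightarrow> norm (F (r n) x - g x) < e"
    by blast
  have "Cauchy (f \<circ> r)"
  proof (rule metric_CauchyI)
    fix e :: real assume "0 < e"
    then obtain N where N: "\<And>n x. n \<ge> N \<Longrightarrow> x \<in> {0..1} \<Longrightarrow> norm (F (r n) x - g x) < e / 3"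
      using g[of "e / 3"] by auto
    have "dist ((f \<circ> r) m) ((f \<circ> r) n) < e" if "m \<ge> N" "n \<ge> N" for m n
    proof -
      have "dist ((f \<circ> r) m) ((f \<circ> r) n) \<le> 2 * (e / 3)"
      proof (rule dist_bound)
        fix u
        show "dist (apply_bcontfun ((f \<circ> r) m) u) (apply_bcontfun ((f \<circ> r) n) u) \<le> 2 * (e / 3)"
          using N[OF \<open>m \<ge> N\<close>, of "val01 u"] N[OF \<open>n \<ge> N\<close>, of "val01 u"] val01[of u]
          unfolding F_def val01_inverse dist_real_def real_norm_def o_def by linarith
      qed
      then show ?thesis using \<open>0 < e\<close> by simp
    qed
    then show "\<exists>N. \<forall>m\<ge>N. \<forall>n\<ge>N. dist ((f \<circ> r) m) ((f \<circ> r) n) < e" by blast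
  qed
  then obtain l where l: "(f \<circ> r) \<longlonglongrightarrow> l" using Cauchy_convergent_iff convergent_def by blast
  moreover have "l \<in> hoelder_set \<gamma> L"
    using closed_sequentially[OF closed_hoelder_set _ l] f by auto
  ultimately show "\<exists>l\<in>hoelder_set \<gamma> L. \<exists>r. strict_mono r \<and> (f \<circ> r) \<longlonglongrightarrow> l" using r by blast
qed

section \<open>Sub-Gaussian increments and chaining\<close>

lemma (in prob_space) subgaussian_tail:
  assumes [measurable]: "Y \<in> borel_measurable M" and v: "0 < v" and x: "0 \<le> x"
    and mgf: "\<And>l. (\<integral>\<^sup>+w. ennreal (exp (l * Y w)) \<partial>M) \<le> ennreal (exp (l\<^sup>2 * v / 2))"
  shows "prob {w \<in> space M. x \<le> \<bar>Y w\<bar>} \<le> 2 * exp (- x\<^sup>2 / (2 * v))"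
proof -
  have one_sided: "prob {w \<in> space M. x \<le> c * Y w} \<le> exp (- x\<^sup>2 / (2 * v))" if "c\<^sup>2 = 1" for c
  proof -
    \<comment> \<open>The minimizer of - l x + l^2 v / 2 in the Chernoff bound. The sign
      \<open>c\<close> serves for both tails, as the bound sees only its square.\<close>
    define l where "l = x / v"
    have "emeasure M {w \<in> space M. x \<le> c * Y w} \<le>
        emeasure M {w \<in> space M. 1 \<le> ennreal (exp (- l * x)) * ennreal (exp (l * c * Y w))}"
    proof (rule emeasure_mono)
      show "{w \<in> space M. x \<le> c * Y w} \<subseteq>
        {w \<in> space M. 1 \<le> ennreal (exp (- l * x)) * ennreal (exp (l * c * Y w))}"
      proof clarsimp
        fix w assume "x \<le> c * Y w"
        then have "l * x \<le> l * (c * Y w)" using v x by (intro mult_left_mono) (auto simp: l_def)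
        then show "1 \<le> ennreal (exp (- (l * x))) * ennreal (exp (l * c * Y w))"
          by (simp add: ennreal_mult[symmetric] exp_add[symmetric] mult.assoc)
      qed
    qed measurable
    also have "\<dots> \<le> ennreal (exp (- l * x)) * (\<integral>\<^sup>+w. ennreal (exp (l * c * Y w)) \<partial>M)"
      using nn_integral_Markov_inequality[of "\<lambda>w. ennreal (exp (l * c * Y w))" "space M" M "ennreal (exp (- l * x))"]
      by (simp add: nn_integral_set_ennreal cong: nn_integral_cong)
    also have "\<dots> \<le> ennreal (exp (- l * x)) * ennreal (exp ((l * c)\<^sup>2 * v / 2))"
      using mgf[of "l * c"] by (intro mult_left_mono) auto
    also have "\<dots> = ennreal (exp (- x\<^sup>2 / (2 * v)))"
      using v that
      by (simp add: ennreal_mult[symmetric] exp_add[symmetric] l_def power_mult_distrib power_divide field_simps power2_eq_square)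
    finally show ?thesis by (simp add: emeasure_eq_measure)
  qed
  have "{w \<in> space M. x \<le> \<bar>Y w\<bar>} = {w \<in> space M. x \<le> 1 * Y w} \<union> {w \<in> space M. x \<le> - 1 * Y w}"
    by auto
  also have "prob \<dots> \<le> prob {w \<in> space M. x \<le> 1 * Y w} + prob {w \<in> space M. x \<le> - 1 * Y w}"
    by (rule measure_Un_le) measurable
  also have "\<dots> \<le> 2 * exp (- x\<^sup>2 / (2 * v))"
    using one_sided[of 1] one_sided[of "-1"] by simp
  finally show ?thesis .
qed

text \<open>The value at time 0 vanishes only almost surely, since in the application it is derived
  from a zero variance.\<close>

locale subgaussian_path = prob_space M for M :: "'a measure" +
  fixes W :: "'a \<Rightarrow> C01" and C \<beta> :: real
  assumes measurable_W [measurable]: "W \<in> borel_measurable M"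
    and C_pos: "0 < C" and \<beta>_pos: "0 < \<beta>"
    and W_0: "AE w in M. apply_bcontfun (W w) (Unit_interval 0) = 0"
    and mgf_incr: "\<And>s t l. (\<integral>\<^sup>+w. ennreal (exp (l * (apply_bcontfun (W w) t - apply_bcontfun (W w) s))) \<partial>M)
      \<le> ennreal (exp (l\<^sup>2 * (C * dist s t powr \<beta>) / 2))"

text \<open>The union bound over the \<open>2 ^ n\<close> dyadic increments of level n, each with
  its two-sided tail, after the common factor exp(-l^2/(4C)) has been taken out.\<close>

definition chaining_summand :: "real \<Rightarrow> real \<Rightarrow> nat \<Rightarrow> real" where
  "chaining_summand C \<beta> n = 2 ^ n * (2 * exp (- ((2 powr (\<beta> / 2)) ^ n / (4 * C))))"

definition chaining_const :: "real \<Rightarrow> real \<Rightarrow> real" where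
  "chaining_const C \<beta> = (\<Sum>n. chaining_summand C \<beta> n)"

text \<open>The factor in \<open>dyadic_increments_imp_hoelder\<close> for exponent \<gamma>, with q
  = 2^-\<gamma>.\<close>

definition hoelder_const :: "real \<Rightarrow> real" where
  "hoelder_const \<gamma> = 2 powr \<gamma> * (1 + 2 / (1 - 2 powr (- \<gamma>)))"

lemma hoelder_const_pos: "0 < \<gamma> \<Longrightarrow> 0 < hoelder_const \<gamma>"
  using powr_less_mono[of "- \<gamma>" 0 2] unfolding hoelder_const_def
  by (intro mult_pos_pos add_pos_pos divide_pos_pos) auto

lemma summable_chaining_summand:
  assumes "0 < C" "0 < \<beta>"
  shows "summable (chaining_summand C \<beta>)"
proof -
  define p where "p = 2 powr (\<beta> / 2)"
  have p: "1 < p" using assms by (simp add: p_def)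
  \<comment> \<open>Bounding exp(y) from below by a power of degree \<open>j\<close> gives decay
    faster than 4^-n, which beats the number 2^n of increments.\<close>
  obtain j where j: "4 < p ^ j" using real_arch_pow[OF p] by blast
  have j0: "0 < j" using j by (cases j) auto
  define K where "K = 2 * (4 * C * real j) ^ j"
  have bound: "chaining_summand C \<beta> n \<le> K * (1/2) ^ n" for n
  proof -
    define y where "y = p ^ n / (4 * C)"
    have y: "0 < y" using p assms by (simp add: y_def)
    have "(y / real j) ^ j \<le> (1 + y / real j) ^ j" using y j0 by (intro power_mono) auto
    also have "\<dots> \<le> exp y" by (rule exp_ge_one_plus_x_over_n_power_n) (use y j0 in auto)
    finally have "exp (- y) \<le> 1 / (y / real j) ^ j"
      using y j0 by (simp add: exp_minus field_simps)
    also have "\<dots> = (4 * C * real j) ^ j / (p ^ j) ^ n"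
      by (simp add: y_def power_divide power_mult_distrib power_mult[symmetric] mult.commute)
    also have "\<dots> \<le> (4 * C * real j) ^ j / 4 ^ n"
      using j assms by (intro divide_left_mono power_mono mult_pos_pos) auto
    finally have "2 ^ n * (2 * exp (- y)) \<le> 2 ^ n * (2 * ((4 * C * real j) ^ j / 4 ^ n))"
      by (intro mult_left_mono) auto
    also have "\<dots> = K * (1/2) ^ n"
      using power_divide[of "2::real" 4 n] by (simp add: K_def)
    finally show ?thesis by (simp add: chaining_summand_def y_def p_def)
  qed
  show ?thesis
    by (rule summable_comparison_test'[where g="\<lambda>n. K * (1/2) ^ n" and N = 0])
      (use bound in \<open>auto intro!: summable_mult simp: chaining_summand_def\<close>)
qed

lemma chaining_const_pos:
  assumes "0 < C" "0 < \<beta>"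
  shows "0 < chaining_const C \<beta>"
  unfolding chaining_const_def
  by (rule suminf_pos[OF summable_chaining_summand[OF assms]]) (simp add: chaining_summand_def)

lemma continuous_on_val01: "continuous_on S val01"
  unfolding continuous_on_iff by (auto simp: dist_unit_interval.rep_eq)

lemma continuous_on_Unit_interval: "continuous_on {0..1} Unit_interval"
  unfolding continuous_on_iff by (auto simp: dist_unit_interval.rep_eq Unit_interval_inverse)

text \<open>At level n the increments have variance parameter C q^(4n) and are compared with l q^n,
  where q = 2^(-\<beta>/4). The resulting exponent l^2 q^(-2n) / (2C) grows geometrically in n, so
  the union bound over all levels converges.\<close>

theorem (in subgaussian_path) hoelder_tail:
  assumes l: "1 \<le> l"
  shows "prob {w \<in> space M. W w \<notin> hoelder_set (\<beta> / 4) (hoelder_const (\<beta> / 4) * l)}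
    \<le> chaining_const C \<beta> * exp (- l\<^sup>2 / (4 * C))"
proof -
  define q where "q = 2 powr (- (\<beta> / 4))"
  define x where "x w t = apply_bcontfun (W w) (Unit_interval t)" for w t
  have [measurable]: "(\<lambda>w. x w t) \<in> borel_measurable M" for t
    unfolding x_def evaluation_apply[symmetric] by measurable
  define E where "E n k = {w \<in> space M. l * q ^ n \<le> \<bar>x w (real (Suc k) / 2 ^ n) - x w (real k / 2 ^ n)\<bar>}"
    for n k
  define B where "B n = (\<Union>k<2^n. E n k)" for n
  have [measurable]: "E n k \<in> sets M" for n k unfolding E_def by measurable
  have [measurable]: "B n \<in> sets M" for n unfolding B_def by measurable
  have q0: "0 < q" by (simp add: q_def)
  have p: "2 powr (\<beta> / 2) = inverse (q ^ 2)"
    by (simp add: q_def powr_power powr_minus[symmetric])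
  have summand: "prob (B n) \<le> chaining_summand C \<beta> n * exp (- l\<^sup>2 / (4 * C))" for n
  proof -
    have E: "prob (E n k) \<le> 2 * exp (- ((2 powr (\<beta> / 2)) ^ n / (4 * C))) * exp (- l\<^sup>2 / (4 * C))"
      if k: "k < 2 ^ n" for k
    proof -
      have "real (Suc k) \<le> real (2 ^ n)" using k by (simp only: of_nat_le_iff)
      then have "real k + 1 \<le> 2 ^ n" by simp
      then have in01: "real (Suc k) / 2 ^ n \<in> {0..1}" "real k / 2 ^ n \<in> {0..1}"
        using k by (simp_all add: divide_le_eq_1 less_imp_le)
      have "dist (Unit_interval (real k / 2 ^ n)) (Unit_interval (real (Suc k) / 2 ^ n)) = 1 / 2 ^ n"
        using in01 by (simp add: dist_unit_interval.rep_eq Unit_interval_inverse dist_real_def diff_divide_distrib[symmetric])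
      moreover have "(1 / 2 ^ n) powr \<beta> = (q ^ n) ^ 4"
        unfolding q_def
        by (simp add: powr_power powr_minus powr_divide inverse_eq_divide powr_realpow[symmetric] powr_powr mult.commute)
      ultimately have mgf: "(\<integral>\<^sup>+w. ennreal (exp (c * (x w (real (Suc k) / 2 ^ n) - x w (real k / 2 ^ n)))) \<partial>M)
          \<le> ennreal (exp (c\<^sup>2 * (C * (q ^ n) ^ 4) / 2))" for c
        using mgf_incr[of c "Unit_interval (real (Suc k) / 2 ^ n)" "Unit_interval (real k / 2 ^ n)"]
        by (simp add: x_def)
      have "prob (E n k) \<le> 2 * exp (- (l * q ^ n)\<^sup>2 / (2 * (C * (q ^ n) ^ 4)))"
        unfolding E_def by (rule subgaussian_tail) (use C_pos q0 l mgf in auto)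
      also have "- (l * q ^ n)\<^sup>2 / (2 * (C * (q ^ n) ^ 4)) = - (l\<^sup>2 * (2 powr (\<beta> / 2)) ^ n / (2 * C))"
      proof -
        have "(2 powr (\<beta> / 2)) ^ n = inverse ((q ^ n)\<^sup>2)"
          by (simp add: p power_inverse power_mult[symmetric] mult.commute)
        moreover have "- (l * y)\<^sup>2 / (2 * (C * y ^ 4)) = - (l\<^sup>2 * inverse (y\<^sup>2) / (2 * C))" if "0 < y" for y
          using that C_pos by (simp add: field_simps power2_eq_square power4_eq_xxxx)
        ultimately show ?thesis using q0 by simp
      qed
      \<comment> \<open>For P \<ge> 1 and l \<ge> 1 one has P + l^2 \<le> 2 l^2 P. The exponent is
        split in this way into a part that is summed over the levels and a part common to all; this
        turns 2C into 4C and uses 1 \<le> l.\<close>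
      also have "\<dots> \<le> - ((2 powr (\<beta> / 2)) ^ n / (4 * C)) + - l\<^sup>2 / (4 * C)"
      proof -
        define P where "P = (2 powr (\<beta> / 2)) ^ n"
        have P: "1 \<le> P" using \<beta>_pos unfolding P_def by (intro one_le_power ge_one_powr_ge_zero) auto
        have "1 \<le> l\<^sup>2" using l by simp
        then have "0 \<le> (l\<^sup>2 - 1) * P + l\<^sup>2 * (P - 1)" using P by simp
        then have "P + l\<^sup>2 \<le> 2 * (l\<^sup>2 * P)" by (simp add: algebra_simps)
        then have "(P + l\<^sup>2) / (4 * C) \<le> 2 * (l\<^sup>2 * P) / (4 * C)"
          using C_pos by (intro divide_right_mono) auto
        then show ?thesis using C_pos unfolding P_def[symmetric] by (simp add: add_divide_distrib mult.commute[of P])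
      qed
      finally have "prob (E n k) \<le> 2 * exp (- ((2 powr (\<beta> / 2)) ^ n / (4 * C)) + - l\<^sup>2 / (4 * C))" by simp
      then show ?thesis by (simp only: exp_add mult.assoc)
    qed
    have "prob (B n) \<le> (\<Sum>k<2^n. prob (E n k))"
      unfolding B_def by (rule finite_measure_subadditive_finite) auto
    also have "\<dots> \<le> (\<Sum>k<(2::nat)^n. 2 * exp (- ((2 powr (\<beta> / 2)) ^ n / (4 * C))) * exp (- l\<^sup>2 / (4 * C)))"
      using E by (intro sum_mono) auto
    finally show ?thesis by (simp add: chaining_summand_def)
  qed
  have sm: "summable (\<lambda>n. chaining_summand C \<beta> n * exp (- l\<^sup>2 / (4 * C)))"
    using summable_chaining_summand[OF C_pos \<beta>_pos] by (rule summable_mult2)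
  then have sB: "summable (\<lambda>n. prob (B n))"
    by (rule summable_comparison_test'[where N=0]) (use summand in auto)
  obtain N where N: "{w \<in> space M. \<not> apply_bcontfun (W w) (Unit_interval 0) = 0} \<subseteq> N" "N \<in> null_sets M"
    using W_0 by (auto elim!: AE_E simp: null_sets_def)
  have "{w \<in> space M. W w \<notin> hoelder_set (\<beta> / 4) (hoelder_const (\<beta> / 4) * l)} \<subseteq> (\<Union>n. B n) \<union> N"
  proof (intro subsetI, rule ccontr)
    fix w assume w: "w \<in> {w \<in> space M. W w \<notin> hoelder_set (\<beta> / 4) (hoelder_const (\<beta> / 4) * l)}"
      and "w \<notin> (\<Union>n. B n) \<union> N"
    then have w0: "apply_bcontfun (W w) (Unit_interval 0) = 0"
      and incr: "\<And>n k. k < 2 ^ n \<Longrightarrow> \<bar>x w (real (Suc k) / 2 ^ n) - x w (real k / 2 ^ n)\<bar> \<le> l * q ^ n"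
      using N(1) by (auto simp: B_def E_def not_le less_imp_le)
    have cont: "continuous_on {0..1} (x w)"
      unfolding x_def by (rule continuous_on_compose2[OF continuous_on_apply_bcontfun[of UNIV] continuous_on_Unit_interval]) auto
    have "\<bar>apply_bcontfun (W w) s - apply_bcontfun (W w) t\<bar>
        \<le> hoelder_const (\<beta> / 4) * l * dist s t powr (\<beta> / 4)" for s t
      using dyadic_increments_imp_hoelder[OF cont _ _ q_def incr val01[of t] val01[of s]] l \<beta>_pos
      by (simp add: x_def val01_inverse hoelder_const_def q_def mult_ac dist_unit_interval.rep_eq dist_real_def)
    then show False using w w0 by (simp add: hoelder_set_def)
  qed
  then have "prob {w \<in> space M. W w \<notin> hoelder_set (\<beta> / 4) (hoelder_const (\<beta> / 4) * l)}
      \<le> prob ((\<Union>n. B n) \<union> N)"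
    using N(2) by (intro finite_measure_mono) auto
  also have "\<dots> \<le> prob (\<Union>n. B n) + prob N"
    using N(2) by (intro measure_Un_le) auto
  also have "prob N = 0" using N(2) by (simp add: measure_def null_setsD1)
  also have "prob (\<Union>n. B n) \<le> (\<Sum>n. prob (B n))"
    using sB by (intro finite_measure_subadditive_countably) auto
  also have "\<dots> \<le> (\<Sum>n. chaining_summand C \<beta> n * exp (- l\<^sup>2 / (4 * C)))"
    by (rule suminf_le[OF summand sB sm])
  also have "\<dots> = chaining_const C \<beta> * exp (- l\<^sup>2 / (4 * C))"
    unfolding chaining_const_def
    using suminf_mult2[OF summable_chaining_summand[OF C_pos \<beta>_pos]] by metis
  finally show ?thesis by simp
qed

section \<open>Gaussian paths and exponential tilting\<close>

lemma borel_measurable_apply_bcontfun [measurable (raw)]: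
  fixes Z :: "'a \<Rightarrow> C01"
  assumes "Z \<in> borel_measurable M"
  shows "(\<lambda>w. apply_bcontfun (Z w) u) \<in> borel_measurable M"
  using borel_measurable_blinfun_apply[OF assms, of "evaluation u"] by simp

lemma integrable_mult_square_integrable:
  fixes X Y :: "'a \<Rightarrow> real"
  assumes [measurable]: "X \<in> borel_measurable M" "Y \<in> borel_measurable M"
    and "integrable M (\<lambda>w. (X w)\<^sup>2)" "integrable M (\<lambda>w. (Y w)\<^sup>2)"
  shows "integrable M (\<lambda>w. X w * Y w)"
proof (rule Bochner_Integration.integrable_bound)
  show "integrable M (\<lambda>w. (X w)\<^sup>2 + (Y w)\<^sup>2)" using assms by simp
  have "\<bar>a * b\<bar> \<le> a\<^sup>2 + b\<^sup>2" for a b :: real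
  proof -
    have "0 \<le> \<bar>a * b\<bar>" by simp
    moreover have "2 * \<bar>a * b\<bar> \<le> a\<^sup>2 + b\<^sup>2"
      using sum_squares_bound[of "\<bar>a\<bar>" "\<bar>b\<bar>"] by (simp add: abs_mult mult.assoc)
    ultimately show ?thesis by linarith
  qed
  then show "AE w in M. norm (X w * Y w) \<le> norm ((X w)\<^sup>2 + (Y w)\<^sup>2)" by simp
qed measurable

lemma Cauchy_Schwarz_square_integrable:
  fixes X Y :: "'a \<Rightarrow> real"
  assumes [measurable]: "X \<in> borel_measurable M" "Y \<in> borel_measurable M"
    and X: "integrable M (\<lambda>w. (X w)\<^sup>2)" and Y: "integrable M (\<lambda>w. (Y w)\<^sup>2)"
  shows "(\<integral>w. X w * Y w \<partial>M)\<^sup>2 \<le> (\<integral>w. (X w)\<^sup>2 \<partial>M) * (\<integral>w. (Y w)\<^sup>2 \<partial>M)"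
proof -
  define a b c where "a = (\<integral>w. (X w)\<^sup>2 \<partial>M)" and "b = (\<integral>w. X w * Y w \<partial>M)"
    and "c = (\<integral>w. (Y w)\<^sup>2 \<partial>M)"
  have XY: "integrable M (\<lambda>w. X w * Y w)"
    by (rule integrable_mult_square_integrable) (use X Y in auto)
  have quad: "0 \<le> a - 2 * r * b + r\<^sup>2 * c" for r
  proof -
    have "0 \<le> (\<integral>w. (X w - r * Y w)\<^sup>2 \<partial>M)" by simp
    also have "(\<lambda>w. (X w - r * Y w)\<^sup>2) = (\<lambda>w. (X w)\<^sup>2 - 2 * r * (X w * Y w) + r\<^sup>2 * (Y w)\<^sup>2)"
      by (simp add: fun_eq_iff power2_eq_square algebra_simps)
    also have "(\<integral>w. (X w)\<^sup>2 - 2 * r * (X w * Y w) + r\<^sup>2 * (Y w)\<^sup>2 \<partial>M) = a - 2 * r * b + r\<^sup>2 * c"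
      using X Y XY by (simp add: a_def b_def c_def)
    finally show ?thesis .
  qed
  have c0: "0 \<le> c" by (simp add: c_def)
  have "b\<^sup>2 \<le> a * c"
  proof (cases "c = 0")
    case True
    have "b = 0"
    proof (rule ccontr)
      assume "b \<noteq> 0"
      \<comment> \<open>With c = 0 the quadratic is affine in r, and this r gives it the value
        -1.\<close>
      then show False using quad[of "(a + 1) / (2 * b)"] True by simp
    qed
    then show ?thesis using True by simp
  next
    case False
    then have "0 \<le> (a - b\<^sup>2 / c) * c"
      using quad[of "b / c"] c0 by (intro mult_nonneg_nonneg) (simp_all add: power2_eq_square field_simps)
    then show ?thesis using False by (simp add: algebra_simps)
  qed
  then show ?thesis by (simp add: a_def b_def c_def)
qed

text \<open>A weak form of Fernique's theorem. The squared norm is dominated by a weighted sum of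
  indicators of the events \<open>E n\<close>, and the chaining tail, weakened to a fourth inverse
  power of n + 1, beats the quadratic weights \<open>c n\<close>.\<close>

lemma (in subgaussian_path) integrable_norm_square: "integrable M (\<lambda>w. (norm (W w))\<^sup>2)"
proof (rule integrableI_bounded)
  define K where "K = hoelder_const (\<beta> / 4)"
  define A where "A = chaining_const C \<beta>"
  have K: "0 < K" unfolding K_def using \<beta>_pos by (intro hoelder_const_pos) simp
  have A: "0 < A" unfolding A_def using C_pos \<beta>_pos by (rule chaining_const_pos)
  define E where "E n = {w \<in> space M. K * real (Suc n) < norm (W w)}" for n
  have [measurable]: "E n \<in> sets M" for n unfolding E_def by measurable
  define c where "c n = (real (n + 2))\<^sup>2" for n
  have bound: "c n * prob (E n) \<le> 256 * A * C\<^sup>2 * inverse ((real (Suc n))\<^sup>2)" for n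
  proof -
    define y where "y = (real (Suc n))\<^sup>2 / (4 * C)"
    have y: "0 < y" using C_pos by (simp add: y_def)
    have "prob (E n) \<le> prob {w \<in> space M. W w \<notin> hoelder_set (\<beta> / 4) (hoelder_const (\<beta> / 4) * real (Suc n))}"
    proof (rule finite_measure_mono)
      show "E n \<subseteq> {w \<in> space M. W w \<notin> hoelder_set (\<beta> / 4) (hoelder_const (\<beta> / 4) * real (Suc n))}"
        using hoelder_set_norm_le[of _ "\<beta> / 4" "K * real (Suc n)"] K \<beta>_pos
        unfolding E_def K_def by force
      show "{w \<in> space M. W w \<notin> hoelder_set (\<beta> / 4) (hoelder_const (\<beta> / 4) * real (Suc n))} \<in> events"
        using borel_closed[OF closed_hoelder_set] by measurable
    qed
    also have "\<dots> \<le> A * exp (- (real (Suc n))\<^sup>2 / (4 * C))"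
      unfolding A_def by (rule hoelder_tail) simp
    also have "- (real (Suc n))\<^sup>2 / (4 * C) = - y" by (simp add: y_def)
    also have "exp (- y) \<le> 4 / y\<^sup>2"
    proof -
      have "(y / 2)\<^sup>2 \<le> (1 + y / real 2) ^ 2" using y by (intro power_mono) auto
      also have "\<dots> \<le> exp y" by (rule exp_ge_one_plus_x_over_n_power_n) (use y in auto)
      finally show ?thesis using y by (simp add: exp_minus field_simps power2_eq_square)
    qed
    finally have "prob (E n) \<le> A * (4 / y\<^sup>2)" using A by simp
    moreover have "c n \<le> 4 * (real (Suc n))\<^sup>2"
      unfolding c_def by (simp add: power2_eq_square algebra_simps)
    ultimately have "c n * prob (E n) \<le> 4 * (real (Suc n))\<^sup>2 * (A * (4 / y\<^sup>2))"
      by (intro mult_mono) auto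
    also have "\<dots> = 256 * A * C\<^sup>2 * inverse ((real (Suc n))\<^sup>2)"
      unfolding y_def using C_pos by (simp add: field_simps power2_eq_square del: of_nat_Suc)
    finally show ?thesis .
  qed
  have sm: "summable (\<lambda>n. c n * prob (E n))"
  proof (rule summable_comparison_test'[where N = 0])
    show "summable (\<lambda>n. 256 * A * C\<^sup>2 * inverse ((real (Suc n))\<^sup>2))"
      using inverse_power_summable[of 2, where 'a=real] summable_Suc_iff[of "\<lambda>n. inverse ((real n)\<^sup>2)"]
      by (intro summable_mult) simp
  qed (use bound in \<open>auto simp: c_def\<close>)
  have pt: "ennreal ((norm (W w))\<^sup>2) \<le> ennreal (K\<^sup>2) * (1 + (\<Sum>n. ennreal (c n) * indicator (E n) w))"
    if w: "w \<in> space M" for w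
  proof -
    define Q where "Q = norm (W w) / K"
    have Q: "0 \<le> Q" "norm (W w) = K * Q" using K by (auto simp: Q_def)
    have "ennreal (Q\<^sup>2) \<le> 1 + (\<Sum>n. ennreal (c n) * indicator (E n) w)"
    proof (cases "Q \<le> 1")
      case True
      then have "ennreal (Q\<^sup>2) \<le> ennreal 1" using Q(1) by (intro ennreal_leI) (simp add: power_le_one)
      then show ?thesis by (simp add: add_increasing2)
    next
      case False
      \<comment> \<open>The shell containing Q, that is n + 1 < Q \<le> n + 2; it exists because Q >
        1, and its upper end explains the weight (n + 2)^2 in \<open>c\<close>.\<close>
      define n where "n = nat (\<lceil>Q\<rceil> - 2)"
      have n: "real (Suc n) < Q" "Q \<le> real (n + 2)"
        using False unfolding n_def by linarith+
      have "w \<in> E n" using w n(1) K Q(2) by (simp add: E_def)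
      moreover have "Q\<^sup>2 \<le> c n" unfolding c_def using n(2) Q(1) by (intro power_mono) auto
      ultimately have "ennreal (Q\<^sup>2) \<le> ennreal (c n) * indicator (E n) w"
        by (simp add: ennreal_leI)
      also have "\<dots> \<le> (\<Sum>n. ennreal (c n) * indicator (E n) w)"
      proof -
        have "f n \<le> (\<Sum>n. f n)" for f :: "nat \<Rightarrow> ennreal"
          using sum_le_suminf[of f "{n}"] by simp
        then show ?thesis .
      qed
      finally show ?thesis by (simp add: add_increasing)
    qed
    then have "ennreal (K\<^sup>2) * ennreal (Q\<^sup>2) \<le> ennreal (K\<^sup>2) * (1 + (\<Sum>n. ennreal (c n) * indicator (E n) w))"
      by (intro mult_left_mono) auto
    then show ?thesis by (simp add: Q(2) power_mult_distrib ennreal_mult)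
  qed
  have "(\<integral>\<^sup>+w. ennreal (norm ((norm (W w))\<^sup>2)) \<partial>M)
      \<le> (\<integral>\<^sup>+w. ennreal (K\<^sup>2) * (1 + (\<Sum>n. ennreal (c n) * indicator (E n) w)) \<partial>M)"
    using pt by (intro nn_integral_mono) simp
  also have "\<dots> = ennreal (K\<^sup>2) * (1 + (\<Sum>n. ennreal (c n) * emeasure M (E n)))"
    by (simp add: nn_integral_cmult nn_integral_add nn_integral_suminf emeasure_space_1)
  also have "(\<Sum>n. ennreal (c n) * emeasure M (E n)) = (\<Sum>n. ennreal (c n * prob (E n)))"
    by (simp add: emeasure_eq_measure ennreal_mult c_def)
  also have "\<dots> = ennreal (\<Sum>n. c n * prob (E n))"
    using sm by (intro suminf_ennreal2) (auto simp: c_def)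
  also have "ennreal (K\<^sup>2) * (1 + \<dots>) < \<infinity>"
    by (simp add: ennreal_mult_less_top)
  finally show "(\<integral>\<^sup>+w. ennreal (norm ((norm (W w))\<^sup>2)) \<partial>M) < \<infinity>" .
qed measurable

section \<open>Covariance form, represented paths and exponential tilting\<close>

definition covar :: "'a measure \<Rightarrow> ('a \<Rightarrow> 'e::real_normed_vector) \<Rightarrow> ('e \<Rightarrow>\<^sub>L real) \<Rightarrow> ('e \<Rightarrow>\<^sub>L real) \<Rightarrow> real" where
  "covar M Z \<alpha> \<beta> = (\<integral>w. blinfun_apply \<alpha> (Z w) * blinfun_apply \<beta> (Z w) \<partial>M)"

definition kernel_path :: "'a measure \<Rightarrow> ('a \<Rightarrow> 'e::{banach, second_countable_topology}) \<Rightarrow> ('a \<Rightarrow> real) \<Rightarrow> 'e" where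
  "kernel_path M Z \<xi> = (\<integral>w. \<xi> w *\<^sub>R Z w \<partial>M)"

abbreviation represent ::
  "'a measure \<Rightarrow> ('a \<Rightarrow> 'e::{banach, second_countable_topology}) \<Rightarrow> ('e \<Rightarrow>\<^sub>L real) \<Rightarrow> 'e" where
  "represent M Z \<alpha> \<equiv> kernel_path M Z (\<lambda>w. blinfun_apply \<alpha> (Z w))"

text \<open>The Cameron-Martin density. By \<open>mgf\<close> the subtracted constant normalizes it
  for \<alpha> in \<open>eval_span\<close>.\<close>

definition tilted :: "'a measure \<Rightarrow> ('a \<Rightarrow> 'e::real_normed_vector) \<Rightarrow> ('e \<Rightarrow>\<^sub>L real) \<Rightarrow> 'a measure" where
  "tilted M Z \<alpha> = density M (\<lambda>w. ennreal (exp (blinfun_apply \<alpha> (Z w) - covar M Z \<alpha> \<alpha> / 2)))"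

text \<open>The Gaussian law enters through three integrals only: the moment generating function
  serves the Chernoff bound and the tilt, cosine and sine serve weak convergence. The constants C
  and \<beta> are parameters so that a whole family can share them.\<close>

locale gaussian_path = prob_space M for M :: "'a measure" +
  fixes Z :: "'a \<Rightarrow> C01" and C \<beta> :: real
  assumes measurable_Z [measurable]: "Z \<in> borel_measurable M"
    and C_pos: "0 < C" and \<beta>_pos: "0 < \<beta>"
    and Z_0: "AE w in M. apply_bcontfun (Z w) (Unit_interval 0) = 0"
    and mgf: "\<And>\<alpha>. \<alpha> \<in> eval_span \<Longrightarrow>
      (\<integral>\<^sup>+w. ennreal (exp (blinfun_apply \<alpha> (Z w))) \<partial>M) = ennreal (exp (covar M Z \<alpha> \<alpha> / 2))"
    and cos_integral: "\<And>\<alpha>. \<alpha> \<in> eval_span \<Longrightarrow>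
      (\<integral>w. cos (blinfun_apply \<alpha> (Z w)) \<partial>M) = exp (- covar M Z \<alpha> \<alpha> / 2)"
    and sin_integral: "\<And>\<alpha>. \<alpha> \<in> eval_span \<Longrightarrow> (\<integral>w. sin (blinfun_apply \<alpha> (Z w)) \<partial>M) = 0"
    and covar_incr: "\<And>s t. covar M Z (evaluation t - evaluation s) (evaluation t - evaluation s)
      \<le> C * dist s t powr \<beta>"
begin

sublocale subgaussian_path M Z C \<beta>
proof
  fix s t l
  define \<delta> where "\<delta> = evaluation t - evaluation s"
  have "covar M Z (l *\<^sub>R \<delta>) (l *\<^sub>R \<delta>) = (\<integral>w. l\<^sup>2 * (blinfun_apply \<delta> (Z w) * blinfun_apply \<delta> (Z w)) \<partial>M)"
    unfolding covar_def by (simp add: blinfun.scaleR_left power2_eq_square mult_ac)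
  also have "\<dots> = l\<^sup>2 * covar M Z \<delta> \<delta>" by (simp add: covar_def)
  also have "\<dots> \<le> l\<^sup>2 * (C * dist s t powr \<beta>)"
    using covar_incr[of t s] unfolding \<delta>_def by (intro mult_left_mono) auto
  finally have "exp (covar M Z (l *\<^sub>R \<delta>) (l *\<^sub>R \<delta>) / 2) \<le> exp (l\<^sup>2 * (C * dist s t powr \<beta>) / 2)" by simp
  then have "(\<integral>\<^sup>+w. ennreal (exp (blinfun_apply (l *\<^sub>R \<delta>) (Z w))) \<partial>M) \<le> ennreal (exp (l\<^sup>2 * (C * dist s t powr \<beta>) / 2))"
    by (subst mgf) (auto simp: \<delta>_def intro: ennreal_leI)
  then show "(\<integral>\<^sup>+w. ennreal (exp (l * (apply_bcontfun (Z w) t - apply_bcontfun (Z w) s))) \<partial>M)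
      \<le> ennreal (exp (l\<^sup>2 * (C * dist s t powr \<beta>) / 2))"
    by (simp add: \<delta>_def blinfun.scaleR_left blinfun.diff_left)
qed (use C_pos \<beta>_pos Z_0 in auto)

lemma integrable_square_apply:
  fixes \<alpha> :: "C01 \<Rightarrow>\<^sub>L real"
  shows "integrable M (\<lambda>w. (blinfun_apply \<alpha> (Z w))\<^sup>2)"
proof (rule Bochner_Integration.integrable_bound)
  show "integrable M (\<lambda>w. (norm \<alpha>)\<^sup>2 * (norm (Z w))\<^sup>2)"
    using integrable_norm_square by simp
  have "\<bar>blinfun_apply \<alpha> f\<bar>\<^sup>2 \<le> (norm \<alpha> * norm f)\<^sup>2" for f
    using norm_blinfun[of \<alpha> f] by (intro power_mono) auto
  then show "AE w in M. norm ((blinfun_apply \<alpha> (Z w))\<^sup>2) \<le> norm ((norm \<alpha>)\<^sup>2 * (norm (Z w))\<^sup>2)"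
    by (simp add: power_mult_distrib)
qed measurable

lemma integrable_mult_apply:
  fixes \<alpha> :: "C01 \<Rightarrow>\<^sub>L real"
  assumes "\<xi> \<in> borel_measurable M" "integrable M (\<lambda>w. (\<xi> w)\<^sup>2)"
  shows "integrable M (\<lambda>w. \<xi> w * blinfun_apply \<alpha> (Z w))"
  using assms integrable_square_apply by (intro integrable_mult_square_integrable) auto

lemma integrable_apply_mult [simp]:
  fixes \<alpha> \<alpha>' :: "C01 \<Rightarrow>\<^sub>L real"
  shows "integrable M (\<lambda>w. blinfun_apply \<alpha> (Z w) * blinfun_apply \<alpha>' (Z w))"
  using integrable_square_apply by (intro integrable_mult_apply) auto

lemma covar_simps:
  "covar M Z (\<alpha> + \<alpha>') \<gamma> = covar M Z \<alpha> \<gamma> + covar M Z \<alpha>' \<gamma>"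
  "covar M Z (\<alpha> - \<alpha>') \<gamma> = covar M Z \<alpha> \<gamma> - covar M Z \<alpha>' \<gamma>"
  "covar M Z \<gamma> (\<alpha> + \<alpha>') = covar M Z \<gamma> \<alpha> + covar M Z \<gamma> \<alpha>'"
  "covar M Z \<gamma> (\<alpha> - \<alpha>') = covar M Z \<gamma> \<alpha> - covar M Z \<gamma> \<alpha>'"
  "covar M Z (c *\<^sub>R \<alpha>) \<gamma> = c * covar M Z \<alpha> \<gamma>"
  "covar M Z \<gamma> (c *\<^sub>R \<alpha>) = c * covar M Z \<gamma> \<alpha>"
  unfolding covar_def
  by (simp_all add: blinfun.add_left blinfun.diff_left blinfun.scaleR_left distrib_left distrib_right
      left_diff_distrib right_diff_distrib mult.assoc mult.left_commute[of _ c])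

lemma covar_commute: "covar M Z \<alpha> \<alpha>' = covar M Z \<alpha>' \<alpha>"
  unfolding covar_def by (simp add: mult.commute)

lemma covar_eq_square: "covar M Z \<alpha> \<alpha> = (\<integral>w. (blinfun_apply \<alpha> (Z w))\<^sup>2 \<partial>M)"
  unfolding covar_def by (simp add: power2_eq_square)

lemma covar_nonneg: "0 \<le> covar M Z \<alpha> \<alpha>"
  unfolding covar_eq_square by simp

lemma covar_Cauchy_Schwarz: "(covar M Z \<alpha> \<alpha>')\<^sup>2 \<le> covar M Z \<alpha> \<alpha> * covar M Z \<alpha>' \<alpha>'"
  unfolding covar_eq_square unfolding covar_def
  by (rule Cauchy_Schwarz_square_integrable) (use integrable_square_apply in auto)

lemma integrable_scaleR_path:
  assumes [measurable]: "\<xi> \<in> borel_measurable M" and "integrable M (\<lambda>w. (\<xi> w)\<^sup>2)"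
  shows "integrable M (\<lambda>w. \<xi> w *\<^sub>R Z w)"
proof (rule Bochner_Integration.integrable_bound)
  show "integrable M (\<lambda>w. \<xi> w * norm (Z w))"
    using assms integrable_norm_square by (intro integrable_mult_square_integrable) auto
qed (auto simp: abs_mult)

lemma blinfun_apply_kernel_path:
  assumes "\<xi> \<in> borel_measurable M" "integrable M (\<lambda>w. (\<xi> w)\<^sup>2)"
  shows "blinfun_apply \<alpha> (kernel_path M Z \<xi>) = (\<integral>w. \<xi> w * blinfun_apply \<alpha> (Z w) \<partial>M)"
  unfolding kernel_path_def
  using integral_bounded_linear[OF blinfun.bounded_linear_right integrable_scaleR_path[OF assms], of \<alpha>]
  by (simp add: blinfun.scaleR_right)

text \<open>The reproducing property, for arbitrary functionals on both sides.\<close>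

lemma blinfun_apply_represent: "blinfun_apply \<alpha>' (represent M Z \<alpha>) = covar M Z \<alpha> \<alpha>'"
  unfolding covar_def by (rule blinfun_apply_kernel_path) (use integrable_square_apply in auto)

lemma represent_eval: "apply_bcontfun (represent M Z \<alpha>) u = covar M Z \<alpha> (evaluation u)"
  using blinfun_apply_represent[of "evaluation u" \<alpha>] by simp

lemma represent_eval_0: "apply_bcontfun (represent M Z \<alpha>) (Unit_interval 0) = 0"
proof -
  have "covar M Z \<alpha> (evaluation (Unit_interval 0)) = (\<integral>w. 0 \<partial>M)"
    unfolding covar_def by (rule integral_cong_AE) (use Z_0 in auto)
  then show ?thesis by (simp add: represent_eval)
qed

text \<open>Cauchy-Schwarz for the covariance form. The modulus of continuity depends on the path
  law only through the variance of \<alpha>, hence is uniform over a family with bounded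
  variances.\<close>

lemma represent_incr:
  "(apply_bcontfun (represent M Z \<alpha>) t - apply_bcontfun (represent M Z \<alpha>) s)\<^sup>2 \<le> covar M Z \<alpha> \<alpha> * (C * dist s t powr \<beta>)"
proof -
  have "(covar M Z \<alpha> (evaluation t - evaluation s))\<^sup>2
      \<le> covar M Z \<alpha> \<alpha> * covar M Z (evaluation t - evaluation s) (evaluation t - evaluation s)"
    by (rule covar_Cauchy_Schwarz)
  also have "\<dots> \<le> covar M Z \<alpha> \<alpha> * (C * dist s t powr \<beta>)"
    by (intro mult_left_mono covar_incr covar_nonneg)
  finally show ?thesis by (simp add: represent_eval covar_simps)
qed

lemma nn_integral_tilted:
  assumes [measurable]: "f \<in> borel_measurable M"
  shows "(\<integral>\<^sup>+w. f w \<partial>tilted M Z \<alpha>) =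
    (\<integral>\<^sup>+w. ennreal (exp (blinfun_apply \<alpha> (Z w) - covar M Z \<alpha> \<alpha> / 2)) * f w \<partial>M)"
  unfolding tilted_def by (rule nn_integral_density) measurable

text \<open>Expanding the variance of \<alpha> + \<delta>, the variance of \<alpha> cancels against
  the normalization and the cross term against the shift by the represented path. What is left is
  the moment generating function of \<delta> under the original law.\<close>

lemma subgaussian_path_tilted:
  assumes \<alpha>: "\<alpha> \<in> eval_span"
  shows "subgaussian_path (tilted M Z \<alpha>) (\<lambda>w. Z w - represent M Z \<alpha>) C \<beta>"
proof -
  have exp_tilt: "(\<integral>\<^sup>+w. ennreal (exp (blinfun_apply \<delta> (Z w - represent M Z \<alpha>))) \<partial>tilted M Z \<alpha>)
      = ennreal (exp (covar M Z \<delta> \<delta> / 2))" if \<delta>: "\<delta> \<in> eval_span" for \<delta>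
  proof -
    define c where "c = - covar M Z \<alpha> \<alpha> / 2 - covar M Z \<alpha> \<delta>"
    have "(\<integral>\<^sup>+w. ennreal (exp (blinfun_apply \<delta> (Z w - represent M Z \<alpha>))) \<partial>tilted M Z \<alpha>) =
      (\<integral>\<^sup>+w. ennreal (exp c) * ennreal (exp (blinfun_apply (\<alpha> + \<delta>) (Z w))) \<partial>M)"
      by (subst nn_integral_tilted)
        (auto simp: ennreal_mult[symmetric] exp_add[symmetric] c_def blinfun.add_left blinfun.diff_right
          blinfun_apply_represent algebra_simps)
    also have "\<dots> = ennreal (exp c) * ennreal (exp (covar M Z (\<alpha> + \<delta>) (\<alpha> + \<delta>) / 2))"
      using \<alpha> \<delta> by (simp add: nn_integral_cmult mgf)
    also have "\<dots> = ennreal (exp (covar M Z \<delta> \<delta> / 2))"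
      by (simp add: ennreal_mult[symmetric] exp_add[symmetric] c_def covar_simps
          covar_commute[of \<delta> \<alpha>] field_simps)
    finally show ?thesis .
  qed
  have "covar M Z 0 0 = 0" by (simp add: covar_def)
  \<comment> \<open>The identity \<open>exp_tilt\<close> at the zero functional says that the total
    mass is 1.\<close>
  then have prob: "prob_space (tilted M Z \<alpha>)"
    using exp_tilt[of 0] by (intro prob_spaceI) simp
  show ?thesis
    unfolding subgaussian_path_def subgaussian_path_axioms_def
  proof (intro conjI allI prob C_pos \<beta>_pos)
    show "(\<lambda>w. Z w - represent M Z \<alpha>) \<in> borel_measurable (tilted M Z \<alpha>)"
      unfolding tilted_def by measurable
    show "AE w in tilted M Z \<alpha>. apply_bcontfun (Z w - represent M Z \<alpha>) (Unit_interval 0) = 0"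
      using Z_0 unfolding tilted_def by (subst AE_density) (auto simp: represent_eval_0)
    fix s t l
    define \<delta> where "\<delta> = l *\<^sub>R (evaluation t - evaluation s)"
    have "l\<^sup>2 * covar M Z (evaluation t - evaluation s) (evaluation t - evaluation s) \<le> l\<^sup>2 * (C * dist s t powr \<beta>)"
      by (intro mult_left_mono covar_incr) auto
    then have "covar M Z \<delta> \<delta> \<le> l\<^sup>2 * (C * dist s t powr \<beta>)"
      unfolding \<delta>_def by (simp add: covar_simps(5,6) power2_eq_square mult_ac)
    then have "(\<integral>\<^sup>+w. ennreal (exp (blinfun_apply \<delta> (Z w - represent M Z \<alpha>))) \<partial>tilted M Z \<alpha>)
        \<le> ennreal (exp (l\<^sup>2 * (C * dist s t powr \<beta>) / 2))"
      by (subst exp_tilt) (auto simp: \<delta>_def intro!: ennreal_leI)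
    then show "(\<integral>\<^sup>+w. ennreal (exp (l * (apply_bcontfun (Z w - represent M Z \<alpha>) t - apply_bcontfun (Z w - represent M Z \<alpha>) s))) \<partial>tilted M Z \<alpha>)
        \<le> ennreal (exp (l\<^sup>2 * (C * dist s t powr \<beta>) / 2))"
      by (simp add: \<delta>_def blinfun.scaleR_left blinfun.diff_left)
  qed
qed

end

section \<open>The rate function of the reproducing kernel Hilbert space\<close>

definition bernstein_path :: "nat \<Rightarrow> nat \<Rightarrow> C01" where
  "bernstein_path n k = Bcontfun (\<lambda>u. Bernstein n k (val01 u))"

lemma apply_bernstein_path [simp]: "apply_bcontfun (bernstein_path n k) u = Bernstein n k (val01 u)"
proof -
  have "continuous_on UNIV (\<lambda>u. Bernstein n k (val01 u))"
    unfolding Bernstein_def by (intro continuous_intros continuous_on_val01)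
  moreover from this have "bounded (range (\<lambda>u. Bernstein n k (val01 u)))"
    by (intro compact_imp_bounded compact_continuous_image compact_UNIV_metric)
  ultimately show ?thesis
    unfolding bernstein_path_def by (subst Bcontfun_inverse) (auto simp: bcontfun_def)
qed

text \<open>Linear in f and dependent on finitely many values, so composing any functional with it
  gives an element of \<open>eval_span\<close>. For n = 0 the node 0 / 0 is 0 by convention, again a
  point of the interval.\<close>

definition bernstein_approx :: "nat \<Rightarrow> C01 \<Rightarrow> C01" where
  "bernstein_approx n f =
    (\<Sum>k\<le>n. apply_bcontfun f (Unit_interval (real k / real n)) *\<^sub>R bernstein_path n k)"

lemma sum_apply_bcontfun: "apply_bcontfun (\<Sum>i\<in>I. f i) u = (\<Sum>i\<in>I. apply_bcontfun (f i :: C01) u)"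
  using blinfun.sum_right[of "evaluation u" f I] by simp

lemma apply_bernstein_approx:
  "apply_bcontfun (bernstein_approx n f) u =
    (\<Sum>k\<le>n. apply_bcontfun f (Unit_interval (real k / real n)) * Bernstein n k (val01 u))"
  by (simp add: bernstein_approx_def sum_apply_bcontfun)

lemma norm_bernstein_approx_le: "norm (bernstein_approx n f) \<le> norm f"
proof (rule norm_bound)
  fix u
  have B: "0 \<le> Bernstein n k (val01 u)" for k
    using val01[of u] by (intro Bernstein_nonneg) auto
  have "\<bar>apply_bcontfun (bernstein_approx n f) u\<bar> \<le>
      (\<Sum>k\<le>n. \<bar>apply_bcontfun f (Unit_interval (real k / real n))\<bar> * Bernstein n k (val01 u))"
    unfolding apply_bernstein_approx
    by (rule order_trans[OF sum_abs]) (simp add: abs_mult B)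
  also have "\<dots> \<le> (\<Sum>k\<le>n. norm f * Bernstein n k (val01 u))"
    using norm_bounded[of f] B by (intro sum_mono mult_right_mono) auto
  also have "\<dots> = norm f" by (simp add: sum_distrib_left[symmetric])
  finally show "norm (apply_bcontfun (bernstein_approx n f) u) \<le> norm f" by simp
qed

lemma bernstein_approx_tendsto: "(\<lambda>n. bernstein_approx n f) \<longlonglongrightarrow> f"
proof (rule metric_LIMSEQ_I)
  fix e :: real assume e: "0 < e"
  have "continuous_on {0..1} (\<lambda>t. apply_bcontfun f (Unit_interval t))"
    by (rule continuous_on_compose2[OF continuous_on_apply_bcontfun[of UNIV] continuous_on_Unit_interval]) auto
  then obtain N where N: "\<And>n x. N \<le> n \<Longrightarrow> x \<in> {0..1} \<Longrightarrow>
      \<bar>apply_bcontfun f (Unit_interval x) -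
        (\<Sum>k\<le>n. apply_bcontfun f (Unit_interval (real k / real n)) * Bernstein n k x)\<bar> < e / 2"
    using Bernstein_Weierstrass[of "\<lambda>t. apply_bcontfun f (Unit_interval t)" "e / 2"] e by auto
  have "dist (bernstein_approx n f) f < e" if "N \<le> n" for n
  proof -
    have "dist (bernstein_approx n f) f \<le> e / 2"
      using N[OF that val01] by (intro dist_bound)
        (simp add: apply_bernstein_approx dist_real_def val01_inverse abs_minus_commute less_imp_le)
    then show ?thesis using e by simp
  qed
  then show "\<exists>N. \<forall>n\<ge>N. dist (bernstein_approx n f) f < e" by blast
qed

lemma bernstein_functional:
  obtains \<alpha>' where "\<alpha>' \<in> eval_span" "\<And>f. blinfun_apply \<alpha>' f = blinfun_apply \<alpha> (bernstein_approx n f)"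
proof
  show "(\<Sum>k\<le>n. blinfun_apply \<alpha> (bernstein_path n k) *\<^sub>R evaluation (Unit_interval (real k / real n)))
      \<in> eval_span"
    by auto
  show "blinfun_apply (\<Sum>k\<le>n. blinfun_apply \<alpha> (bernstein_path n k) *\<^sub>R evaluation (Unit_interval (real k / real n))) f
      = blinfun_apply \<alpha> (bernstein_approx n f)" for f
    by (simp add: bernstein_approx_def blinfun.sum_left blinfun.scaleR_left blinfun.sum_right
        blinfun.scaleR_right mult.commute)
qed

lemma enn_square_diff_triangle:
  fixes X Y Z :: "'a \<Rightarrow> real"
  assumes [measurable]: "X \<in> borel_measurable M" "Y \<in> borel_measurable M" "Z \<in> borel_measurable M"
  shows "(\<integral>\<^sup>+w. ennreal ((X w - Z w)\<^sup>2) \<partial>M) \<le>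
    2 * (\<integral>\<^sup>+w. ennreal ((X w - Y w)\<^sup>2) \<partial>M) + 2 * (\<integral>\<^sup>+w. ennreal ((Y w - Z w)\<^sup>2) \<partial>M)"
proof -
  have "(\<integral>\<^sup>+w. ennreal ((X w - Z w)\<^sup>2) \<partial>M) \<le>
      (\<integral>\<^sup>+w. 2 * ennreal ((X w - Y w)\<^sup>2) + 2 * ennreal ((Y w - Z w)\<^sup>2) \<partial>M)"
  proof (rule nn_integral_mono)
    fix w
    have "(a - c)\<^sup>2 \<le> 2 * (a - b)\<^sup>2 + 2 * (b - c)\<^sup>2" for a b c :: real
      using zero_le_power2[of "a - 2 * b + c"] by (simp add: power2_eq_square algebra_simps)
    then have "ennreal ((X w - Z w)\<^sup>2) \<le> ennreal (2 * (X w - Y w)\<^sup>2 + 2 * (Y w - Z w)\<^sup>2)"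
      by (rule ennreal_leI)
    then show "ennreal ((X w - Z w)\<^sup>2) \<le> 2 * ennreal ((X w - Y w)\<^sup>2) + 2 * ennreal ((Y w - Z w)\<^sup>2)"
      by (simp add: ennreal_mult)
  qed
  then show ?thesis by (simp add: nn_integral_add nn_integral_cmult)
qed

section \<open>The Legendre transform of the variance and the RKHS norm\<close>

definition legendre ::
  "'a measure \<Rightarrow> ('a \<Rightarrow> 'e::real_normed_vector) \<Rightarrow> ('e \<Rightarrow>\<^sub>L real) \<Rightarrow> 'e \<Rightarrow> real" where
  "legendre M Z \<alpha> h = blinfun_apply \<alpha> h - covar M Z \<alpha> \<alpha> / 2"

definition rkhs_rate :: "'a measure \<Rightarrow> ('a \<Rightarrow> 'e::{banach, second_countable_topology}) \<Rightarrow> 'e \<Rightarrow> ennreal" where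
  "rkhs_rate M Z h = (if h \<in> rkhs M Z then ennreal (1/2 * (rkhs_norm M Z h)\<^sup>2) else \<infinity>)"

context gaussian_path
begin

text \<open>Bernstein approximants converge at every path and are dominated by a multiple of the
  norm, which is square integrable; dominated convergence gives the L^2 statement. Hence the closure
  defined by all functionals is already that of \<open>eval_span\<close>.\<close>

lemma eval_span_dense:
  fixes \<alpha> :: "C01 \<Rightarrow>\<^sub>L real"
  assumes "0 < e"
  obtains \<alpha>' where "\<alpha>' \<in> eval_span"
    "(\<integral>\<^sup>+w. ennreal ((blinfun_apply \<alpha> (Z w) - blinfun_apply \<alpha>' (Z w))\<^sup>2) \<partial>M) < ennreal e"
proof -
  have "\<exists>\<alpha>'. \<alpha>' \<in> eval_span \<and> (\<forall>f. blinfun_apply \<alpha>' f = blinfun_apply \<alpha> (bernstein_approx n f))" for n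
    using bernstein_functional[of \<alpha> n] by metis
  then obtain a where a: "\<And>n. a n \<in> eval_span"
    "\<And>n f. blinfun_apply (a n) f = blinfun_apply \<alpha> (bernstein_approx n f)"
    by metis
  have "(\<lambda>n. \<integral>w. (blinfun_apply \<alpha> (Z w) - blinfun_apply (a n) (Z w))\<^sup>2 \<partial>M) \<longlonglongrightarrow> (\<integral>w. 0 \<partial>M)"
  proof (rule integral_dominated_convergence)
    show "integrable M (\<lambda>w. (2 * norm \<alpha>)\<^sup>2 * (norm (Z w))\<^sup>2)"
      using integrable_norm_square by simp
    have "blinfun_apply \<alpha> f - blinfun_apply (a n) f = blinfun_apply \<alpha> (f - bernstein_approx n f)" for n f
      by (simp add: a(2) blinfun.diff_right)
    then have "norm (blinfun_apply \<alpha> f - blinfun_apply (a n) f) \<le> norm \<alpha> * (2 * norm f)" for n f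
      using norm_blinfun[of \<alpha> "f - bernstein_approx n f"] norm_triangle_ineq4[of f "bernstein_approx n f"]
        norm_bernstein_approx_le[of n f]
      by (smt (verit, best) mult_left_mono norm_ge_zero)
    then have "(norm (blinfun_apply \<alpha> f - blinfun_apply (a n) f))\<^sup>2 \<le> (norm \<alpha> * (2 * norm f))\<^sup>2" for n f
      by (intro power_mono) auto
    then show "AE w in M. norm ((blinfun_apply \<alpha> (Z w) - blinfun_apply (a n) (Z w))\<^sup>2)
        \<le> (2 * norm \<alpha>)\<^sup>2 * (norm (Z w))\<^sup>2" for n
      by (simp add: power_mult_distrib mult_ac)
    have "(\<lambda>n. (blinfun_apply \<alpha> f - blinfun_apply (a n) f)\<^sup>2) \<longlonglongrightarrow> (blinfun_apply \<alpha> f - blinfun_apply \<alpha> f)\<^sup>2" for f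
      unfolding a(2) by (intro tendsto_intros bernstein_approx_tendsto)
    then show "AE w in M. (\<lambda>n. (blinfun_apply \<alpha> (Z w) - blinfun_apply (a n) (Z w))\<^sup>2) \<longlonglongrightarrow> 0"
      by simp
  qed measurable
  then have "\<forall>\<^sub>F n in sequentially. (\<integral>w. (blinfun_apply \<alpha> (Z w) - blinfun_apply (a n) (Z w))\<^sup>2 \<partial>M) < e"
    using assms by (intro order_tendstoD) auto
  then obtain n where n: "(\<integral>w. (blinfun_apply \<alpha> (Z w) - blinfun_apply (a n) (Z w))\<^sup>2 \<partial>M) < e"
    using eventually_happens'[OF sequentially_bot] by blast
  have "integrable M (\<lambda>w. (blinfun_apply (\<alpha> - a n) (Z w))\<^sup>2)" by (rule integrable_square_apply)
  then have "(\<integral>\<^sup>+w. ennreal ((blinfun_apply \<alpha> (Z w) - blinfun_apply (a n) (Z w))\<^sup>2) \<partial>M) =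
      ennreal (\<integral>w. (blinfun_apply \<alpha> (Z w) - blinfun_apply (a n) (Z w))\<^sup>2 \<partial>M)"
    by (intro nn_integral_eq_integral) (auto simp: blinfun.diff_left)
  with n a(1) assms show thesis by (intro that[of "a n"]) (auto simp: ennreal_lessI)
qed

lemma gaussian_L2_closureD:
  assumes "\<xi> \<in> gaussian_L2_closure M Z"
  shows "\<xi> \<in> borel_measurable M" "integrable M (\<lambda>w. (\<xi> w)\<^sup>2)"
  using assms by (auto simp: gaussian_L2_closure_def)

lemma integrable_square_diff_apply:
  fixes \<alpha> :: "C01 \<Rightarrow>\<^sub>L real"
  assumes "\<xi> \<in> borel_measurable M" "integrable M (\<lambda>w. (\<xi> w)\<^sup>2)"
  shows "integrable M (\<lambda>w. (\<xi> w - blinfun_apply \<alpha> (Z w))\<^sup>2)"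
proof -
  have "(\<lambda>w. (\<xi> w - blinfun_apply \<alpha> (Z w))\<^sup>2) =
      (\<lambda>w. (\<xi> w)\<^sup>2 - 2 * (\<xi> w * blinfun_apply \<alpha> (Z w)) + (blinfun_apply \<alpha> (Z w))\<^sup>2)"
    by (simp add: fun_eq_iff power2_eq_square algebra_simps)
  then show ?thesis
    using assms integrable_mult_apply[OF assms] integrable_square_apply by simp
qed

lemma gaussian_L2_closure_approx:
  assumes \<xi>: "\<xi> \<in> gaussian_L2_closure M Z" and "0 < e"
  obtains \<alpha> where "\<alpha> \<in> eval_span" "(\<integral>w. (\<xi> w - blinfun_apply \<alpha> (Z w))\<^sup>2 \<partial>M) < e"
proof -
  note [measurable] = gaussian_L2_closureD(1)[OF \<xi>]
  from assms obtain \<alpha>' :: "C01 \<Rightarrow>\<^sub>L real"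
    where a': "(\<integral>\<^sup>+w. ennreal ((\<xi> w - blinfun_apply \<alpha>' (Z w))\<^sup>2) \<partial>M) < ennreal (e / 8)"
    unfolding gaussian_L2_closure_def by (auto dest!: spec[of _ "e / 8"])
  obtain \<alpha> where a: "\<alpha> \<in> eval_span"
    "(\<integral>\<^sup>+w. ennreal ((blinfun_apply \<alpha>' (Z w) - blinfun_apply \<alpha> (Z w))\<^sup>2) \<partial>M) < ennreal (e / 8)"
    using eval_span_dense[of "e / 8" \<alpha>'] \<open>0 < e\<close> by auto
  have "(\<integral>\<^sup>+w. ennreal ((\<xi> w - blinfun_apply \<alpha> (Z w))\<^sup>2) \<partial>M) \<le>
      2 * (\<integral>\<^sup>+w. ennreal ((\<xi> w - blinfun_apply \<alpha>' (Z w))\<^sup>2) \<partial>M) +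
      2 * (\<integral>\<^sup>+w. ennreal ((blinfun_apply \<alpha>' (Z w) - blinfun_apply \<alpha> (Z w))\<^sup>2) \<partial>M)"
    by (rule enn_square_diff_triangle) measurable
  also have "\<dots> \<le> 2 * ennreal (e / 8) + 2 * ennreal (e / 8)"
    using a' a(2) by (intro add_mono mult_left_mono) auto
  also have "\<dots> = ennreal (e / 2)"
    using \<open>0 < e\<close> by (simp add: ennreal_mult'[symmetric] ennreal_plus[symmetric] flip: ennreal_numeral del: ennreal_plus)
  also have "\<dots> < ennreal e" using \<open>0 < e\<close> by (simp add: ennreal_lessI)
  finally have "ennreal (\<integral>w. (\<xi> w - blinfun_apply \<alpha> (Z w))\<^sup>2 \<partial>M) < ennreal e"
    using integrable_square_diff_apply[OF gaussian_L2_closureD[OF \<xi>]]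
    by (subst (asm) nn_integral_eq_integral) auto
  then show thesis using a(1) by (intro that) (auto simp: ennreal_less_iff)
qed

text \<open>Completing the square in L^2: maximizing over \<alpha> is the same as approximating
  \<xi> by \<alpha>(Z).\<close>

lemma legendre_kernel_path:
  assumes "\<xi> \<in> borel_measurable M" "integrable M (\<lambda>w. (\<xi> w)\<^sup>2)"
  shows "legendre M Z \<alpha> (kernel_path M Z \<xi>) =
    ((\<integral>w. (\<xi> w)\<^sup>2 \<partial>M) - (\<integral>w. (\<xi> w - blinfun_apply \<alpha> (Z w))\<^sup>2 \<partial>M)) / 2"
proof -
  have "(\<lambda>w. (\<xi> w - blinfun_apply \<alpha> (Z w))\<^sup>2) =
      (\<lambda>w. (\<xi> w)\<^sup>2 - 2 * (\<xi> w * blinfun_apply \<alpha> (Z w)) + (blinfun_apply \<alpha> (Z w))\<^sup>2)"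
    by (simp add: fun_eq_iff power2_eq_square algebra_simps)
  then have "(\<integral>w. (\<xi> w - blinfun_apply \<alpha> (Z w))\<^sup>2 \<partial>M) =
      (\<integral>w. (\<xi> w)\<^sup>2 \<partial>M) - 2 * (\<integral>w. \<xi> w * blinfun_apply \<alpha> (Z w) \<partial>M) + covar M Z \<alpha> \<alpha>"
    using assms integrable_mult_apply[OF assms] integrable_square_apply[of \<alpha>]
    by (simp add: covar_eq_square)
  then show ?thesis by (simp add: legendre_def blinfun_apply_kernel_path[OF assms])
qed

text \<open>The distance term in \<open>legendre_kernel_path\<close> is nonnegative and can be made
  arbitrarily small, so the least upper bound is half the squared norm of \<xi>. Stating it for
  every bound c gives a description of level sets directly.\<close>

lemma legendre_le_iff:
  assumes \<xi>: "\<xi> \<in> gaussian_L2_closure M Z"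
  shows "(\<forall>\<alpha>\<in>eval_span. legendre M Z \<alpha> (kernel_path M Z \<xi>) \<le> c) \<longleftrightarrow> (\<integral>w. (\<xi> w)\<^sup>2 \<partial>M) / 2 \<le> c"
proof
  assume "(\<integral>w. (\<xi> w)\<^sup>2 \<partial>M) / 2 \<le> c"
  moreover have "0 \<le> (\<integral>w. (\<xi> w - blinfun_apply \<alpha> (Z w))\<^sup>2 \<partial>M)" for \<alpha> by simp
  ultimately show "\<forall>\<alpha>\<in>eval_span. legendre M Z \<alpha> (kernel_path M Z \<xi>) \<le> c"
    by (auto simp: legendre_kernel_path[OF gaussian_L2_closureD[OF \<xi>]] intro: order_trans[rotated])
next
  assume le: "\<forall>\<alpha>\<in>eval_span. legendre M Z \<alpha> (kernel_path M Z \<xi>) \<le> c"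
  show "(\<integral>w. (\<xi> w)\<^sup>2 \<partial>M) / 2 \<le> c"
  proof (rule field_le_epsilon)
    fix e :: real assume "0 < e"
    then obtain \<alpha> where "\<alpha> \<in> eval_span" "(\<integral>w. (\<xi> w - blinfun_apply \<alpha> (Z w))\<^sup>2 \<partial>M) < 2 * e"
      using gaussian_L2_closure_approx[OF \<xi>, of "2 * e"] by auto
    then show "(\<integral>w. (\<xi> w)\<^sup>2 \<partial>M) / 2 \<le> c + e"
      using le legendre_kernel_path[OF gaussian_L2_closureD[OF \<xi>], of \<alpha>] by fastforce
  qed
qed

lemma rkhs_eq: "rkhs M Z = kernel_path M Z ` gaussian_L2_closure M Z"
  unfolding rkhs_def kernel_path_def by auto

text \<open>By \<open>legendre_le_iff\<close> the L^2 norm of a representer is determined by the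
  represented path, so the \<open>THE\<close> in the definition has exactly one candidate.\<close>

lemma rkhs_norm_kernel_path:
  assumes \<xi>: "\<xi> \<in> gaussian_L2_closure M Z"
  shows "rkhs_norm M Z (kernel_path M Z \<xi>) = sqrt (\<integral>w. (\<xi> w)\<^sup>2 \<partial>M)"
  unfolding rkhs_norm_def
proof (rule the_equality)
  show "\<exists>\<xi>'\<in>gaussian_L2_closure M Z. kernel_path M Z \<xi> = (\<integral>w. \<xi>' w *\<^sub>R Z w \<partial>M) \<and>
      sqrt (\<integral>w. (\<xi> w)\<^sup>2 \<partial>M) = sqrt (\<integral>w. (\<xi>' w)\<^sup>2 \<partial>M)"
    using \<xi> by (auto simp: kernel_path_def)
  fix r
  assume "\<exists>\<xi>'\<in>gaussian_L2_closure M Z. kernel_path M Z \<xi> = (\<integral>w. \<xi>' w *\<^sub>R Z w \<partial>M) \<and>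
      r = sqrt (\<integral>w. (\<xi>' w)\<^sup>2 \<partial>M)"
  then obtain \<xi>' where \<xi>': "\<xi>' \<in> gaussian_L2_closure M Z" "kernel_path M Z \<xi>' = kernel_path M Z \<xi>"
    "r = sqrt (\<integral>w. (\<xi>' w)\<^sup>2 \<partial>M)"
    by (auto simp: kernel_path_def)
  have "(\<integral>w. (\<xi>' w)\<^sup>2 \<partial>M) / 2 \<le> c \<longleftrightarrow> (\<integral>w. (\<xi> w)\<^sup>2 \<partial>M) / 2 \<le> c" for c
    using legendre_le_iff[OF \<xi>] legendre_le_iff[OF \<xi>'(1)] \<xi>'(2) by simp
  from this[of "(\<integral>w. (\<xi>' w)\<^sup>2 \<partial>M) / 2"] this[of "(\<integral>w. (\<xi> w)\<^sup>2 \<partial>M) / 2"]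
  show "r = sqrt (\<integral>w. (\<xi> w)\<^sup>2 \<partial>M)" using \<xi>'(3) by simp
qed

text \<open>The converse half of the variational formula. The representer is the L^2 limit of
  maximizers, and it represents h because the supremum is stationary under perturbations in every
  direction \<gamma>.\<close>

lemma exists_rkhs_representer:
  assumes le: "\<And>\<alpha>. \<alpha> \<in> eval_span \<Longrightarrow> legendre M Z \<alpha> h \<le> c"
  obtains \<xi> where "\<xi> \<in> gaussian_L2_closure M Z" "h = kernel_path M Z \<xi>"
proof -
  define q where "q \<alpha> = covar M Z \<alpha> \<alpha>" for \<alpha>
  define S where "S = (SUP \<alpha>\<in>eval_span. legendre M Z \<alpha> h)"
  have bdd: "bdd_above ((\<lambda>\<alpha>. legendre M Z \<alpha> h) ` eval_span)" using le by (auto simp: bdd_above_def)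
  have leS: "legendre M Z \<alpha> h \<le> S" if "\<alpha> \<in> eval_span" for \<alpha>
    unfolding S_def by (rule cSUP_upper[OF that bdd])
  \<comment> \<open>The 8 cancels the factor of the parallelogram estimate; powers of 1/4 for
    squared distances become powers of 1/2 in L^1.\<close>
  have "\<exists>\<alpha>\<in>eval_span. S - (1/4) ^ n / 8 < legendre M Z \<alpha> h" for n :: nat
    using less_cSUP_iff[OF _ bdd, of "S - (1/4) ^ n / 8"] eval_span_closed(1)
    unfolding S_def[symmetric] by (auto simp: S_def)
  then obtain a where a: "\<And>n. a n \<in> eval_span" "\<And>n. S - (1/4) ^ n / 8 < legendre M Z (a n) h"
    by metis
  \<comment> \<open>At the midpoint the functional exceeds the average of its two values by
    q(\<alpha> - \<alpha>')/8, and it still cannot exceed S.\<close>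
  have parallelogram: "q (\<alpha> - \<alpha>') \<le> 8 * (S - legendre M Z \<alpha> h / 2 - legendre M Z \<alpha>' h / 2)"
    if "\<alpha> \<in> eval_span" "\<alpha>' \<in> eval_span" for \<alpha> \<alpha>'
  proof -
    have "legendre M Z ((1/2) *\<^sub>R (\<alpha> + \<alpha>')) h = legendre M Z \<alpha> h / 2 + legendre M Z \<alpha>' h / 2 + q (\<alpha> - \<alpha>') / 8"
      by (simp add: legendre_def q_def covar_simps blinfun.scaleR_left blinfun.add_left
          covar_commute[of \<alpha>' \<alpha>] field_simps)
    moreover have "legendre M Z ((1/2) *\<^sub>R (\<alpha> + \<alpha>')) h \<le> S" using that by (intro leS) auto
    ultimately show ?thesis by simp
  qed
  have cauchy: "q (a m - a n) \<le> (1/4) ^ k" if "k \<le> m" "k \<le> n" for k m n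
  proof -
    have "(1/4::real) ^ m \<le> (1/4) ^ k" "(1/4::real) ^ n \<le> (1/4) ^ k"
      using that by (auto intro: power_decreasing)
    moreover have "x \<le> z" if "y1 \<le> z" "y2 \<le> z" "x \<le> 8 * (S - u1 / 2 - u2 / 2)"
      "S - y1 / 8 < u1" "S - y2 / 8 < u2" for x y1 y2 z u1 u2 :: real
      using that by (simp add: field_simps)
    ultimately show ?thesis using parallelogram[OF a(1) a(1), of m n] a(2) by blast
  qed
  define Y where "Y n w = blinfun_apply (a n) (Z w)" for n w
  have [measurable]: "Y n \<in> borel_measurable M" for n unfolding Y_def by measurable
  have YY: "(\<integral>w. (Y m w - Y n w)\<^sup>2 \<partial>M) = q (a m - a n)" for m n
    by (simp add: Y_def q_def covar_eq_square blinfun.diff_left)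
  have iYY: "integrable M (\<lambda>w. (Y m w - Y n w)\<^sup>2)" for m n
    using integrable_square_apply[of "a m - a n"] by (simp add: Y_def blinfun.diff_left)
  have iY2: "integrable M (\<lambda>w. (Y n w)\<^sup>2)" for n
    unfolding Y_def by (rule integrable_square_apply)
  have iY: "integrable M (Y n)" for n
    by (rule square_integrable_imp_integrable) (use iY2 in auto)
  have L1: "(LINT w|M. norm (Y m w - Y n w)) \<le> (1/2) ^ k" if "k \<le> m" "k \<le> n" for k m n
  proof -
    have "(LINT w|M. \<bar>Y m w - Y n w\<bar> * 1)\<^sup>2 \<le>
        (LINT w|M. \<bar>Y m w - Y n w\<bar>\<^sup>2) * (LINT w|M. 1\<^sup>2)"
      by (rule Cauchy_Schwarz_square_integrable) (use iYY in auto)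
    also have "\<dots> \<le> (1/4) ^ k" using cauchy[OF that] by (simp add: YY prob_space)
    also have "\<dots> = ((1/2) ^ k)\<^sup>2"
      using power_mult_distrib[of "1/2::real" "1/2" k] by (simp add: power2_eq_square)
    finally have "(LINT w|M. norm (Y m w - Y n w))\<^sup>2 \<le> ((1/2) ^ k)\<^sup>2" by simp
    then show ?thesis by (rule power2_le_imp_le) simp
  qed
  \<comment> \<open>An actual function is needed as limit. On a probability space the L^2 rate
    passes to L^1, and an L^1 Cauchy sequence has an almost surely convergent subsequence.\<close>
  obtain r where r: "strict_mono (r :: nat \<Rightarrow> nat)" "AE w in M. Cauchy (\<lambda>i. Y (r i) w)"
  proof (rule cauchy_L1_AE_cauchy_subseq[OF iY])
    fix e :: real assume "0 < e"
    then obtain k where "(1/2) ^ k < e" using real_arch_pow_inv[of e "1/2"] by auto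
    then show "\<exists>N. \<forall>i\<ge>N. \<forall>j\<ge>N. LINT w|M. norm (Y i w - Y j w) < e"
      using L1 by (intro exI[of _ k]) (meson order.strict_trans1)
  qed
  define \<xi> where "\<xi> w = lim (\<lambda>i. Y (r i) w)" for w
  have [measurable]: "\<xi> \<in> borel_measurable M" unfolding \<xi>_def by measurable
  have lim: "AE w in M. (\<lambda>i. Y (r i) w) \<longlonglongrightarrow> \<xi> w"
    using r(2) by eventually_elim (auto simp: \<xi>_def Cauchy_convergent_iff convergent_LIMSEQ_iff)
  have ri: "i \<le> r i" for i using r(1) by (rule strict_mono_imp_increasing)
  \<comment> \<open>Fatou's lemma brings the L^2 rate back to the almost sure limit.\<close>
  have fatou: "(\<integral>\<^sup>+w. ennreal ((\<xi> w - Y (r k) w)\<^sup>2) \<partial>M) \<le> ennreal ((1/4) ^ k)" for k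
  proof -
    have "(\<integral>\<^sup>+w. ennreal ((\<xi> w - Y (r k) w)\<^sup>2) \<partial>M) =
        (\<integral>\<^sup>+w. liminf (\<lambda>i. ennreal ((Y (r i) w - Y (r k) w)\<^sup>2)) \<partial>M)"
    proof (rule nn_integral_cong_AE)
      show "AE w in M. ennreal ((\<xi> w - Y (r k) w)\<^sup>2) = liminf (\<lambda>i. ennreal ((Y (r i) w - Y (r k) w)\<^sup>2))"
        using lim
      proof eventually_elim
        case (elim w)
        then have "(\<lambda>i. ennreal ((Y (r i) w - Y (r k) w)\<^sup>2)) \<longlonglongrightarrow> ennreal ((\<xi> w - Y (r k) w)\<^sup>2)"
          by (intro tendsto_intros)
        then show ?case by (rule lim_imp_Liminf[symmetric, OF sequentially_bot])
      qed
    qed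
    also have "\<dots> \<le> liminf (\<lambda>i. \<integral>\<^sup>+w. ennreal ((Y (r i) w - Y (r k) w)\<^sup>2) \<partial>M)"
      by (rule nn_integral_liminf) measurable
    also have "\<dots> \<le> ennreal ((1/4) ^ k)"
    proof (rule Liminf_le)
      show "\<forall>\<^sub>F i in sequentially. (\<integral>\<^sup>+w. ennreal ((Y (r i) w - Y (r k) w)\<^sup>2) \<partial>M) \<le> ennreal ((1/4) ^ k)"
        using eventually_ge_at_top[of k]
      proof eventually_elim
        case (elim i)
        then have "q (a (r i) - a (r k)) \<le> (1/4) ^ k" using ri[of i] ri[of k] by (intro cauchy) auto
        then show ?case using iYY by (simp add: nn_integral_eq_integral YY ennreal_leI)
      qed
    qed simp
    finally show ?thesis .
  qed
  have i\<xi>Y: "integrable M (\<lambda>w. (\<xi> w - Y (r k) w)\<^sup>2)" for k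
    by (rule integrableI_bounded) (use fatou[of k] in \<open>auto intro: order.strict_trans1\<close>)
  have E\<xi>Y: "(\<integral>w. (\<xi> w - Y (r k) w)\<^sup>2 \<partial>M) \<le> (1/4) ^ k" for k
    using fatou[of k] i\<xi>Y[of k] by (simp add: nn_integral_eq_integral)
  have i\<xi>: "integrable M (\<lambda>w. (\<xi> w)\<^sup>2)"
  proof (rule Bochner_Integration.integrable_bound)
    show "integrable M (\<lambda>w. 2 * (\<xi> w - Y (r 0) w)\<^sup>2 + 2 * (Y (r 0) w)\<^sup>2)"
      using i\<xi>Y iY2 by simp
    have "x\<^sup>2 \<le> 2 * (x - y)\<^sup>2 + 2 * y\<^sup>2" for x y :: real
      using zero_le_power2[of "x - 2 * y"] by (simp add: power2_eq_square algebra_simps)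
    then show "AE w in M. norm ((\<xi> w)\<^sup>2) \<le> norm (2 * (\<xi> w - Y (r 0) w)\<^sup>2 + 2 * (Y (r 0) w)\<^sup>2)" by simp
  qed measurable
  have closure: "\<xi> \<in> gaussian_L2_closure M Z"
    unfolding gaussian_L2_closure_def
  proof (safe intro!: i\<xi>)
    fix e :: real assume "0 < e"
    then obtain k where k: "(1/4) ^ k < e" using real_arch_pow_inv[of e "1/4"] by auto
    then have "(\<integral>\<^sup>+w. ennreal ((\<xi> w - blinfun_apply (a (r k)) (Z w))\<^sup>2) \<partial>M) < ennreal e"
      using fatou[of k] \<open>0 < e\<close> unfolding Y_def by (auto intro: order.strict_trans1 simp: ennreal_lessI)
    then show "\<exists>\<alpha> :: C01 \<Rightarrow>\<^sub>L real. (\<integral>\<^sup>+w. ennreal ((\<xi> w - blinfun_apply \<alpha> (Z w))\<^sup>2) \<partial>M) < ennreal e"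
      by blast
  qed measurable
  have "blinfun_apply \<gamma> h = blinfun_apply \<gamma> (kernel_path M Z \<xi>)" if \<gamma>: "\<gamma> \<in> eval_span" for \<gamma>
  proof -
    define d where "d = blinfun_apply \<gamma> h - blinfun_apply \<gamma> (kernel_path M Z \<xi>)"
    have cov: "(\<lambda>k. covar M Z (a (r k)) \<gamma>) \<longlonglongrightarrow> blinfun_apply \<gamma> (kernel_path M Z \<xi>)"
    proof (rule LIM_zero_cancel, rule Lim_null_comparison[OF always_eventually, rule_format])
      fix k
      have "covar M Z (a (r k)) \<gamma> - blinfun_apply \<gamma> (kernel_path M Z \<xi>) =
          - (\<integral>w. (\<xi> w - Y (r k) w) * blinfun_apply \<gamma> (Z w) \<partial>M)"
        using integrable_mult_apply[OF _ i\<xi>, of \<gamma>]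
        by (simp add: covar_def blinfun_apply_kernel_path i\<xi> Y_def left_diff_distrib)
      moreover have "(\<integral>w. (\<xi> w - Y (r k) w) * blinfun_apply \<gamma> (Z w) \<partial>M)\<^sup>2 \<le>
          (\<integral>w. (\<xi> w - Y (r k) w)\<^sup>2 \<partial>M) * q \<gamma>"
        unfolding q_def covar_eq_square
        by (rule Cauchy_Schwarz_square_integrable) (use i\<xi>Y integrable_square_apply in auto)
      moreover have "\<dots> \<le> (1/4) ^ k * q \<gamma>"
        by (intro mult_right_mono E\<xi>Y) (simp add: q_def covar_nonneg)
      ultimately have "(covar M Z (a (r k)) \<gamma> - blinfun_apply \<gamma> (kernel_path M Z \<xi>))\<^sup>2 \<le> (1/4) ^ k * q \<gamma>"
        by simp
      then show "norm (covar M Z (a (r k)) \<gamma> - blinfun_apply \<gamma> (kernel_path M Z \<xi>)) \<le> sqrt ((1/4) ^ k * q \<gamma>)"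
        by (simp add: real_le_rsqrt)
    next
      have "(\<lambda>k. sqrt ((1/4) ^ k * q \<gamma>)) \<longlonglongrightarrow> sqrt (0 * q \<gamma>)"
        by (intro tendsto_intros LIMSEQ_power_zero) auto
      then show "(\<lambda>k. sqrt ((1/4) ^ k * q \<gamma>)) \<longlonglongrightarrow> 0" by simp
    qed
    have S: "(\<lambda>k. legendre M Z (a (r k)) h) \<longlonglongrightarrow> S"
    proof (rule tendsto_sandwich[OF always_eventually always_eventually])
      show "\<forall>k. S - (1/4) ^ k / 8 \<le> legendre M Z (a (r k)) h"
      proof
        fix k
        have "S - (1/4::real) ^ k / 8 \<le> S - (1/4) ^ r k / 8" using ri[of k] by simp
        also have "\<dots> < legendre M Z (a (r k)) h" by (rule a(2))
        finally show "S - (1/4) ^ k / 8 \<le> legendre M Z (a (r k)) h" by simp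
      qed
      show "\<forall>k. legendre M Z (a (r k)) h \<le> S" using leS a(1) by blast
      have "(\<lambda>k. S - (1/4) ^ k / 8) \<longlonglongrightarrow> S - 0 / 8"
        by (intro tendsto_intros LIMSEQ_power_zero) auto
      then show "(\<lambda>k. S - (1/4) ^ k / 8) \<longlonglongrightarrow> S" by simp
    qed simp
    \<comment> \<open>First-order condition: adding l \<gamma> to a maximizing sequence cannot lift
      the limit above S. The inequality for all l forces the defect d to vanish.\<close>
    have quad: "l * d \<le> l\<^sup>2 * q \<gamma> / 2" for l
    proof -
      have "legendre M Z (a (r k)) h + l * (blinfun_apply \<gamma> h - covar M Z (a (r k)) \<gamma>) - l\<^sup>2 * q \<gamma> / 2 \<le> S" for k
      proof -
        have "legendre M Z (a (r k) + l *\<^sub>R \<gamma>) h =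
            legendre M Z (a (r k)) h + l * (blinfun_apply \<gamma> h - covar M Z (a (r k)) \<gamma>) - l\<^sup>2 * q \<gamma> / 2"
          by (simp add: legendre_def q_def covar_simps blinfun.scaleR_left blinfun.add_left
              covar_commute[of \<gamma> "a (r k)"] field_simps power2_eq_square)
        moreover have "legendre M Z (a (r k) + l *\<^sub>R \<gamma>) h \<le> S" using a(1) \<gamma> by (intro leS) auto
        ultimately show ?thesis by simp
      qed
      moreover have "(\<lambda>k. legendre M Z (a (r k)) h + l * (blinfun_apply \<gamma> h - covar M Z (a (r k)) \<gamma>) - l\<^sup>2 * q \<gamma> / 2)
          \<longlonglongrightarrow> S + l * d - l\<^sup>2 * q \<gamma> / 2"
        unfolding d_def by (intro tendsto_intros S cov)
      ultimately have "S + l * d - l\<^sup>2 * q \<gamma> / 2 \<le> S"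
        by (intro LIMSEQ_le_const2) auto
      then show ?thesis by simp
    qed
    have q0: "0 \<le> q \<gamma>" by (simp add: q_def covar_nonneg)
    have "d = 0"
    proof (rule ccontr)
      assume "d \<noteq> 0"
      \<comment> \<open>A step of this size makes the linear term win over the quadratic one; the +
        1 covers the case of zero variance.\<close>
      define x where "x = d / (q \<gamma> + 1)"
      have x: "x \<noteq> 0" "d = x * (q \<gamma> + 1)" using \<open>d \<noteq> 0\<close> q0 by (auto simp: x_def)
      have "x * d \<le> x\<^sup>2 * q \<gamma> / 2" by (rule quad)
      then have "x\<^sup>2 * (q \<gamma> / 2 + 1) \<le> 0" by (simp add: x(2) power2_eq_square algebra_simps)
      moreover have "0 < x\<^sup>2 * (q \<gamma> / 2 + 1)" using x(1) q0 by (intro mult_pos_pos) auto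
      ultimately show False by simp
    qed
    then show ?thesis by (simp add: d_def)
  qed
  from this[OF evaluation_in_span] have "h = kernel_path M Z \<xi>" by (intro bcontfun_eqI) simp
  with closure show thesis by (rule that)
qed

lemma rkhs_rate_kernel_path:
  assumes "\<xi> \<in> gaussian_L2_closure M Z"
  shows "rkhs_rate M Z (kernel_path M Z \<xi>) = ennreal ((\<integral>w. (\<xi> w)\<^sup>2 \<partial>M) / 2)"
  using assms by (auto simp: rkhs_rate_def rkhs_eq rkhs_norm_kernel_path)

text \<open>Level sets become intersections of closed sets given by single functionals, both on and
  off the RKHS. The condition 0 \<le> c matters because \<open>ennreal\<close> sends negative
  numbers to 0.\<close>

lemma rkhs_rate_le_iff:
  assumes "0 \<le> c"
  shows "rkhs_rate M Z h \<le> ennreal c \<longleftrightarrow> (\<forall>\<alpha>\<in>eval_span. legendre M Z \<alpha> h \<le> c)"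
proof (cases "h \<in> rkhs M Z")
  case True
  then obtain \<xi> where "\<xi> \<in> gaussian_L2_closure M Z" "h = kernel_path M Z \<xi>" by (auto simp: rkhs_eq)
  then show ?thesis using assms by (simp add: rkhs_rate_kernel_path legendre_le_iff)
next
  case False
  then have "\<not> (\<forall>\<alpha>\<in>eval_span. legendre M Z \<alpha> h \<le> c)"
    by (metis (no_types) rkhs_eq exists_rkhs_representer image_eqI)
  then show ?thesis using False by (auto simp: rkhs_rate_def top_unique)
qed

text \<open>On a level set Cauchy-Schwarz bounds \<alpha>(h)^2 by 2 c times the variance of
  \<alpha>. For increments this gives a Hoelder bound with exponent \<beta>/2, for time 0 it gives
  the value 0; a closed subset of a compact Hoelder set results.\<close>

lemma rate_function_rkhs_rate: "rate_function (rkhs_rate M Z)"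
proof -
  have closed: "closed {h. rkhs_rate M Z h \<le> a}" for a
  proof (cases a)
    case (real c)
    have "closed (\<Inter>\<alpha>\<in>eval_span. {h. legendre M Z \<alpha> h \<le> c})"
      unfolding legendre_def by (intro closed_INT ballI closed_Collect_le continuous_intros)
    also have "(\<Inter>\<alpha>\<in>eval_span. {h. legendre M Z \<alpha> h \<le> c}) = {h. rkhs_rate M Z h \<le> a}"
      using real by (auto simp: rkhs_rate_le_iff)
    finally show ?thesis .
  qed simp
  have "compact {h. rkhs_rate M Z h \<le> a}" if a: "a < \<infinity>" for a
  proof -
    obtain c where c: "0 \<le> c" "a = ennreal c" using a by (cases a) auto
    have "{h. rkhs_rate M Z h \<le> a} \<subseteq> hoelder_set (\<beta> / 2) (sqrt (2 * c * C))"
    proof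
      fix h assume "h \<in> {h. rkhs_rate M Z h \<le> a}"
      then have h: "\<And>\<alpha>. \<alpha> \<in> eval_span \<Longrightarrow> legendre M Z \<alpha> h \<le> c"
        using c by (simp add: rkhs_rate_le_iff)
      have "(blinfun_apply \<alpha> h)\<^sup>2 \<le> 2 * c * covar M Z \<alpha> \<alpha>" if \<alpha>: "\<alpha> \<in> eval_span" for \<alpha>
      proof -
        obtain \<xi> where \<xi>: "\<xi> \<in> gaussian_L2_closure M Z" "h = kernel_path M Z \<xi>"
          using exists_rkhs_representer h by blast
        note \<xi>' = gaussian_L2_closureD[OF \<xi>(1)]
        have "(blinfun_apply \<alpha> h)\<^sup>2 \<le> (\<integral>w. (\<xi> w)\<^sup>2 \<partial>M) * covar M Z \<alpha> \<alpha>"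
          unfolding \<xi>(2) blinfun_apply_kernel_path[OF \<xi>'] covar_eq_square
          by (rule Cauchy_Schwarz_square_integrable) (use \<xi>' integrable_square_apply in auto)
        also have "\<dots> \<le> 2 * c * covar M Z \<alpha> \<alpha>"
          using h legendre_le_iff[OF \<xi>(1), of c] \<xi>(2) by (intro mult_right_mono covar_nonneg) auto
        finally show ?thesis .
      qed
      note bound = this
      have "(apply_bcontfun h (Unit_interval 0))\<^sup>2 \<le> 2 * c * 0"
        using bound[of "evaluation (Unit_interval 0)"]
          represent_eval_0[of "evaluation (Unit_interval 0)"] by (simp only: represent_eval) simp
      moreover have "\<bar>apply_bcontfun h s - apply_bcontfun h t\<bar> \<le> sqrt (2 * c * C) * dist s t powr (\<beta> / 2)" for s t
      proof -
        have "(apply_bcontfun h s - apply_bcontfun h t)\<^sup>2 \<le>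
            2 * c * covar M Z (evaluation s - evaluation t) (evaluation s - evaluation t)"
          using bound[of "evaluation s - evaluation t"] by (simp add: blinfun.diff_left)
        also have "\<dots> \<le> 2 * c * (C * dist t s powr \<beta>)"
          using c(1) by (intro mult_left_mono covar_incr) auto
        also have "\<dots> = (sqrt (2 * c * C) * dist s t powr (\<beta> / 2))\<^sup>2"
          using c(1) C_pos by (cases "s = t") (simp_all add: power_mult_distrib powr_power dist_commute)
        finally show ?thesis
          using c(1) C_pos by (subst (asm) power2_le_iff_abs_le) auto
      qed
      ultimately show "h \<in> hoelder_set (\<beta> / 2) (sqrt (2 * c * C))" by (simp add: hoelder_set_def)
    qed
    then have "{h. rkhs_rate M Z h \<le> a} = hoelder_set (\<beta> / 2) (sqrt (2 * c * C)) \<inter> {h. rkhs_rate M Z h \<le> a}"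
      by blast
    also have "compact \<dots>"
      using \<beta>_pos c(1) C_pos by (intro compact_Int_closed compact_hoelder_set closed) auto
    finally show ?thesis .
  qed
  with closed show ?thesis unfolding rate_function_def by blast
qed

text \<open>Reduces the lower bound at an arbitrary path of the RKHS to paths represented by an
  element of \<open>eval_span\<close>, the functionals for which the tilt is available.\<close>

lemma kernel_path_approx:
  assumes \<xi>: "\<xi> \<in> gaussian_L2_closure M Z" and G: "open G" "kernel_path M Z \<xi> \<in> G" and "0 < e"
  obtains \<alpha> where "\<alpha> \<in> eval_span" "represent M Z \<alpha> \<in> G"
    "covar M Z \<alpha> \<alpha> \<le> (\<integral>w. (\<xi> w)\<^sup>2 \<partial>M) + e"
proof -
  note \<xi>' = gaussian_L2_closureD[OF \<xi>]
  note [measurable] = \<xi>'(1)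
  define m where "m = (\<integral>w. (norm (Z w))\<^sup>2 \<partial>M)"
  have m: "0 \<le> m" by (simp add: m_def)
  define v where "v = (\<integral>w. (\<xi> w)\<^sup>2 \<partial>M)"
  have v: "0 \<le> v" by (simp add: v_def)
  obtain \<rho> where \<rho>: "0 < \<rho>" "ball (kernel_path M Z \<xi>) \<rho> \<subseteq> G" using G open_contains_ball by blast
  \<comment> \<open>The first entry keeps the represented path within \<rho> of the given one, the
    others give \<delta> (v + \<delta> + 1) \<le> e in the variance estimate.\<close>
  define \<delta> where "\<delta> = min (\<rho> / (m + 1)) (min 1 (e / (2 * v + 3)))"
  have \<delta>: "0 < \<delta>" "\<delta> \<le> 1" "\<delta> \<le> e / (2 * v + 3)" "\<delta> \<le> \<rho> / (m + 1)"
    using \<rho>(1) \<open>0 < e\<close> m v unfolding \<delta>_def by (auto intro: divide_pos_pos add_nonneg_pos)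
  obtain \<alpha> where \<alpha>: "\<alpha> \<in> eval_span" "(\<integral>w. (\<xi> w - blinfun_apply \<alpha> (Z w))\<^sup>2 \<partial>M) < \<delta>\<^sup>2"
    using gaussian_L2_closure_approx[OF \<xi>, of "\<delta>\<^sup>2"] \<delta>(1) by auto
  define X where "X w = \<xi> w - blinfun_apply \<alpha> (Z w)" for w
  have [measurable]: "X \<in> borel_measurable M" unfolding X_def by measurable
  have iX: "integrable M (\<lambda>w. (X w)\<^sup>2)" unfolding X_def by (rule integrable_square_diff_apply[OF \<xi>'])
  have EX: "(\<integral>w. (X w)\<^sup>2 \<partial>M) < \<delta>\<^sup>2" using \<alpha>(2) by (simp add: X_def)
  have "kernel_path M Z \<xi> - represent M Z \<alpha> = (\<integral>w. X w *\<^sub>R Z w \<partial>M)"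
    unfolding kernel_path_def X_def
    using integrable_scaleR_path[OF \<xi>'] integrable_scaleR_path[OF _ integrable_square_apply[of \<alpha>]]
    by (simp add: scaleR_diff_left)
  also have "norm \<dots> \<le> (\<integral>w. \<bar>X w\<bar> * norm (Z w) \<partial>M)"
    using integral_norm_bound[of M "\<lambda>w. X w *\<^sub>R Z w"] by simp
  also have "\<dots> < \<rho>"
  proof -
    have "(\<integral>w. \<bar>X w\<bar> * norm (Z w) \<partial>M)\<^sup>2 \<le> (\<integral>w. \<bar>X w\<bar>\<^sup>2 \<partial>M) * m"
      unfolding m_def by (rule Cauchy_Schwarz_square_integrable) (use iX integrable_norm_square in auto)
    also have "\<dots> \<le> \<delta>\<^sup>2 * m" using EX m by (intro mult_right_mono) auto
    also have "\<dots> < \<delta>\<^sup>2 * (m + 1)\<^sup>2"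
    proof -
      have "(m + 1)\<^sup>2 = m + (1 + m + m\<^sup>2)" by (simp add: power2_eq_square algebra_simps)
      then have "m < (m + 1)\<^sup>2" using m zero_le_power2[of m] by linarith
      then show ?thesis using \<delta>(1) by simp
    qed
    also have "\<dots> = (\<delta> * (m + 1))\<^sup>2" by (simp add: power_mult_distrib)
    also have "\<dots> \<le> \<rho>\<^sup>2"
      using \<delta>(1,4) m by (intro power_mono) (auto simp: field_simps)
    finally show ?thesis using \<rho>(1) by (intro power2_less_imp_less[of _ \<rho>]) auto
  qed
  finally have 1: "represent M Z \<alpha> \<in> G" using \<rho>(2) by (auto simp: dist_norm)
  have "covar M Z \<alpha> \<alpha> \<le> v + e"
  proof -
    \<comment> \<open>Young's inequality with weight \<delta>: the main term is multiplied by only 1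
      + \<delta>, while the large factor 1 + 1/\<delta> meets an error below \<delta>^2.\<close>
    have "(blinfun_apply \<alpha> f)\<^sup>2 \<le> (1 + \<delta>) * x\<^sup>2 + (1 + 1 / \<delta>) * (x - blinfun_apply \<alpha> f)\<^sup>2" for f x
    proof -
      have "0 \<le> (\<delta> * x + (x - blinfun_apply \<alpha> f))\<^sup>2 / \<delta>" using \<delta>(1) by simp
      also have "\<dots> = (1 + \<delta>) * x\<^sup>2 + (1 + 1 / \<delta>) * (x - blinfun_apply \<alpha> f)\<^sup>2 - (blinfun_apply \<alpha> f)\<^sup>2"
        using \<delta>(1) by (simp add: field_simps power2_eq_square)
      finally show ?thesis by simp
    qed
    then have "covar M Z \<alpha> \<alpha> \<le> (\<integral>w. (1 + \<delta>) * (\<xi> w)\<^sup>2 + (1 + 1 / \<delta>) * (X w)\<^sup>2 \<partial>M)"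
      unfolding covar_eq_square X_def
      by (intro integral_mono) (use \<xi>' iX integrable_square_apply in \<open>auto simp: X_def\<close>)
    also have "\<dots> = (1 + \<delta>) * v + (1 + 1 / \<delta>) * (\<integral>w. (X w)\<^sup>2 \<partial>M)"
      using \<xi>' iX by (simp add: v_def)
    also have "\<dots> \<le> (1 + \<delta>) * v + (1 + 1 / \<delta>) * \<delta>\<^sup>2"
      using EX \<delta>(1) by (intro add_left_mono mult_left_mono) auto
    also have "\<dots> = v + \<delta> * (v + \<delta> + 1)" using \<delta>(1) by (simp add: field_simps power2_eq_square)
    also have "\<delta> * (v + \<delta> + 1) \<le> \<delta> * (2 * v + 3)" using \<delta> v by (intro mult_left_mono) auto
    also have "\<dots> \<le> e" using \<delta>(3) v by (simp add: field_simps)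
    finally show ?thesis by simp
  qed
  then show thesis using that[OF \<alpha>(1) 1] by (simp add: v_def)
qed

end

section \<open>Weak convergence\<close>

lemma chaining_tail_small:
  assumes "0 < C" "0 < \<beta>" "0 < \<eta>"
  obtains l where "1 \<le> l" "chaining_const C \<beta> * exp (- l\<^sup>2 / (4 * C)) \<le> \<eta>"
proof -
  define A where "A = chaining_const C \<beta>"
  have A: "0 < A" unfolding A_def using assms by (intro chaining_const_pos)
  \<comment> \<open>Since l \<le> l^2 for l \<ge> 1, a choice linear in the logarithm is
    enough.\<close>
  define l where "l = max 1 (4 * C * ln (A / \<eta>))"
  have l: "1 \<le> l" "4 * C * ln (A / \<eta>) \<le> l" by (auto simp: l_def)
  have "l \<le> l\<^sup>2" using l(1) by (simp add: power2_eq_square)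
  then have "ln (A / \<eta>) \<le> l\<^sup>2 / (4 * C)" using l(2) assms by (simp add: pos_le_divide_eq mult.commute)
  then have "A / \<eta> \<le> exp (l\<^sup>2 / (4 * C))"
    using A assms by (simp add: ln_le_cancel_iff[symmetric, of "A / \<eta>" "exp (l\<^sup>2 / (4 * C))"])
  then have "A * exp (- l\<^sup>2 / (4 * C)) \<le> \<eta>" using assms by (simp add: exp_minus field_simps)
  then show thesis using l(1) that unfolding A_def by blast
qed

section \<open>Trigonometric polynomials in the point evaluations\<close>

inductive_set trig_polys :: "(C01 \<Rightarrow> real) set" where
  cos: "\<alpha> \<in> eval_span \<Longrightarrow> (\<lambda>f. cos (blinfun_apply \<alpha> f)) \<in> trig_polys"
| sin: "\<alpha> \<in> eval_span \<Longrightarrow> (\<lambda>f. sin (blinfun_apply \<alpha> f)) \<in> trig_polys"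
| add: "F \<in> trig_polys \<Longrightarrow> G \<in> trig_polys \<Longrightarrow> (\<lambda>f. F f + G f) \<in> trig_polys"
| scale: "F \<in> trig_polys \<Longrightarrow> (\<lambda>f. c * F f) \<in> trig_polys"

lemma trig_polys_divide: "F \<in> trig_polys \<Longrightarrow> (\<lambda>f. F f / c) \<in> trig_polys"
  using trig_polys.scale[of F "inverse c"] by (simp add: divide_inverse mult.commute)

lemma trig_polys_diff:
  "F \<in> trig_polys \<Longrightarrow> G \<in> trig_polys \<Longrightarrow> (\<lambda>f. F f - G f) \<in> trig_polys"
  using trig_polys.add[OF _ trig_polys.scale[of G "-1"], of F] by simp

lemma trig_polys_mult_basic:
  assumes G: "G \<in> trig_polys" and \<alpha>: "\<alpha> \<in> eval_span"
  shows "(\<lambda>f. cos (blinfun_apply \<alpha> f) * G f) \<in> trig_polys \<and>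
    (\<lambda>f. sin (blinfun_apply \<alpha> f) * G f) \<in> trig_polys"
  using G
proof induction
  case (cos \<gamma>)
  have "(\<lambda>f. cos (blinfun_apply \<alpha> f) * cos (blinfun_apply \<gamma> f)) =
      (\<lambda>f. (cos (blinfun_apply (\<alpha> - \<gamma>) f) + cos (blinfun_apply (\<alpha> + \<gamma>) f)) / 2)"
    "(\<lambda>f. sin (blinfun_apply \<alpha> f) * cos (blinfun_apply \<gamma> f)) =
      (\<lambda>f. (sin (blinfun_apply (\<alpha> + \<gamma>) f) + sin (blinfun_apply (\<alpha> - \<gamma>) f)) / 2)"
    by (simp_all add: cos_times_cos sin_times_cos blinfun.add_left blinfun.diff_left)
  then show ?case using \<alpha> cos by (auto intro!: trig_polys_divide trig_polys_diff trig_polys.intros)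
next
  case (sin \<gamma>)
  have "(\<lambda>f. cos (blinfun_apply \<alpha> f) * sin (blinfun_apply \<gamma> f)) =
      (\<lambda>f. (sin (blinfun_apply (\<alpha> + \<gamma>) f) - sin (blinfun_apply (\<alpha> - \<gamma>) f)) / 2)"
    "(\<lambda>f. sin (blinfun_apply \<alpha> f) * sin (blinfun_apply \<gamma> f)) =
      (\<lambda>f. (cos (blinfun_apply (\<alpha> - \<gamma>) f) - cos (blinfun_apply (\<alpha> + \<gamma>) f)) / 2)"
    by (simp_all add: cos_times_sin sin_times_sin blinfun.add_left blinfun.diff_left)
  then show ?case using \<alpha> sin by (auto intro!: trig_polys_divide trig_polys_diff trig_polys.intros)
next
  case (add F G)
  then show ?case by (auto simp: distrib_left intro: trig_polys.add)
next
  case (scale F c)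
  then show ?case by (auto simp: mult.left_commute[of _ c] intro: trig_polys.scale)
qed

text \<open>Linear combinations of cosines and sines already form an algebra by the product-to-sum
  formulas. Keeping products out of the inductive rules lets expectations be computed by
  induction.\<close>

lemma trig_polys_mult:
  assumes "F \<in> trig_polys" "G \<in> trig_polys"
  shows "(\<lambda>f. F f * G f) \<in> trig_polys"
  using assms(1)
proof induction
  case (add F F')
  then show ?case by (auto simp: distrib_right intro: trig_polys.add)
next
  case (scale F c)
  then show ?case by (auto simp: mult.assoc intro: trig_polys.scale)
qed (use trig_polys_mult_basic[OF assms(2)] in auto)

lemma trig_polys_const: "(\<lambda>_. c) \<in> trig_polys"
  using trig_polys.scale[OF trig_polys.cos[OF eval_span_closed(1)], of c] by simp

lemma trig_polys_continuous:
  assumes "F \<in> trig_polys"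
  shows "continuous_on S F"
  using assms by induction (auto intro!: continuous_intros)

lemma trig_polys_bounded:
  assumes "F \<in> trig_polys"
  obtains B where "\<And>f. \<bar>F f\<bar> \<le> B"
proof -
  from assms have "\<exists>B. \<forall>f. \<bar>F f\<bar> \<le> B"
  proof induction
    case (add F G)
    then obtain A B where "\<And>f. \<bar>F f\<bar> \<le> A" "\<And>f. \<bar>G f\<bar> \<le> B" by blast
    then have "\<bar>F f + G f\<bar> \<le> A + B" for f by (meson abs_triangle_ineq add_mono order_trans)
    then show ?case by blast
  next
    case (scale F c)
    then obtain A where "\<And>f. \<bar>F f\<bar> \<le> A" by blast
    then have "\<bar>c * F f\<bar> \<le> \<bar>c\<bar> * A" for f by (simp add: abs_mult mult_left_mono)
    then show ?case by blast
  qed (auto intro: exI[of _ 1])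
  then show thesis using that by blast
qed

lemma trig_polys_polynomial:
  assumes "real_polynomial_function (q :: real \<Rightarrow> real)" "F \<in> trig_polys"
  shows "(\<lambda>f. q (F f)) \<in> trig_polys"
  using assms(1)
proof induction
  case (linear h)
  then have "h x = h 1 * x" for x
    using linear_simps(5)[of h x 1] by (simp add: mult.commute)
  then have "(\<lambda>f. h (F f)) = (\<lambda>f. h 1 * F f)" by blast
  then show ?case using trig_polys.scale[OF assms(2)] by simp
qed (auto intro: trig_polys_const trig_polys.add trig_polys_mult)

lemma trig_polys_separate:
  assumes "f \<noteq> f'"
  obtains F where "F \<in> trig_polys" "F f \<noteq> F f'"
proof -
  obtain u where u: "apply_bcontfun f u \<noteq> apply_bcontfun f' u" using assms bcontfun_eqI by metis
  define a b where "a = apply_bcontfun f u" and "b = apply_bcontfun f' u"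
  \<comment> \<open>Shrinks both values into [-1, 1], where the sine is injective.\<close>
  define c where "c = 1 / (1 + \<bar>a\<bar> + \<bar>b\<bar>)"
  have c: "0 < c" by (simp add: c_def add_pos_nonneg)
  have "\<bar>c * a\<bar> \<le> 1" "\<bar>c * b\<bar> \<le> 1"
    by (auto simp: c_def abs_mult field_simps)
  then have "- (pi / 2) \<le> c * a" "c * a \<le> pi / 2" "- (pi / 2) \<le> c * b" "c * b \<le> pi / 2"
    using pi_ge_two by auto
  moreover have "c * a \<noteq> c * b" using u c by (simp add: a_def b_def)
  ultimately have "sin (c * a) \<noteq> sin (c * b)" using sin_inj_pi by metis
  then show thesis
    by (intro that[of "\<lambda>f. sin (blinfun_apply (c *\<^sub>R evaluation u) f)"] trig_polys.sin)
      (auto simp: blinfun.scaleR_left a_def b_def)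
qed

text \<open>
  Composing the Stone--Weierstrass approximant with a polynomial close to a truncation keeps it
  bounded off the compact set without leaving the algebra.
\<close>

lemma trig_polys_approx:
  fixes \<phi> :: "C01 \<Rightarrow> real"
  assumes K: "compact K" and \<phi>: "continuous_on UNIV \<phi>" "\<And>f. \<bar>\<phi> f\<bar> \<le> B" and e: "0 < e"
  obtains F where "F \<in> trig_polys" "\<And>f. f \<in> K \<Longrightarrow> \<bar>F f - \<phi> f\<bar> \<le> e" "\<And>f. \<bar>F f\<bar> \<le> B + e"
proof -
  have B: "0 \<le> B" using \<phi>(2)[of 0] by linarith
  interpret function_ring_on trig_polys K
    by unfold_locales (use K in \<open>auto intro: trig_polys_continuous trig_polys.add
        trig_polys_mult trig_polys_const elim: trig_polys_separate\<close>)
  obtain p where p: "p \<in> trig_polys" "\<And>f. f \<in> K \<Longrightarrow> \<bar>\<phi> f - p f\<bar> < e / 2"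
    using Stone_Weierstrass_basic[of \<phi> "e / 2"] e continuous_on_subset[OF \<phi>(1)] by auto
  obtain R where R: "\<And>f. \<bar>p f\<bar> \<le> R" using trig_polys_bounded[OF p(1)] by blast
  define clip where "clip x = max (- (B + e / 2)) (min (B + e / 2) x)" for x :: real
  have "continuous_on {-R..R} clip" unfolding clip_def by (intro continuous_intros)
  then obtain q where q: "real_polynomial_function q" "\<And>x. x \<in> {-R..R} \<Longrightarrow> \<bar>clip x - q x\<bar> < e / 2"
    using Stone_Weierstrass_real_polynomial_function[of "{-R..R}" clip "e / 2"] e by auto
  have q': "\<bar>clip (p f) - q (p f)\<bar> < e / 2" for f
    using R[of f] by (intro q(2)) (auto simp: abs_le_iff)
  show thesis
  proof (rule that)
    show "(\<lambda>f. q (p f)) \<in> trig_polys" by (rule trig_polys_polynomial[OF q(1) p(1)])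
    show "\<bar>q (p f) - \<phi> f\<bar> \<le> e" if "f \<in> K" for f
    proof -
      have "\<bar>p f\<bar> \<le> B + e / 2" using p(2)[OF that] \<phi>(2)[of f] by linarith
      then have "clip (p f) = p f" by (auto simp: clip_def)
      then show ?thesis using p(2)[OF that] q'[of f] by linarith
    qed
    show "\<bar>q (p f)\<bar> \<le> B + e" for f
    proof -
      have "\<bar>clip (p f)\<bar> \<le> B + e / 2" using B e by (auto simp: clip_def)
      then show ?thesis using q'[of f] by linarith
    qed
  qed
qed

lemma eventually_in_unit: "\<forall>\<^sub>F \<epsilon> in at_right (0::real). \<epsilon> \<in> {0<..1}"
  by (rule eventually_at_rightI[of 0 1]) auto

text \<open>The error is e on the Hoelder set and at most 2 B + 1 off it, an event of probability at
  most e.\<close>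

lemma (in subgaussian_path) expectation_trig_approx:
  assumes l: "1 \<le> l" "chaining_const C \<beta> * exp (- l\<^sup>2 / (4 * C)) \<le> e" and e: "0 \<le> e" "e \<le> 1"
    and [measurable]: "F \<in> borel_measurable borel" "\<phi> \<in> borel_measurable borel"
    and close: "\<And>f. f \<in> hoelder_set (\<beta> / 4) (hoelder_const (\<beta> / 4) * l) \<Longrightarrow> \<bar>F f - \<phi> f\<bar> \<le> e"
    and \<phi>: "\<And>f. \<bar>\<phi> f\<bar> \<le> B" and F: "\<And>f. \<bar>F f\<bar> \<le> B + e"
  shows "\<bar>expectation (\<lambda>w. F (W w)) - expectation (\<lambda>w. \<phi> (W w))\<bar> \<le> e * (2 * B + 2)"
proof -
  have B: "0 \<le> B" using \<phi>[of 0] by linarith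
  define bad where "bad = {w \<in> space M. W w \<notin> hoelder_set (\<beta> / 4) (hoelder_const (\<beta> / 4) * l)}"
  have [measurable]: "bad \<in> sets M"
    unfolding bad_def using borel_closed[OF closed_hoelder_set] by measurable
  have iF: "integrable M (\<lambda>w. F (W w))" by (rule integrable_const_bound[where B = "B + e"]) (use F in auto)
  have i\<phi>: "integrable M (\<lambda>w. \<phi> (W w))" by (rule integrable_const_bound[where B = B]) (use \<phi> in auto)
  have ibad: "integrable M (\<lambda>w. (2 * B + 1) * indicator bad w :: real)"
    by (intro integrable_mult_right integrable_real_indicator) (auto simp: less_top[symmetric])
  have "\<bar>expectation (\<lambda>w. F (W w)) - expectation (\<lambda>w. \<phi> (W w))\<bar> =
      \<bar>expectation (\<lambda>w. F (W w) - \<phi> (W w))\<bar>"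
    using iF i\<phi> by simp
  also have "\<dots> \<le> expectation (\<lambda>w. \<bar>F (W w) - \<phi> (W w)\<bar>)" by (rule integral_abs_bound)
  also have "\<dots> \<le> expectation (\<lambda>w. e + (2 * B + 1) * indicator bad w)"
  proof (rule integral_mono)
    show "integrable M (\<lambda>w. \<bar>F (W w) - \<phi> (W w)\<bar>)" using iF i\<phi> by simp
    show "integrable M (\<lambda>w. e + (2 * B + 1) * indicator bad w)"
      using ibad by (intro Bochner_Integration.integrable_add integrable_const)
    fix w assume w: "w \<in> space M"
    have "\<bar>F (W w) - \<phi> (W w)\<bar> \<le> 2 * B + 1" using F[of "W w"] \<phi>[of "W w"] e by linarith
    then show "\<bar>F (W w) - \<phi> (W w)\<bar> \<le> e + (2 * B + 1) * indicator bad w"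
      using close[of "W w"] w e(1) by (auto simp: bad_def split: split_indicator)
  qed
  also have "\<dots> = e + (2 * B + 1) * prob bad"
    by (subst Bochner_Integration.integral_add[OF integrable_const ibad]) (simp add: prob_space)
  also have "prob bad \<le> e" unfolding bad_def using hoelder_tail[OF l(1)] l(2) by linarith
  then have "e + (2 * B + 1) * prob bad \<le> e + (2 * B + 1) * e"
    using B by (intro add_left_mono mult_left_mono) auto
  finally show ?thesis by (simp add: algebra_simps)
qed

section \<open>Probabilities on the logarithmic scale\<close>

lemma Limsup_log_prob_le:
  assumes g: "filterlim g at_top (at_right (0::real))" and B: "0 < B"
    and P: "\<forall>\<^sub>F \<epsilon> in at_right 0. P \<epsilon> \<le> B * exp (- g \<epsilon> * b)"
  shows "Limsup (at_right 0) (\<lambda>\<epsilon>. ereal (1 / g \<epsilon>) * log_prob (P \<epsilon>)) \<le> ereal (- b)"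
proof -
  have "\<forall>\<^sub>F \<epsilon> in at_right 0. 0 < g \<epsilon>" using g by (simp add: filterlim_at_top_dense)
  with P have "\<forall>\<^sub>F \<epsilon> in at_right 0. ereal (1 / g \<epsilon>) * log_prob (P \<epsilon>) \<le> ereal (ln B / g \<epsilon> - b)"
  proof eventually_elim
    case (elim \<epsilon>)
    show ?case
    proof (cases "P \<epsilon> \<le> 0")
      case False
      then have "ln (P \<epsilon>) \<le> ln (B * exp (- g \<epsilon> * b))" using elim by (subst ln_le_cancel_iff) auto
      also have "\<dots> = ln B - g \<epsilon> * b" using B by (simp add: ln_mult)
      finally have "ln (P \<epsilon>) / g \<epsilon> \<le> (ln B - g \<epsilon> * b) / g \<epsilon>"
        using elim by (intro divide_right_mono) auto
      then show ?thesis using False elim by (simp add: log_prob_def diff_divide_distrib)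
    qed (use elim in \<open>simp add: log_prob_def\<close>)
  qed
  then have "Limsup (at_right 0) (\<lambda>\<epsilon>. ereal (1 / g \<epsilon>) * log_prob (P \<epsilon>)) \<le>
      Limsup (at_right 0) (\<lambda>\<epsilon>. ereal (ln B / g \<epsilon> - b))"
    by (rule Limsup_mono)
  also have "\<dots> = ereal (- b)"
  proof (rule lim_imp_Limsup)
    \<comment> \<open>A constant prefactor disappears at speed g, so a finite union bound costs
      nothing.\<close>
    have "((\<lambda>\<epsilon>. ln B / g \<epsilon> - b) \<longlongrightarrow> 0 - b) (at_right 0)"
      by (intro tendsto_intros tendsto_divide_0[OF tendsto_const] filterlim_at_top_imp_at_infinity g)
    then show "((\<lambda>\<epsilon>. ereal (ln B / g \<epsilon> - b)) \<longlongrightarrow> ereal (- b)) (at_right 0)" by simp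
  qed simp
  finally show ?thesis .
qed

lemma Liminf_log_prob_ge:
  assumes g: "filterlim g at_top (at_right (0::real))" and B: "0 < B"
    and P: "\<forall>\<^sub>F \<epsilon> in at_right 0. B * exp (- g \<epsilon> * b) \<le> P \<epsilon>"
  shows "ereal (- b) \<le> Liminf (at_right 0) (\<lambda>\<epsilon>. ereal (1 / g \<epsilon>) * log_prob (P \<epsilon>))"
proof -
  have "ereal (- b) = Liminf (at_right 0) (\<lambda>\<epsilon>. ereal (ln B / g \<epsilon> - b))"
  proof (rule lim_imp_Liminf[symmetric])
    have "((\<lambda>\<epsilon>. ln B / g \<epsilon> - b) \<longlongrightarrow> 0 - b) (at_right 0)"
      by (intro tendsto_intros tendsto_divide_0[OF tendsto_const] filterlim_at_top_imp_at_infinity g)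
    then show "((\<lambda>\<epsilon>. ereal (ln B / g \<epsilon> - b)) \<longlongrightarrow> ereal (- b)) (at_right 0)" by simp
  qed simp
  also have "\<dots> \<le> Liminf (at_right 0) (\<lambda>\<epsilon>. ereal (1 / g \<epsilon>) * log_prob (P \<epsilon>))"
  proof (rule Liminf_mono)
    have "\<forall>\<^sub>F \<epsilon> in at_right 0. 0 < g \<epsilon>" using g by (simp add: filterlim_at_top_dense)
    with P show "\<forall>\<^sub>F \<epsilon> in at_right 0. ereal (ln B / g \<epsilon> - b) \<le> ereal (1 / g \<epsilon>) * log_prob (P \<epsilon>)"
    proof eventually_elim
      case (elim \<epsilon>)
      have pos: "0 < P \<epsilon>" using elim B by (meson exp_gt_zero mult_pos_pos order.strict_trans2)
      have "ln B - g \<epsilon> * b = ln (B * exp (- g \<epsilon> * b))" using B by (simp add: ln_mult)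
      also have "\<dots> \<le> ln (P \<epsilon>)" using elim pos B by (subst ln_le_cancel_iff) auto
      finally have "(ln B - g \<epsilon> * b) / g \<epsilon> \<le> ln (P \<epsilon>) / g \<epsilon>"
        using elim by (intro divide_right_mono) auto
      then show ?case using pos elim by (simp add: log_prob_def diff_divide_distrib)
    qed
  qed
  finally show ?thesis .
qed

text \<open>Convergence is asked of variances only; polarization recovers covariances. The constants
  C and \<beta> are common to all members and to the limit, which makes every chaining estimate
  uniform.\<close>

locale gaussian_path_family = limit: gaussian_path N Z0 C \<beta>
  for N :: "'b measure" and Z0 :: "'b \<Rightarrow> C01" and C \<beta> :: real +
  fixes M :: "'a measure" and Z :: "real \<Rightarrow> 'a \<Rightarrow> C01" and g :: "real \<Rightarrow> real"
  assumes path: "\<epsilon> \<in> {0<..1} \<Longrightarrow> gaussian_path M (Z \<epsilon>) C \<beta>"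
    and variance_tendsto: "\<alpha> \<in> eval_span \<Longrightarrow>
      ((\<lambda>\<epsilon>. covar M (Z \<epsilon>) \<alpha> \<alpha>) \<longlongrightarrow> covar N Z0 \<alpha> \<alpha>) (at_right 0)"
    and g_at_top: "filterlim g at_top (at_right 0)"
begin

lemma tight_family_law: "tight_family {0<..1} (\<lambda>\<epsilon>. distr M borel (Z \<epsilon>))"
  unfolding tight_family_def
proof (intro allI impI)
  fix \<eta> :: real assume "0 < \<eta>"
  then obtain l where l: "1 \<le> l" "chaining_const C \<beta> * exp (- l\<^sup>2 / (4 * C)) \<le> \<eta>"
    using chaining_tail_small[OF limit.C_pos limit.\<beta>_pos] by metis
  define K where "K = hoelder_set (\<beta> / 4) (hoelder_const (\<beta> / 4) * l)"
  have "compact K"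
    unfolding K_def using limit.\<beta>_pos l hoelder_const_pos[of "\<beta> / 4"] by (intro compact_hoelder_set) auto
  moreover have "measure (distr M borel (Z \<epsilon>)) (- K) \<le> \<eta>" if "\<epsilon> \<in> {0<..1}" for \<epsilon>
  proof -
    interpret gaussian_path M "Z \<epsilon>" C \<beta> using path[OF that] .
    have "measure (distr M borel (Z \<epsilon>)) (- K) = prob {w \<in> space M. Z \<epsilon> w \<notin> K}"
      using borel_closed[OF closed_hoelder_set] unfolding K_def
      by (subst measure_distr) (auto intro!: arg_cong[where f = prob])
    then show ?thesis using hoelder_tail[OF l(1)] l(2) unfolding K_def by linarith
  qed
  ultimately show "\<exists>K. compact K \<and> (\<forall>\<epsilon>\<in>{0<..1}. measure (distr M borel (Z \<epsilon>)) (- K) \<le> \<eta>)"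
    by blast
qed

lemma expectation_trig_tendsto:
  assumes "F \<in> trig_polys"
  shows "((\<lambda>\<epsilon>. \<integral>w. F (Z \<epsilon> w) \<partial>M) \<longlongrightarrow> (\<integral>w. F (Z0 w) \<partial>N)) (at_right 0)"
proof -
  have int: "integrable M' (\<lambda>w. F (Z' w))"
    if F: "F \<in> trig_polys" and "gaussian_path M' Z' C \<beta>" for F and M' :: "'c measure" and Z'
  proof -
    interpret gaussian_path M' Z' C \<beta> by fact
    obtain B where "\<And>f. \<bar>F f\<bar> \<le> B" using trig_polys_bounded[OF F] by blast
    moreover have "F \<in> borel_measurable borel"
      using trig_polys_continuous[OF F] by (rule borel_measurable_continuous_onI)
    ultimately show ?thesis by (intro integrable_const_bound[where B = B]) auto
  qed
  note ev = eventually_in_unit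
  show ?thesis
    using assms
  proof induction
    case (cos \<alpha>)
    have "((\<lambda>\<epsilon>. exp (- covar M (Z \<epsilon>) \<alpha> \<alpha> / 2)) \<longlongrightarrow> exp (- covar N Z0 \<alpha> \<alpha> / 2)) (at_right 0)"
      by (intro tendsto_intros variance_tendsto cos) simp
    moreover have "\<forall>\<^sub>F \<epsilon> in at_right 0. exp (- covar M (Z \<epsilon>) \<alpha> \<alpha> / 2) = (\<integral>w. cos (blinfun_apply \<alpha> (Z \<epsilon> w)) \<partial>M)"
      using ev by eventually_elim (use gaussian_path.cos_integral[OF path] cos in simp)
    ultimately show ?case
      unfolding limit.cos_integral[OF cos] by (rule Lim_transform_eventually)
  next
    case (sin \<alpha>)
    have "\<forall>\<^sub>F \<epsilon> in at_right 0. 0 = (\<integral>w. sin (blinfun_apply \<alpha> (Z \<epsilon> w)) \<partial>M)"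
      using ev by eventually_elim (use gaussian_path.sin_integral[OF path] sin in simp)
    then show ?case
      unfolding limit.sin_integral[OF sin] by (rule Lim_transform_eventually[OF tendsto_const])
  next
    case (add F G)
    have "\<forall>\<^sub>F \<epsilon> in at_right 0. (\<integral>w. F (Z \<epsilon> w) \<partial>M) + (\<integral>w. G (Z \<epsilon> w) \<partial>M) = (\<integral>w. F (Z \<epsilon> w) + G (Z \<epsilon> w) \<partial>M)"
      using ev by eventually_elim (use int[OF _ path] add in simp)
    moreover have "(\<integral>w. F (Z0 w) + G (Z0 w) \<partial>N) = (\<integral>w. F (Z0 w) \<partial>N) + (\<integral>w. G (Z0 w) \<partial>N)"
      using int[OF _ limit.gaussian_path_axioms] add by simp
    ultimately show ?case
      using tendsto_add[OF add.IH] by (simp add: Lim_transform_eventually)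
  next
    case (scale F c)
    then show ?case by (simp add: tendsto_mult_left)
  qed
qed

lemma weakly_converges_law:
  "weakly_converges (\<lambda>\<epsilon>. distr M borel (Z \<epsilon>)) (distr N borel Z0) (at_right 0)"
  unfolding weakly_converges_def
proof (intro allI)
  fix \<phi> :: "C01 \<Rightarrow>\<^sub>C real"
  define B where "B = norm \<phi>"
  have \<phi>: "\<bar>apply_bcontfun \<phi> f\<bar> \<le> B" for f using norm_bounded[of \<phi> f] by (simp add: B_def)
  have B: "0 \<le> B" by (simp add: B_def)
  have [measurable]: "apply_bcontfun \<phi> \<in> borel_measurable borel"
    by (rule borel_measurable_continuous_onI) simp
  have "((\<lambda>\<epsilon>. \<integral>w. apply_bcontfun \<phi> (Z \<epsilon> w) \<partial>M) \<longlongrightarrow> (\<integral>w. apply_bcontfun \<phi> (Z0 w) \<partial>N)) (at_right 0)"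
  proof (rule tendstoI)
    fix d :: real assume "0 < d"
    \<comment> \<open>Each of the two approximation errors becomes at most d / 4, leaving d / 2 for
      the convergence of the trigonometric polynomial.\<close>
    define e where "e = min 1 (d / (4 * (2 * B + 2)))"
    have e: "0 < e" "e \<le> 1" using \<open>0 < d\<close> B by (auto simp: e_def)
    have ed: "e * (2 * B + 2) \<le> d / 4"
    proof -
      have "e * (2 * B + 2) \<le> d / (4 * (2 * B + 2)) * (2 * B + 2)"
        using B by (intro mult_right_mono) (auto simp: e_def)
      also have "\<dots> = d / 4" using B by (simp add: field_simps)
      finally show ?thesis .
    qed
    obtain l where l: "1 \<le> l" "chaining_const C \<beta> * exp (- l\<^sup>2 / (4 * C)) \<le> e"
      using chaining_tail_small[OF limit.C_pos limit.\<beta>_pos e(1)] by metis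
    define K where "K = hoelder_set (\<beta> / 4) (hoelder_const (\<beta> / 4) * l)"
    have "compact K"
      unfolding K_def using limit.\<beta>_pos l hoelder_const_pos[of "\<beta> / 4"] by (intro compact_hoelder_set) auto
    then obtain F where F: "F \<in> trig_polys" "\<And>f. f \<in> K \<Longrightarrow> \<bar>F f - apply_bcontfun \<phi> f\<bar> \<le> e"
      "\<And>f. \<bar>F f\<bar> \<le> B + e"
      using trig_polys_approx[of K "apply_bcontfun \<phi>" B e] \<phi> e(1) by auto
    have [measurable]: "F \<in> borel_measurable borel"
      using trig_polys_continuous[OF F(1)] by (rule borel_measurable_continuous_onI)
    have 0: "\<bar>(\<integral>w. F (Z0 w) \<partial>N) - (\<integral>w. apply_bcontfun \<phi> (Z0 w) \<partial>N)\<bar> \<le> d / 4"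
      by (rule order_trans[OF limit.expectation_trig_approx[OF l] ed])
        (use e F \<phi> in \<open>auto simp: K_def\<close>)
    have "\<forall>\<^sub>F \<epsilon> in at_right 0. dist (\<integral>w. F (Z \<epsilon> w) \<partial>M) (\<integral>w. F (Z0 w) \<partial>N) < d / 2"
      using expectation_trig_tendsto[OF F(1)] \<open>0 < d\<close> by (intro tendstoD) auto
    with eventually_in_unit
    show "\<forall>\<^sub>F \<epsilon> in at_right 0.
        dist (\<integral>w. apply_bcontfun \<phi> (Z \<epsilon> w) \<partial>M) (\<integral>w. apply_bcontfun \<phi> (Z0 w) \<partial>N) < d"
    proof eventually_elim
      case (elim \<epsilon>)
      interpret gaussian_path M "Z \<epsilon>" C \<beta> using path[OF elim(1)] .
      have "\<bar>(\<integral>w. F (Z \<epsilon> w) \<partial>M) - (\<integral>w. apply_bcontfun \<phi> (Z \<epsilon> w) \<partial>M)\<bar> \<le> d / 4"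
        by (rule order_trans[OF expectation_trig_approx[OF l] ed])
          (use e F \<phi> in \<open>auto simp: K_def\<close>)
      then show ?case using elim(2) 0 unfolding dist_real_def by linarith
    qed
  qed
  then have "((\<lambda>\<epsilon>. \<integral>f. apply_bcontfun \<phi> f \<partial>distr M borel (Z \<epsilon>)) \<longlongrightarrow> (\<integral>w. apply_bcontfun \<phi> (Z0 w) \<partial>N)) (at_right 0)"
  proof (rule Lim_transform_eventually)
    show "\<forall>\<^sub>F \<epsilon> in at_right 0. (\<integral>w. apply_bcontfun \<phi> (Z \<epsilon> w) \<partial>M) = (\<integral>f. apply_bcontfun \<phi> f \<partial>distr M borel (Z \<epsilon>))"
      using eventually_in_unit
    proof eventually_elim
      case (elim \<epsilon>)
      interpret gaussian_path M "Z \<epsilon>" C \<beta> using path[OF elim] .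
      show ?case by (subst integral_distr) auto
    qed
  qed
  then show "((\<lambda>\<epsilon>. \<integral>f. apply_bcontfun \<phi> f \<partial>distr M borel (Z \<epsilon>)) \<longlongrightarrow>
      (\<integral>f. apply_bcontfun \<phi> f \<partial>distr N borel Z0)) (at_right 0)"
    by (subst integral_distr[OF limit.measurable_Z]) auto
qed

end

section \<open>Large deviations\<close>

context gaussian_path_family
begin

lemma covar_tendsto:
  assumes "\<alpha> \<in> eval_span" "\<gamma> \<in> eval_span"
  shows "((\<lambda>\<epsilon>. covar M (Z \<epsilon>) \<alpha> \<gamma>) \<longlongrightarrow> covar N Z0 \<alpha> \<gamma>) (at_right 0)"
proof -
  have polar: "(covar M' Z' (\<alpha> + \<gamma>) (\<alpha> + \<gamma>) - covar M' Z' (\<alpha> - \<gamma>) (\<alpha> - \<gamma>)) / 4 = covar M' Z' \<alpha> \<gamma>"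
    if "gaussian_path M' Z' C \<beta>" for M' :: "'c measure" and Z'
  proof -
    interpret gaussian_path M' Z' C \<beta> by fact
    show ?thesis by (simp add: covar_simps covar_commute[of \<gamma> \<alpha>])
  qed
  have "((\<lambda>\<epsilon>. (covar M (Z \<epsilon>) (\<alpha> + \<gamma>) (\<alpha> + \<gamma>) - covar M (Z \<epsilon>) (\<alpha> - \<gamma>) (\<alpha> - \<gamma>)) / 4)
      \<longlongrightarrow> (covar N Z0 (\<alpha> + \<gamma>) (\<alpha> + \<gamma>) - covar N Z0 (\<alpha> - \<gamma>) (\<alpha> - \<gamma>)) / 4) (at_right 0)"
    using assms by (intro tendsto_intros variance_tendsto) auto
  moreover have "\<forall>\<^sub>F \<epsilon> in at_right 0.
      (covar M (Z \<epsilon>) (\<alpha> + \<gamma>) (\<alpha> + \<gamma>) - covar M (Z \<epsilon>) (\<alpha> - \<gamma>) (\<alpha> - \<gamma>)) / 4 = covar M (Z \<epsilon>) \<alpha> \<gamma>"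
    using eventually_in_unit by eventually_elim (rule polar[OF path])
  ultimately show ?thesis
    unfolding polar[OF limit.gaussian_path_axioms] by (rule Lim_transform_eventually)
qed

text \<open>Covariances converge at the finitely many points of a net, and the represented paths
  share a modulus of continuity; together this gives convergence in the supremum norm.\<close>

lemma represent_tendsto:
  assumes \<alpha>: "\<alpha> \<in> eval_span"
  shows "((\<lambda>\<epsilon>. represent M (Z \<epsilon>) \<alpha>) \<longlongrightarrow> represent N Z0 \<alpha>) (at_right 0)"
proof (rule tendstoI)
  fix r :: real assume "0 < r"
  define c where "c = covar N Z0 \<alpha> \<alpha> + 1"
  have c: "0 < c" using limit.covar_nonneg[of \<alpha>] by (simp add: c_def)
  \<comment> \<open>The mesh at which \<open>represent_incr\<close> with variance at most
    \<open>c\<close> yields r / 4. Two such errors and one at a net point give 3 r / 4.\<close>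
  define \<delta> where "\<delta> = ((r / 4)\<^sup>2 / (c * C)) powr (1 / \<beta>)"
  have \<delta>: "0 < \<delta>" using \<open>0 < r\<close> c limit.C_pos by (simp add: \<delta>_def)
  have \<delta>': "c * (C * \<delta> powr \<beta>) = (r / 4)\<^sup>2"
    using \<open>0 < r\<close> c limit.C_pos limit.\<beta>_pos by (simp add: \<delta>_def powr_powr)
  obtain U :: "unit_interval set" where U: "finite U" "UNIV \<subseteq> (\<Union>u\<in>U. ball u \<delta>)"
    using compact_UNIV_metric[where 'a=unit_interval] \<delta> unfolding compact_eq_totally_bounded by blast
  have incr: "\<bar>apply_bcontfun (represent M' Z' \<alpha>) t - apply_bcontfun (represent M' Z' \<alpha>) s\<bar> \<le> r / 4"
    if "gaussian_path M' Z' C \<beta>" "covar M' Z' \<alpha> \<alpha> \<le> c" "dist s t \<le> \<delta>"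
    for M' :: "'c measure" and Z' s t
  proof -
    interpret gaussian_path M' Z' C \<beta> by fact
    have "(apply_bcontfun (represent M' Z' \<alpha>) t - apply_bcontfun (represent M' Z' \<alpha>) s)\<^sup>2 \<le>
        covar M' Z' \<alpha> \<alpha> * (C * dist s t powr \<beta>)"
      by (rule represent_incr)
    also have "\<dots> \<le> c * (C * \<delta> powr \<beta>)"
      using that(2,3) c C_pos \<beta>_pos by (intro mult_mono powr_mono2) auto
    finally show ?thesis
      unfolding \<delta>' using \<open>0 < r\<close> by (subst (asm) power2_le_iff_abs_le) auto
  qed
  have "\<forall>\<^sub>F \<epsilon> in at_right 0. covar M (Z \<epsilon>) \<alpha> \<alpha> < c"
    using variance_tendsto[OF \<alpha>] by (rule order_tendstoD) (simp add: c_def)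
  moreover have "\<forall>\<^sub>F \<epsilon> in at_right 0. \<forall>u\<in>U. dist (covar M (Z \<epsilon>) \<alpha> (evaluation u)) (covar N Z0 \<alpha> (evaluation u)) < r / 4"
    using \<open>0 < r\<close> \<alpha> by (intro eventually_ball_finite[OF U(1)] ballI tendstoD covar_tendsto) auto
  ultimately show "\<forall>\<^sub>F \<epsilon> in at_right 0. dist (represent M (Z \<epsilon>) \<alpha>) (represent N Z0 \<alpha>) < r"
    using eventually_in_unit
  proof eventually_elim
    case (elim \<epsilon>)
    note gp = path[OF elim(3)]
    interpret gaussian_path M "Z \<epsilon>" C \<beta> by (rule gp)
    have "dist (represent M (Z \<epsilon>) \<alpha>) (represent N Z0 \<alpha>) \<le> 3 * (r / 4)"
    proof (rule dist_bound)
      fix t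
      obtain u where u: "u \<in> U" "dist u t \<le> \<delta>" using subsetD[OF U(2), of t] by (auto simp: less_imp_le)
      have "\<bar>apply_bcontfun (represent M (Z \<epsilon>) \<alpha>) t - apply_bcontfun (represent M (Z \<epsilon>) \<alpha>) u\<bar> \<le> r / 4"
        using elim(1) u(2) by (intro incr[OF gp]) auto
      moreover have "\<bar>apply_bcontfun (represent N Z0 \<alpha>) t - apply_bcontfun (represent N Z0 \<alpha>) u\<bar> \<le> r / 4"
        using u(2) by (intro incr[OF limit.gaussian_path_axioms]) (auto simp: c_def)
      moreover have "\<bar>apply_bcontfun (represent M (Z \<epsilon>) \<alpha>) u - apply_bcontfun (represent N Z0 \<alpha>) u\<bar> < r / 4"
        using elim(2) u(1) by (simp add: represent_eval limit.represent_eval dist_real_def)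
      ultimately show "dist (apply_bcontfun (represent M (Z \<epsilon>) \<alpha>) t) (apply_bcontfun (represent N Z0 \<alpha>) t) \<le> 3 * (r / 4)"
        unfolding dist_real_def by linarith
    qed
    then show ?case using \<open>0 < r\<close> by simp
  qed
qed

section \<open>Exponential bounds for the path divided by \<open>sqrt (g \<epsilon>)\<close>\<close>

definition scaled_prob :: "real \<Rightarrow> C01 set \<Rightarrow> real" where
  "scaled_prob \<epsilon> A = measure M {w \<in> space M. (1 / sqrt (g \<epsilon>)) *\<^sub>R Z \<epsilon> w \<in> A}"

lemma eventually_g_ge: "\<forall>\<^sub>F \<epsilon> in at_right 0. c \<le> g \<epsilon>"
  using g_at_top by (simp add: filterlim_at_top)

text \<open>Chernoff's bound with the functional s \<alpha>, s^2 = g: the event becomes s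
  \<alpha>(Z) > g c, and the moment generating function contributes g times half the
  variance.\<close>

lemma scaled_prob_half_space:
  assumes \<alpha>: "\<alpha> \<in> eval_span" and \<epsilon>: "\<epsilon> \<in> {0<..1}" and g: "0 < g \<epsilon>"
  shows "scaled_prob \<epsilon> {y. c < blinfun_apply \<alpha> y} \<le> exp (- g \<epsilon> * (c - covar M (Z \<epsilon>) \<alpha> \<alpha> / 2))"
proof -
  interpret gaussian_path M "Z \<epsilon>" C \<beta> using path[OF \<epsilon>] .
  define s where "s = sqrt (g \<epsilon>)"
  have s: "0 < s" "g \<epsilon> = s\<^sup>2" using g by (auto simp: s_def)
  have "emeasure M {w \<in> space M. (1 / s) *\<^sub>R Z \<epsilon> w \<in> {y. c < blinfun_apply \<alpha> y}} \<le>
      emeasure M {w \<in> space M. 1 \<le> ennreal (exp (- g \<epsilon> * c)) * ennreal (exp (blinfun_apply (s *\<^sub>R \<alpha>) (Z \<epsilon> w)))}"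
  proof (rule emeasure_mono)
    have "1 \<le> ennreal (exp (- g \<epsilon> * c)) * ennreal (exp (blinfun_apply (s *\<^sub>R \<alpha>) f))"
      if f: "c < blinfun_apply \<alpha> ((1 / s) *\<^sub>R f)" for f
    proof -
      have "s * c < blinfun_apply \<alpha> f" using f s(1) by (simp add: blinfun.scaleR_right field_simps)
      then have "s * (s * c) \<le> s * blinfun_apply \<alpha> f" using s(1) by simp
      then show ?thesis
        by (simp add: s(2) power2_eq_square ennreal_mult[symmetric] exp_add[symmetric]
            blinfun.scaleR_left mult.assoc)
    qed
    then show "{w \<in> space M. (1 / s) *\<^sub>R Z \<epsilon> w \<in> {y. c < blinfun_apply \<alpha> y}} \<subseteq>
      {w \<in> space M. 1 \<le> ennreal (exp (- g \<epsilon> * c)) * ennreal (exp (blinfun_apply (s *\<^sub>R \<alpha>) (Z \<epsilon> w)))}"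
      by blast
  qed measurable
  also have "\<dots> \<le> ennreal (exp (- g \<epsilon> * c)) * (\<integral>\<^sup>+w. ennreal (exp (blinfun_apply (s *\<^sub>R \<alpha>) (Z \<epsilon> w))) \<partial>M)"
    using nn_integral_Markov_inequality[of "\<lambda>w. ennreal (exp (blinfun_apply (s *\<^sub>R \<alpha>) (Z \<epsilon> w)))"
        "space M" M "ennreal (exp (- g \<epsilon> * c))"]
    by (simp cong: nn_integral_cong)
  also have "\<dots> = ennreal (exp (- g \<epsilon> * (c - covar M (Z \<epsilon>) \<alpha> \<alpha> / 2)))"
    using \<alpha> by (subst mgf)
      (auto simp: ennreal_mult[symmetric] exp_add[symmetric] covar_simps s(2) power2_eq_square algebra_simps)
  finally show ?thesis
    unfolding scaled_prob_def s_def by (simp add: emeasure_eq_measure)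
qed

lemma measurable_scaled [measurable]:
  assumes "\<epsilon> \<in> {0<..1}"
  shows "(\<lambda>w. c *\<^sub>R Z \<epsilon> w) \<in> borel_measurable M"
  using gaussian_path.measurable_Z[OF path[OF assms]] by measurable

text \<open>The cover is built at level a' from the limiting variances, while the Chernoff bound
  uses those at \<epsilon>; the gap a < a' absorbs the difference.\<close>

lemma closed_upper_bound:
  assumes F: "closed F" and a: "0 \<le> a" "a < a'"
    and rate: "\<And>x. x \<in> F \<Longrightarrow> \<not> rkhs_rate N Z0 x \<le> ennreal a'"
  shows "Limsup (at_right 0) (\<lambda>\<epsilon>. ereal (1 / g \<epsilon>) * log_prob (scaled_prob \<epsilon> F)) \<le> ereal (- a)"
proof -
  \<comment> \<open>Makes l^2 / (4 C) at least a, so leaving the compact set \<open>K\<close> is as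
    unlikely as the bound to be proved.\<close>
  define l where "l = max 1 (4 * C * a)"
  have l: "1 \<le> l" "4 * C * a \<le> l" by (auto simp: l_def)
  have "l \<le> l\<^sup>2" using l(1) by (simp add: power2_eq_square)
  then have la: "a \<le> l\<^sup>2 / (4 * C)" using l(2) limit.C_pos by (simp add: pos_le_divide_eq mult.commute)
  define K where "K = hoelder_set (\<beta> / 4) (hoelder_const (\<beta> / 4) * l)"
  have K: "compact K"
    unfolding K_def using limit.\<beta>_pos l hoelder_const_pos[of "\<beta> / 4"] by (intro compact_hoelder_set) auto
  define A where "A = chaining_const C \<beta>"
  have A: "0 < A" unfolding A_def using limit.C_pos limit.\<beta>_pos by (rule chaining_const_pos)
  define U where "U \<alpha> = {y. a' + covar N Z0 \<alpha> \<alpha> / 2 < blinfun_apply \<alpha> y}" for \<alpha> :: "C01 \<Rightarrow>\<^sub>L real"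
  have oU: "open (U \<alpha>)" for \<alpha> unfolding U_def by (intro open_Collect_less continuous_intros)
  have "\<exists>\<alpha>\<in>eval_span. x \<in> U \<alpha>" if "x \<in> F" for x
    using rate[OF that] limit.rkhs_rate_le_iff[of a' x] a
    by (auto simp: U_def legendre_def not_le algebra_simps)
  then have cover: "F \<inter> K \<subseteq> (\<Union>\<alpha>\<in>eval_span. U \<alpha>)" by blast
  obtain D where D: "D \<subseteq> eval_span" "finite D" "F \<inter> K \<subseteq> (\<Union>\<alpha>\<in>D. U \<alpha>)"
    by (rule compactE_image[OF _ _ cover]) (use K F oU in \<open>auto intro: closed_Int_compact\<close>)
  \<comment> \<open>Variances enter the exponent with a factor 1/2, hence the tolerance 2 (a' -
    a).\<close>
  have "\<forall>\<^sub>F \<epsilon> in at_right 0. \<forall>\<alpha>\<in>D. covar M (Z \<epsilon>) \<alpha> \<alpha> < covar N Z0 \<alpha> \<alpha> + 2 * (a' - a)"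
    using D(1) a(2)
    by (intro eventually_ball_finite[OF D(2)] ballI order_tendstoD(2)[OF variance_tendsto]) auto
  then have "\<forall>\<^sub>F \<epsilon> in at_right 0. scaled_prob \<epsilon> F \<le> (A + real (card D)) * exp (- g \<epsilon> * a)"
    using eventually_in_unit eventually_g_ge[of 1]
  proof eventually_elim
    case (elim \<epsilon>)
    interpret gaussian_path M "Z \<epsilon>" C \<beta> using path[OF elim(2)] .
    define s where "s = sqrt (g \<epsilon>)"
    have s: "1 \<le> s" "g \<epsilon> = s\<^sup>2" using elim(3) by (auto simp: s_def)
    define E where "E B = {w \<in> space M. (1 / s) *\<^sub>R Z \<epsilon> w \<in> B}" for B
    have E[measurable]: "E B \<in> sets M" if "B \<in> sets borel" for B
      unfolding E_def using that by measurable
    have sets: "U \<alpha> \<in> sets borel" "K \<in> sets borel" "F \<in> sets borel" for \<alpha>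
      using oU F K by (auto intro: borel_open borel_closed compact_imp_closed)
    have "E F \<subseteq> E (- K) \<union> (\<Union>\<alpha>\<in>D. E (U \<alpha>))" using D(3) by (auto simp: E_def)
    then have "prob (E F) \<le> prob (E (- K) \<union> (\<Union>\<alpha>\<in>D. E (U \<alpha>)))"
      using sets D(2) by (intro finite_measure_mono sets.Un sets.finite_UN E) auto
    also have "\<dots> \<le> prob (E (- K)) + prob (\<Union>\<alpha>\<in>D. E (U \<alpha>))"
      using sets D(2) by (intro measure_Un_le sets.finite_UN E) auto
    also have "prob (\<Union>\<alpha>\<in>D. E (U \<alpha>)) \<le> (\<Sum>\<alpha>\<in>D. prob (E (U \<alpha>)))"
      using sets D(2) E by (intro finite_measure_subadditive_finite) auto
    also have "\<dots> \<le> (\<Sum>\<alpha>\<in>D. exp (- g \<epsilon> * a))"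
    proof (rule sum_mono)
      fix \<alpha> assume \<alpha>: "\<alpha> \<in> D"
      have "prob (E (U \<alpha>)) \<le> exp (- g \<epsilon> * (a' + covar N Z0 \<alpha> \<alpha> / 2 - covar M (Z \<epsilon>) \<alpha> \<alpha> / 2))"
        using scaled_prob_half_space[of \<alpha> \<epsilon> "a' + covar N Z0 \<alpha> \<alpha> / 2"] \<alpha> D(1) elim(2,3)
        unfolding E_def U_def scaled_prob_def s_def by auto
      also have "\<dots> \<le> exp (- g \<epsilon> * a)"
      proof -
        have "a \<le> a' + covar N Z0 \<alpha> \<alpha> / 2 - covar M (Z \<epsilon>) \<alpha> \<alpha> / 2"
          using elim(1) \<alpha> by fastforce
        then have "g \<epsilon> * a \<le> g \<epsilon> * (a' + covar N Z0 \<alpha> \<alpha> / 2 - covar M (Z \<epsilon>) \<alpha> \<alpha> / 2)"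
          using elim(3) by (intro mult_left_mono) auto
        then show ?thesis by simp
      qed
      finally show "prob (E (U \<alpha>)) \<le> exp (- g \<epsilon> * a)" .
    qed
    also have "\<dots> = real (card D) * exp (- g \<epsilon> * a)" by simp
    also have "prob (E (- K)) \<le> A * exp (- g \<epsilon> * a)"
    proof -
      \<comment> \<open>Homogeneity of the Hoelder sets: the divided path leaves radius l exactly
        when the undivided one leaves radius s l.\<close>
      have "E (- K) = {w \<in> space M. Z \<epsilon> w \<notin> hoelder_set (\<beta> / 4) (hoelder_const (\<beta> / 4) * (s * l))}"
        using scaleR_hoelder_set[of s "(1 / s) *\<^sub>R f" "\<beta> / 4" "hoelder_const (\<beta> / 4) * l" for f] s(1)
        by (auto simp: E_def K_def mult.left_commute)
      then have "prob (E (- K)) \<le> A * exp (- (s * l)\<^sup>2 / (4 * C))"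
        unfolding A_def using hoelder_tail[of "s * l"] s(1) l(1) mult_mono[of 1 s 1 l] by simp
      also have "- (s * l)\<^sup>2 / (4 * C) = - (g \<epsilon> * (l\<^sup>2 / (4 * C)))"
        by (simp add: s(2) power_mult_distrib)
      also have "exp \<dots> \<le> exp (- g \<epsilon> * a)"
        using mult_left_mono[OF la, of "g \<epsilon>"] elim(3) by simp
      finally show ?thesis using A by simp
    qed
    finally have "prob (E F) \<le> A * exp (- g \<epsilon> * a) + real (card D) * exp (- g \<epsilon> * a)" by simp
    then show ?case by (simp add: scaled_prob_def E_def s_def distrib_right)
  qed
  then show ?thesis
    using A by (intro Limsup_log_prob_le[OF g_at_top, of "A + real (card D)"]) auto
qed

text \<open>Under the tilt the deviation from the shifted center stays bounded with probability at
  least 1/2, and division by s makes it small. Near the center the tilting density is at most exp(g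
  (v/2 + \<eta>)), which converts this 1/2 into a lower bound for the original probability.\<close>

lemma scaled_prob_lower:
  assumes \<alpha>: "\<alpha> \<in> eval_span" and G: "open G" "represent N Z0 \<alpha> \<in> G" and \<eta>: "0 < \<eta>"
  shows "\<forall>\<^sub>F \<epsilon> in at_right 0. (1/2) * exp (- g \<epsilon> * (covar N Z0 \<alpha> \<alpha> / 2 + \<eta>)) \<le> scaled_prob \<epsilon> G"
proof -
  define h where "h = represent N Z0 \<alpha>"
  define v where "v = covar N Z0 \<alpha> \<alpha>"
  obtain \<rho>0 where \<rho>0: "0 < \<rho>0" "ball h \<rho>0 \<subseteq> G" using G open_contains_ball unfolding h_def by blast
  \<comment> \<open>On a ball of this radius \<alpha> varies by at most \<eta> / 2; the + 1 covers a
    zero functional.\<close>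
  define \<rho> where "\<rho> = min \<rho>0 (\<eta> / (2 * (norm \<alpha> + 1)))"
  have n\<alpha>: "0 < 2 * (norm \<alpha> + 1)" by (simp add: add_nonneg_pos)
  have \<rho>: "0 < \<rho>" "ball h \<rho> \<subseteq> G" "norm \<alpha> * \<rho> \<le> \<eta> / 2"
  proof -
    show "0 < \<rho>" using \<rho>0(1) \<eta> n\<alpha> by (simp add: \<rho>_def)
    show "ball h \<rho> \<subseteq> G" using \<rho>0(2) by (auto simp: \<rho>_def)
    have "norm \<alpha> * \<rho> \<le> (norm \<alpha> + 1) * (\<eta> / (2 * (norm \<alpha> + 1)))"
      using \<eta> n\<alpha> \<open>0 < \<rho>\<close> by (intro mult_mono) (auto simp: \<rho>_def)
    also have "\<dots> = \<eta> / 2" using n\<alpha> by (simp add: field_simps)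
    finally show "norm \<alpha> * \<rho> \<le> \<eta> / 2" .
  qed
  obtain l where l: "1 \<le> l" "chaining_const C \<beta> * exp (- l\<^sup>2 / (4 * C)) \<le> 1/2"
    using chaining_tail_small[OF limit.C_pos limit.\<beta>_pos, of "1/2"] by auto
  define L where "L = hoelder_const (\<beta> / 4) * l"
  have L: "0 < L" unfolding L_def using l limit.\<beta>_pos by (intro mult_pos_pos hoelder_const_pos) auto
  have "\<forall>\<^sub>F \<epsilon> in at_right 0. dist (represent M (Z \<epsilon>) \<alpha>) h < \<rho> / 2"
    unfolding h_def using \<rho>(1) by (intro tendstoD represent_tendsto \<alpha>) simp
  moreover have "\<forall>\<^sub>F \<epsilon> in at_right 0. dist (covar M (Z \<epsilon>) \<alpha> \<alpha>) v < \<eta>"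
    unfolding v_def using \<eta> by (intro tendstoD variance_tendsto \<alpha>)
  \<comment> \<open>This size of g gives L / s < \<rho> / 2, the share of the radius left after the
    center has moved by less than \<rho> / 2.\<close>
  moreover note eventually_in_unit eventually_g_ge[of "max 1 ((2 * L / \<rho>)\<^sup>2 + 1)"]
  ultimately show ?thesis
  proof eventually_elim
    case (elim \<epsilon>)
    interpret gaussian_path M "Z \<epsilon>" C \<beta> using path[OF elim(3)] .
    define s where "s = sqrt (g \<epsilon>)"
    have "1 \<le> g \<epsilon>" using elim(4) max.cobounded1 order_trans by blast
    then have s: "1 \<le> s" "g \<epsilon> = s\<^sup>2" by (auto simp: s_def)
    have sL: "L / s < \<rho> / 2"
    proof -
      have "(2 * L / \<rho>)\<^sup>2 < s\<^sup>2" using elim(4) s(2) by simp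
      then have "2 * L / \<rho> < s" using s(1) by (intro power2_less_imp_less[of _ s]) auto
      then show ?thesis using \<rho>(1) s(1) by (simp add: field_simps)
    qed
    define q where "q = covar M (Z \<epsilon>) \<alpha> \<alpha>"
    define E where "E = {w \<in> space M. (1 / s) *\<^sub>R Z \<epsilon> w \<in> ball h \<rho>}"
    have [measurable]: "E \<in> sets M" unfolding E_def using borel_open[OF open_ball[of h \<rho>]] by measurable
    define T where "T = tilted M (Z \<epsilon>) (s *\<^sub>R \<alpha>)"
    have sT: "sets T = sets M" "space T = space M" by (simp_all add: T_def tilted_def)
    interpret T: subgaussian_path T "\<lambda>w. Z \<epsilon> w - represent M (Z \<epsilon>) (s *\<^sub>R \<alpha>)" C \<beta>
      unfolding T_def using \<alpha> by (intro subgaussian_path_tilted) auto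
    have rep: "represent M (Z \<epsilon>) (s *\<^sub>R \<alpha>) = s *\<^sub>R represent M (Z \<epsilon>) \<alpha>"
      by (rule bcontfun_eqI) (simp add: represent_eval covar_simps)
    define bad where "bad = {w \<in> space T. Z \<epsilon> w - represent M (Z \<epsilon>) (s *\<^sub>R \<alpha>) \<notin> hoelder_set (\<beta> / 4) L}"
    have [measurable]: "bad \<in> sets T"
      unfolding bad_def using borel_closed[OF closed_hoelder_set] by measurable
    \<comment> \<open>Off \<open>bad\<close> the centered path has norm at most L; after division by
      s it is within \<rho> / 2 of its own center, which lies within \<rho> / 2 of h.\<close>
    have "space T - bad \<subseteq> E"
    proof
      fix w assume w: "w \<in> space T - bad"
      then have "norm (Z \<epsilon> w - s *\<^sub>R represent M (Z \<epsilon>) \<alpha>) \<le> L"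
        using hoelder_set_norm_le[of _ "\<beta> / 4" L] L \<beta>_pos by (auto simp: bad_def rep)
      then have "norm ((1 / s) *\<^sub>R (Z \<epsilon> w - s *\<^sub>R represent M (Z \<epsilon>) \<alpha>)) \<le> L / s"
        using s(1) by (simp add: divide_right_mono)
      moreover have "(1 / s) *\<^sub>R (Z \<epsilon> w - s *\<^sub>R represent M (Z \<epsilon>) \<alpha>) =
          (1 / s) *\<^sub>R Z \<epsilon> w - represent M (Z \<epsilon>) \<alpha>"
        using s(1) by (simp add: scaleR_diff_right)
      ultimately have "dist ((1 / s) *\<^sub>R Z \<epsilon> w) (represent M (Z \<epsilon>) \<alpha>) < \<rho> / 2"
        using sL unfolding dist_norm by (metis order.strict_trans1)
      then have "dist h ((1 / s) *\<^sub>R Z \<epsilon> w) < \<rho>"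
        using elim(1) dist_triangle[of h "(1 / s) *\<^sub>R Z \<epsilon> w" "represent M (Z \<epsilon>) \<alpha>"]
        by (simp add: dist_commute)
      then show "w \<in> E" using w sT by (simp add: E_def)
    qed
    moreover have "T.prob bad \<le> 1/2"
      using T.hoelder_tail[OF l(1)] l(2) unfolding bad_def L_def by linarith
    then have "1/2 \<le> T.prob (space T - bad)" by (subst T.prob_compl) auto
    ultimately have "1/2 \<le> T.prob E"
      using T.finite_measure_mono[of "space T - bad" E] sT by auto
    then have "ennreal (1/2) \<le> emeasure T E" unfolding T.emeasure_eq_measure by (rule ennreal_leI)
    also have "\<dots> = (\<integral>\<^sup>+w. ennreal (exp (blinfun_apply (s *\<^sub>R \<alpha>) (Z \<epsilon> w) -
        covar M (Z \<epsilon>) (s *\<^sub>R \<alpha>) (s *\<^sub>R \<alpha>) / 2)) * indicator E w \<partial>M)"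
      unfolding T_def tilted_def by (rule emeasure_density) measurable
    also have "\<dots> \<le> (\<integral>\<^sup>+w. ennreal (exp (g \<epsilon> * (v / 2 + \<eta>))) * indicator E w \<partial>M)"
    proof (rule nn_integral_mono)
      fix w assume "w \<in> space M"
      have "blinfun_apply (s *\<^sub>R \<alpha>) (Z \<epsilon> w) - covar M (Z \<epsilon>) (s *\<^sub>R \<alpha>) (s *\<^sub>R \<alpha>) / 2 \<le> g \<epsilon> * (v / 2 + \<eta>)"
        if "w \<in> E"
      proof -
        define y where "y = (1 / s) *\<^sub>R Z \<epsilon> w"
        have y: "dist h y < \<rho>" "Z \<epsilon> w = s *\<^sub>R y" using that s(1) by (auto simp: E_def y_def)
        have "blinfun_apply \<alpha> y - v = blinfun_apply \<alpha> (y - h)"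
          by (simp add: blinfun.diff_right h_def v_def limit.blinfun_apply_represent)
        also have "\<dots> \<le> norm \<alpha> * norm (y - h)" using norm_blinfun[of \<alpha> "y - h"] by simp
        also have "\<dots> \<le> norm \<alpha> * \<rho>"
          using y(1) by (intro mult_left_mono) (auto simp: dist_norm norm_minus_commute)
        also have "\<dots> \<le> \<eta> / 2" by (rule \<rho>(3))
        \<comment> \<open>By the reproducing property \<alpha>(h) = v, so \<alpha>(y) \<le> v +
          \<eta>/2, while q > v - \<eta>.\<close>
        finally have "blinfun_apply \<alpha> y - q / 2 \<le> v / 2 + \<eta>"
          using elim(2) unfolding q_def dist_real_def by linarith
        then have "g \<epsilon> * (blinfun_apply \<alpha> y - q / 2) \<le> g \<epsilon> * (v / 2 + \<eta>)"
          using s by (intro mult_left_mono) auto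
        moreover have "blinfun_apply (s *\<^sub>R \<alpha>) (Z \<epsilon> w) - covar M (Z \<epsilon>) (s *\<^sub>R \<alpha>) (s *\<^sub>R \<alpha>) / 2 =
            g \<epsilon> * (blinfun_apply \<alpha> y - q / 2)"
          unfolding y(2) by (simp add: s(2) q_def covar_simps blinfun.scaleR_left blinfun.scaleR_right
              power2_eq_square algebra_simps)
        ultimately show ?thesis by simp
      qed
      then show "ennreal (exp (blinfun_apply (s *\<^sub>R \<alpha>) (Z \<epsilon> w) - covar M (Z \<epsilon>) (s *\<^sub>R \<alpha>) (s *\<^sub>R \<alpha>) / 2)) * indicator E w
          \<le> ennreal (exp (g \<epsilon> * (v / 2 + \<eta>))) * indicator E w"
        by (auto split: split_indicator intro!: ennreal_leI)
    qed
    also have "\<dots> = ennreal (exp (g \<epsilon> * (v / 2 + \<eta>)) * prob E)"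
      by (simp add: nn_integral_cmult emeasure_eq_measure ennreal_mult)
    finally have "1/2 \<le> exp (g \<epsilon> * (v / 2 + \<eta>)) * prob E"
      by (subst (asm) ennreal_le_iff) auto
    then have "1/2 * exp (- (g \<epsilon> * (v / 2 + \<eta>)))
        \<le> exp (g \<epsilon> * (v / 2 + \<eta>)) * prob E * exp (- (g \<epsilon> * (v / 2 + \<eta>)))"
      by (rule mult_right_mono) simp
    also have "\<dots> = prob E" by (simp add: exp_minus)
    also have "prob E \<le> scaled_prob \<epsilon> G"
      unfolding scaled_prob_def
    proof (rule finite_measure_mono)
      show "E \<subseteq> {w \<in> space M. (1 / sqrt (g \<epsilon>)) *\<^sub>R Z \<epsilon> w \<in> G}"
        using \<rho>(2) by (auto simp: E_def s_def)
      show "{w \<in> space M. (1 / sqrt (g \<epsilon>)) *\<^sub>R Z \<epsilon> w \<in> G} \<in> events"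
        using borel_open[OF G(1)] by measurable
    qed
    finally show ?case by (simp add: v_def)
  qed
qed

theorem satisfies_LDP_scaled:
  assumes law: "\<And>\<epsilon>. \<epsilon> \<in> {0<..1} \<Longrightarrow> \<nu> \<epsilon> = distr M borel (\<lambda>w. (1 / sqrt (g \<epsilon>)) *\<^sub>R Z \<epsilon> w)"
  shows "satisfies_LDP \<nu> g (rkhs_rate N Z0)"
proof -
  have eq: "\<forall>\<^sub>F \<epsilon> in at_right 0. ereal (1 / g \<epsilon>) * log_prob (measure (\<nu> \<epsilon>) A) =
      ereal (1 / g \<epsilon>) * log_prob (scaled_prob \<epsilon> A)" if "A \<in> sets borel" for A
    using eventually_in_unit
  proof eventually_elim
    case (elim \<epsilon>)
    have "measure (\<nu> \<epsilon>) A = scaled_prob \<epsilon> A"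
      unfolding law[OF elim] scaled_prob_def using that measurable_scaled[OF elim]
      by (subst measure_distr) (auto intro!: arg_cong[where f = "measure M"])
    then show ?case by simp
  qed
  have prob_le_1: "\<forall>\<^sub>F \<epsilon> in at_right 0. scaled_prob \<epsilon> A \<le> 1" for A
    using eventually_in_unit
  proof eventually_elim
    case (elim \<epsilon>)
    interpret gaussian_path M "Z \<epsilon>" C \<beta> using path[OF elim] .
    show ?case by (simp add: scaled_prob_def)
  qed
  have upper: "Limsup (at_right 0) (\<lambda>\<epsilon>. ereal (1 / g \<epsilon>) * log_prob (measure (\<nu> \<epsilon>) F))
      \<le> - (INF x\<in>F. enn2ereal (rkhs_rate N Z0 x))" if F: "closed F" for F
  proof -
    define m where "m = (INF x\<in>F. enn2ereal (rkhs_rate N Z0 x))"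
    define L where "L = Limsup (at_right 0) (\<lambda>\<epsilon>. ereal (1 / g \<epsilon>) * log_prob (scaled_prob \<epsilon> F))"
    have "m \<le> - L"
    proof (rule ccontr)
      assume "\<not> m \<le> - L"
      then have "- L < m" by simp
      then obtain a where a: "- L < ereal a" "ereal a < m" using ereal_dense2 by blast
      then obtain a' where a': "ereal a < ereal a'" "ereal a' < m" using ereal_dense2 by blast
      \<comment> \<open>\<open>closed_upper_bound\<close> requires a nonnegative level; for a < 0
        the trivial bound by probability 1 gives L \<le> 0.\<close>
      have "L \<le> ereal (- max a 0)"
      proof (cases "0 \<le> a")
        case True
        have "\<not> rkhs_rate N Z0 x \<le> ennreal a'" if "x \<in> F" for x
        proof
          assume "rkhs_rate N Z0 x \<le> ennreal a'"
          then have "enn2ereal (rkhs_rate N Z0 x) \<le> enn2ereal (ennreal a')"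
            by (simp add: less_eq_ennreal.rep_eq)
          also have "\<dots> = ereal a'" using True a'(1) by (simp add: enn2ereal_ennreal)
          also have "\<dots> < m" by (rule a'(2))
          also have "m \<le> enn2ereal (rkhs_rate N Z0 x)" unfolding m_def by (rule INF_lower[OF that])
          finally show False by simp
        qed
        then have "L \<le> ereal (- a)"
          unfolding L_def using True a'(1) by (intro closed_upper_bound[OF F, of _ a']) auto
        then show ?thesis using True by (simp add: max_def)
      next
        case False
        have "L \<le> ereal (- 0)"
          unfolding L_def
          by (rule Limsup_log_prob_le[OF g_at_top, of 1]) (use prob_le_1 in auto)
        then show ?thesis using False by simp
      qed
      then have "L \<le> ereal (- a)" by (rule order_trans) simp
      then have "ereal a \<le> - L" by (metis ereal_minus_le_minus ereal_uminus_uminus uminus_ereal.simps(1))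
      then show False using a(1) by simp
    qed
    then have "L \<le> - m" by (metis ereal_minus_le_minus ereal_uminus_uminus)
    moreover have "Limsup (at_right 0) (\<lambda>\<epsilon>. ereal (1 / g \<epsilon>) * log_prob (measure (\<nu> \<epsilon>) F)) = L"
      unfolding L_def by (rule Limsup_eq[OF eq]) (use F in \<open>rule borel_closed\<close>)
    ultimately show ?thesis by (simp add: m_def)
  qed
  have lower: "- (INF x\<in>G. enn2ereal (rkhs_rate N Z0 x)) \<le>
      Liminf (at_right 0) (\<lambda>\<epsilon>. ereal (1 / g \<epsilon>) * log_prob (measure (\<nu> \<epsilon>) G))" if G: "open G" for G
  proof -
    define L where "L = Liminf (at_right 0) (\<lambda>\<epsilon>. ereal (1 / g \<epsilon>) * log_prob (scaled_prob \<epsilon> G))"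
    have "- L \<le> enn2ereal (rkhs_rate N Z0 x)" if x: "x \<in> G" for x
    proof (cases "x \<in> rkhs N Z0")
      case False
      then show ?thesis by (simp add: rkhs_rate_def)
    next
      case True
      then obtain \<xi> where \<xi>: "\<xi> \<in> gaussian_L2_closure N Z0" "x = kernel_path N Z0 \<xi>"
        by (auto simp: limit.rkhs_eq)
      define v where "v = (\<integral>w. (\<xi> w)\<^sup>2 \<partial>N)"
      have rate: "enn2ereal (rkhs_rate N Z0 x) = ereal (v / 2)"
        by (simp add: \<xi>(2) limit.rkhs_rate_kernel_path[OF \<xi>(1)] enn2ereal_ennreal v_def)
      have "- L \<le> ereal (v / 2) + ereal e" if "0 < e" for e
      proof -
        \<comment> \<open>A variance excess e counts as e / 2 in the rate, and the tolerance e / 2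
          of \<open>scaled_prob_lower\<close> supplies the other half.\<close>
        obtain \<alpha> where \<alpha>: "\<alpha> \<in> eval_span" "represent N Z0 \<alpha> \<in> G" "covar N Z0 \<alpha> \<alpha> \<le> v + e"
          using limit.kernel_path_approx[OF \<xi>(1) G, of e] x \<open>0 < e\<close> unfolding \<xi>(2) v_def by auto
        have "ereal (- (covar N Z0 \<alpha> \<alpha> / 2 + e / 2)) \<le> L"
          unfolding L_def
          by (rule Liminf_log_prob_ge[OF g_at_top, of "1/2"])
            (use scaled_prob_lower[OF \<alpha>(1) G \<alpha>(2), of "e / 2"] \<open>0 < e\<close> in auto)
        then have "- L \<le> ereal (covar N Z0 \<alpha> \<alpha> / 2 + e / 2)"
          by (metis ereal_minus_le_minus ereal_uminus_uminus uminus_ereal.simps(1))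
        also have "\<dots> \<le> ereal (v / 2) + ereal e" using \<alpha>(3) by simp
        finally show ?thesis .
      qed
      then have "- L \<le> ereal (v / 2)" by (rule ereal_le_epsilon2)
      then show ?thesis by (simp add: rate)
    qed
    then have "- L \<le> (INF x\<in>G. enn2ereal (rkhs_rate N Z0 x))" by (rule INF_greatest)
    moreover have "Liminf (at_right 0) (\<lambda>\<epsilon>. ereal (1 / g \<epsilon>) * log_prob (measure (\<nu> \<epsilon>) G)) = L"
      unfolding L_def by (rule Liminf_eq[OF eq]) (use G in \<open>rule borel_open\<close>)
    ultimately show ?thesis by (metis ereal_uminus_le_reorder)
  qed
  show ?thesis
    unfolding satisfies_LDP_def
    using limit.rate_function_rkhs_rate g_at_top upper lower by blast
qed

end

section \<open>Gaussian processes and averages over the Hurst index\<close>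

lemma gaussian_rv_cong:
  assumes "\<And>w. w \<in> space M \<Longrightarrow> Y w = Y' w"
  shows "gaussian_rv M Y \<longleftrightarrow> gaussian_rv M Y'"
proof -
  have "Y \<in> borel_measurable M \<longleftrightarrow> Y' \<in> borel_measurable M" using assms by (rule measurable_cong)
  moreover have "distr M borel Y = distr M borel Y'" using assms by (intro distr_cong) auto
  ultimately show ?thesis unfolding gaussian_rv_def by simp
qed

locale centered_gaussian_process =
  fixes M :: "'a measure" and X :: "real \<Rightarrow> 'a \<Rightarrow> real" and k :: "real \<Rightarrow> real \<Rightarrow> real"
  assumes ccgp: "continuous_centered_gaussian_process M X k"
begin

sublocale prob_space M
  using ccgp by (simp add: continuous_centered_gaussian_process_def)

lemma continuous_paths: "w \<in> space M \<Longrightarrow> continuous_on {0..1} (\<lambda>t. X t w)"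
  and mean_0: "t \<in> {0..1} \<Longrightarrow> expectation (X t) = 0"
  and covariance: "s \<in> {0..1} \<Longrightarrow> t \<in> {0..1} \<Longrightarrow> expectation (\<lambda>w. X s w * X t w) = k s t"
  and gaussian_sum: "finite T \<Longrightarrow> T \<subseteq> {0..1} \<Longrightarrow> gaussian_rv M (\<lambda>w. \<Sum>t\<in>T. a t * X t w)"
  using ccgp by (auto simp: continuous_centered_gaussian_process_def gaussian_process_def)

lemma gaussian_rv_X: "t \<in> {0..1} \<Longrightarrow> gaussian_rv M (X t)"
  using gaussian_sum[of "{t}" "\<lambda>_. 1"] by simp

lemma measurable_X: "t \<in> {0..1} \<Longrightarrow> X t \<in> borel_measurable M"
  using gaussian_rv_X by (simp add: gaussian_rv_def)

lemma integrable_X_square: "t \<in> {0..1} \<Longrightarrow> integrable M (\<lambda>w. (X t w)\<^sup>2)"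
  by (rule centered_gaussian_rv_integrable[OF prob_space_axioms gaussian_rv_X mean_0])

lemma integrable_X: "t \<in> {0..1} \<Longrightarrow> integrable M (X t)"
  by (rule square_integrable_imp_integrable[OF measurable_X integrable_X_square])

lemma integrable_X_mult: "s \<in> {0..1} \<Longrightarrow> t \<in> {0..1} \<Longrightarrow> integrable M (\<lambda>w. X s w * X t w)"
  by (intro integrable_mult_square_integrable measurable_X integrable_X_square)

lemma sample_path_eval:
  "w \<in> space M \<Longrightarrow> apply_bcontfun (sample_path X w) u = X (val01 u) w"
  by (intro apply_sample_path continuous_paths)

lemma measurable_sample_path: "sample_path X \<in> borel_measurable M"
proof (rule borel_measurable_C01I)
  fix u
  show "(\<lambda>w. apply_bcontfun (sample_path X w) u) \<in> borel_measurable M"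
    using measurable_X[OF val01[of u]] by (subst measurable_cong[OF sample_path_eval])
qed

text \<open>Through this quadratic form the variances inherit convergence from the kernel at pairs
  of times.\<close>

lemma covar_sum:
  assumes T: "finite T" "T \<subseteq> {0..1}"
    and \<alpha>: "\<And>f. blinfun_apply \<alpha> f = (\<Sum>t\<in>T. a t * apply_bcontfun f (Unit_interval t))"
  shows "covar M (sample_path X) \<alpha> \<alpha> = (\<Sum>s\<in>T. \<Sum>t\<in>T. a s * a t * k s t)"
proof -
  have "covar M (sample_path X) \<alpha> \<alpha> = (\<integral>w. (\<Sum>s\<in>T. \<Sum>t\<in>T. a s * a t * (X s w * X t w)) \<partial>M)"
    unfolding covar_def
  proof (rule Bochner_Integration.integral_cong[OF refl])
    fix w assume w: "w \<in> space M"
    have "blinfun_apply \<alpha> (sample_path X w) = (\<Sum>t\<in>T. a t * X t w)"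
      unfolding \<alpha> using T(2) by (intro sum.cong) (auto simp: sample_path_eval[OF w] Unit_interval_inverse)
    then show "blinfun_apply \<alpha> (sample_path X w) * blinfun_apply \<alpha> (sample_path X w) =
        (\<Sum>s\<in>T. \<Sum>t\<in>T. a s * a t * (X s w * X t w))"
      by (simp add: sum_product mult_ac)
  qed
  also have "\<dots> = (\<Sum>s\<in>T. \<Sum>t\<in>T. a s * a t * k s t)"
  proof -
    have int: "integrable M (\<lambda>w. a s * a t * (X s w * X t w))" if "s \<in> T" "t \<in> T" for s t
      using that T(2) by (intro integrable_mult_right integrable_X_mult) auto
    have "(\<integral>w. (\<Sum>s\<in>T. \<Sum>t\<in>T. a s * a t * (X s w * X t w)) \<partial>M) =
        (\<Sum>s\<in>T. \<integral>w. (\<Sum>t\<in>T. a s * a t * (X s w * X t w)) \<partial>M)"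
      by (intro Bochner_Integration.integral_sum Bochner_Integration.integrable_sum int)
    also have "\<dots> = (\<Sum>s\<in>T. \<Sum>t\<in>T. \<integral>w. a s * a t * (X s w * X t w) \<partial>M)"
      by (intro sum.cong refl Bochner_Integration.integral_sum int)
    also have "\<dots> = (\<Sum>s\<in>T. \<Sum>t\<in>T. a s * a t * k s t)"
      using T(2) by (intro sum.cong refl) (simp add: covariance subset_iff)
    finally show ?thesis .
  qed
  finally show ?thesis .
qed

lemma gaussian_path_sample_path:
  assumes C: "0 < C" "0 < \<beta>" and k0: "k 0 0 = 0"
    and incr: "\<And>s t. s \<in> {0..1} \<Longrightarrow> t \<in> {0..1} \<Longrightarrow> k t t + k s s - 2 * k s t \<le> C * \<bar>t - s\<bar> powr \<beta>"
  shows "gaussian_path M (sample_path X) C \<beta>"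
proof -
  have gauss: "gaussian_rv M (\<lambda>w. blinfun_apply \<alpha> (sample_path X w)) \<and>
      (\<integral>w. blinfun_apply \<alpha> (sample_path X w) \<partial>M) = 0" if \<alpha>: "\<alpha> \<in> eval_span" for \<alpha>
  proof -
    obtain T a where T: "finite T" "T \<subseteq> {0..1}"
      and a: "\<And>f. blinfun_apply \<alpha> f = (\<Sum>t\<in>T. a t * apply_bcontfun f (Unit_interval t))"
      using eval_span_as_sum[OF \<alpha>] by metis
    have eq: "blinfun_apply \<alpha> (sample_path X w) = (\<Sum>t\<in>T. a t * X t w)" if w: "w \<in> space M" for w
      unfolding a using T(2) by (intro sum.cong) (auto simp: sample_path_eval[OF w] Unit_interval_inverse)
    have "(\<integral>w. blinfun_apply \<alpha> (sample_path X w) \<partial>M) = (\<integral>w. (\<Sum>t\<in>T. a t * X t w) \<partial>M)"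
      by (rule Bochner_Integration.integral_cong[OF refl eq])
    also have "\<dots> = (\<Sum>t\<in>T. a t * expectation (X t))"
      using T(2) by (subst Bochner_Integration.integral_sum) (auto intro: integrable_X)
    also have "\<dots> = 0" using T(2) by (intro sum.neutral) (auto simp: mean_0 subset_iff)
    finally show ?thesis using gaussian_sum[OF T, of a] by (subst gaussian_rv_cong[OF eq]) auto
  qed
  show ?thesis
  proof
    show "AE w in M. apply_bcontfun (sample_path X w) (Unit_interval 0) = 0"
    proof -
      have "(\<integral>w. (X 0 w)\<^sup>2 \<partial>M) = 0" using covariance[of 0 0] k0 by (simp add: power2_eq_square)
      then have "AE w in M. (X 0 w)\<^sup>2 = 0"
        using integral_nonneg_eq_0_iff_AE[OF integrable_X_square[of 0]] by simp
      then show ?thesis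
        by (rule AE_mp) (auto intro!: AE_I2 simp: sample_path_eval Unit_interval_inverse)
    qed
    fix \<alpha> assume \<alpha>: "\<alpha> \<in> eval_span"
    note * = prob_space_axioms gauss[OF \<alpha>, THEN conjunct1] gauss[OF \<alpha>, THEN conjunct2]
    have c: "covar M (sample_path X) \<alpha> \<alpha> = (\<integral>w. (blinfun_apply \<alpha> (sample_path X w))\<^sup>2 \<partial>M)"
      by (simp add: covar_def power2_eq_square)
    show "(\<integral>\<^sup>+w. ennreal (exp (blinfun_apply \<alpha> (sample_path X w))) \<partial>M) = ennreal (exp (covar M (sample_path X) \<alpha> \<alpha> / 2))"
      unfolding c by (rule centered_gaussian_rv_exp[OF *])
    show "(\<integral>w. cos (blinfun_apply \<alpha> (sample_path X w)) \<partial>M) = exp (- covar M (sample_path X) \<alpha> \<alpha> / 2)"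
      unfolding c by (rule centered_gaussian_rv_cos[OF *])
    show "(\<integral>w. sin (blinfun_apply \<alpha> (sample_path X w)) \<partial>M) = 0"
      by (rule centered_gaussian_rv_sin[OF *])
  next
    fix s t
    define x y where "x = val01 s" and "y = val01 t"
    have xy: "x \<in> {0..1}" "y \<in> {0..1}" unfolding x_def y_def by (rule val01)+
    have "covar M (sample_path X) (evaluation t - evaluation s) (evaluation t - evaluation s) =
        (\<integral>w. X y w * X y w + X x w * X x w - 2 * (X x w * X y w) \<partial>M)"
      unfolding covar_def x_def y_def
      by (rule Bochner_Integration.integral_cong[OF refl])
        (simp add: blinfun.diff_left sample_path_eval algebra_simps)
    also have "\<dots> = k y y + k x x - 2 * k x y"
      using xy integrable_X_mult covariance by simp
    also have "\<dots> \<le> C * dist s t powr \<beta>"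
      using incr[OF xy] by (simp add: dist_unit_interval.rep_eq dist_real_def x_def y_def abs_minus_commute)
    finally show "covar M (sample_path X) (evaluation t - evaluation s) (evaluation t - evaluation s)
        \<le> C * dist s t powr \<beta>" .
  qed (use C measurable_sample_path in auto)
qed

lemma scaled_process:
  assumes c: "0 < c" "c \<le> 1"
  shows "continuous_centered_gaussian_process M (\<lambda>t w. r * X (c * t) w) (\<lambda>s t. r\<^sup>2 * k (c * s) (c * t))"
proof -
  have c01: "c * t \<in> {0..1}" if "t \<in> {0..1}" for t using that c by (auto simp: mult_le_one)
  have "gaussian_rv M (\<lambda>w. \<Sum>t\<in>T. a t * (r * X (c * t) w))" if T: "finite T" "T \<subseteq> {0..1}" for T a
  proof -
    \<comment> \<open>Distinct times stay distinct after the time change, so the combination is one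
      of \<open>X\<close> over the image set.\<close>
    have inj: "inj_on ((*) c) T" using c by (auto simp: inj_on_def)
    have "gaussian_rv M (\<lambda>w. \<Sum>t\<in>(*) c ` T. (a (t / c) * r) * X t w)"
      using T c01 by (intro gaussian_sum) auto
    then show ?thesis using c by (simp add: sum.reindex[OF inj] mult.assoc)
  qed
  moreover have "continuous_on {0..1} (\<lambda>t. r * X (c * t) w)" if "w \<in> space M" for w
    by (intro continuous_intros continuous_on_compose2[OF continuous_paths[OF that]]) (use c01 in auto)
  moreover have "(\<integral>w. r * X s w * (r * X t w) \<partial>M) = r\<^sup>2 * k s t" if "s \<in> {0..1}" "t \<in> {0..1}" for s t
  proof -
    have "(\<integral>w. r * X s w * (r * X t w) \<partial>M) = (\<integral>w. r\<^sup>2 * (X s w * X t w) \<partial>M)"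
      by (simp add: power2_eq_square mult_ac)
    then show ?thesis by (simp add: covariance[OF that])
  qed
  ultimately show ?thesis
    unfolding continuous_centered_gaussian_process_def gaussian_process_def
    using prob_space_axioms c01 mean_0 by simp
qed

end

text \<open>Time 0 is fixed by scaling, so scaling by 1/2 multiplies the value by 2^(-2H) < 1
  without changing it.\<close>

lemma self_similar_cov_0:
  assumes "self_similar_cov H k" "0 < H"
  shows "k 0 0 = 0"
proof -
  have "k 0 0 = (1/2) powr (2 * H) * k 0 0"
    using assms(1)[unfolded self_similar_cov_def, rule_format, of "1/2" 0 0] by simp
  moreover have "(1/2) powr (2 * H) < (1::real)" using assms(2) powr_less_mono2[of "2 * H" "1/2" 1] by simp
  ultimately show ?thesis by auto
qed

section \<open>Laplace asymptotics of averages over the Hurst index\<close>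

locale hurst_measure = finite_measure \<mu> for \<mu> :: "real measure" +
  fixes H0 H1 :: real
  assumes H0_pos: "0 < H0" and H0_less_H1: "H0 < H1"
    and sets_\<mu>: "sets \<mu> = sets (restrict_space borel {H0..H1})"
    and H0_support: "H0 \<in> measure_support \<mu>"
begin

lemma space_\<mu>: "space \<mu> = {H0..H1}"
  using sets_eq_imp_space_eq[OF sets_\<mu>] by (simp add: space_restrict_space)

lemma measurable_\<mu>:
  assumes "continuous_on {H0..H1} f"
  shows "f \<in> borel_measurable \<mu>"
  using borel_measurable_continuous_on_restrict[OF assms] measurable_cong_sets[OF sets_\<mu> refl] by blast

lemma integrable_\<mu>:
  fixes f :: "real \<Rightarrow> real"
  assumes "continuous_on {H0..H1} f"
  shows "integrable \<mu> f"
proof -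
  have "compact (f ` {H0..H1})" using assms by (intro compact_continuous_image) auto
  then obtain B where "\<And>H. H \<in> {H0..H1} \<Longrightarrow> norm (f H) \<le> B"
    using compact_imp_bounded bounded_iff by (metis imageI)
  then show ?thesis
    by (intro integrable_const_bound[where B = B] measurable_\<mu> assms) (auto simp: space_\<mu>)
qed

definition weight :: "real \<Rightarrow> real" where
  "weight \<epsilon> = (\<integral>H. \<epsilon> powr (2 * H) \<partial>\<mu>)"

lemma continuous_on_powr_exponent: "0 < \<epsilon> \<Longrightarrow> continuous_on S (\<lambda>H::real. \<epsilon> powr (2 * H))"
  by (intro continuous_intros) auto

text \<open>For \<epsilon> \<le> 1 the integrand decreases in H, so indices below H0 + \<delta>
  contribute at least its value there. Their mass is positive because H0 lies in the
  support.\<close>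

lemma weight_ge:
  assumes "0 < \<epsilon>" "\<epsilon> \<le> 1"
  shows "\<epsilon> powr (2 * (H0 + \<delta>)) * measure \<mu> ({..<H0 + \<delta>} \<inter> space \<mu>) \<le> weight \<epsilon>"
proof -
  have A: "{..<H0 + \<delta>} \<inter> space \<mu> \<in> sets \<mu>"
    unfolding sets_\<mu> space_\<mu> by (auto simp: sets_restrict_space)
  have "\<epsilon> powr (2 * (H0 + \<delta>)) * measure \<mu> ({..<H0 + \<delta>} \<inter> space \<mu>) =
      (\<integral>H. \<epsilon> powr (2 * (H0 + \<delta>)) * indicator ({..<H0 + \<delta>} \<inter> space \<mu>) H \<partial>\<mu>)"
    using A by simp
  also have "\<dots> \<le> (\<integral>H. \<epsilon> powr (2 * H) \<partial>\<mu>)"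
  proof (rule integral_mono)
    show "integrable \<mu> (\<lambda>H. \<epsilon> powr (2 * (H0 + \<delta>)) * indicator ({..<H0 + \<delta>} \<inter> space \<mu>) H)"
      using A by (intro integrable_mult_right integrable_real_indicator) (auto simp: less_top[symmetric])
    show "integrable \<mu> (\<lambda>H. \<epsilon> powr (2 * H))"
      using assms by (intro integrable_\<mu> continuous_on_powr_exponent)
    show "\<epsilon> powr (2 * (H0 + \<delta>)) * indicator ({..<H0 + \<delta>} \<inter> space \<mu>) H \<le> \<epsilon> powr (2 * H)" for H
      using assms by (auto split: split_indicator intro: powr_mono')
  qed
  finally show ?thesis by (simp add: weight_def)
qed

lemma support_measure_pos: "0 < \<delta> \<Longrightarrow> 0 < measure \<mu> ({..<H0 + \<delta>} \<inter> space \<mu>)"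
  using H0_support unfolding measure_support_def
  by (auto simp: emeasure_eq_measure dest!: spec[of _ "{..<H0 + \<delta>}"])

lemma weight_pos:
  assumes "0 < \<epsilon>" "\<epsilon> \<le> 1"
  shows "0 < weight \<epsilon>"
proof -
  have "0 < \<epsilon> powr (2 * (H0 + 1)) * measure \<mu> ({..<H0 + 1} \<inter> space \<mu>)"
    using support_measure_pos[of 1] assms by simp
  then show ?thesis using weight_ge[OF assms, of 1] by linarith
qed

lemma weight_le:
  assumes "0 < \<epsilon>" "\<epsilon> \<le> 1"
  shows "weight \<epsilon> \<le> \<epsilon> powr (2 * H0) * measure \<mu> (space \<mu>)"
proof -
  have "weight \<epsilon> \<le> (\<integral>H. \<epsilon> powr (2 * H0) \<partial>\<mu>)"
    unfolding weight_def
  proof (rule integral_mono)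
    show "integrable \<mu> (\<lambda>H. \<epsilon> powr (2 * H))"
      using assms by (intro integrable_\<mu> continuous_on_powr_exponent)
    show "\<epsilon> powr (2 * H) \<le> \<epsilon> powr (2 * H0)" if "H \<in> space \<mu>" for H
      using assms that by (intro powr_mono') (auto simp: space_\<mu>)
  qed simp
  then show ?thesis by (simp add: mult.commute)
qed

lemma tendsto_powr_at_right_0: "0 < a \<Longrightarrow> ((\<lambda>\<epsilon>::real. \<epsilon> powr a) \<longlongrightarrow> 0) (at_right 0)"
  using tendsto_powr'[of "\<lambda>\<epsilon>. \<epsilon>" "0::real" "at_right 0" "\<lambda>_. a" a]
  by (simp add: eventually_at_filter)

lemma inverse_weight_at_top: "filterlim (\<lambda>\<epsilon>. inverse (weight \<epsilon>)) at_top (at_right 0)"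
proof (rule filterlim_inverse_at_top)
  have ev: "\<forall>\<^sub>F \<epsilon> in at_right (0::real). \<epsilon> \<in> {0<..1}" by (rule eventually_in_unit)
  have "((\<lambda>\<epsilon>. \<epsilon> powr (2 * H0) * measure \<mu> (space \<mu>)) \<longlongrightarrow> 0 * measure \<mu> (space \<mu>)) (at_right 0)"
    using H0_pos by (intro tendsto_intros tendsto_powr_at_right_0) auto
  then have lim: "((\<lambda>\<epsilon>. \<epsilon> powr (2 * H0) * measure \<mu> (space \<mu>)) \<longlongrightarrow> 0) (at_right 0)" by simp
  show "(weight \<longlongrightarrow> 0) (at_right 0)"
    by (rule tendsto_sandwich[OF _ _ tendsto_const lim])
      (use ev in \<open>eventually_elim, use weight_pos weight_le less_imp_le in auto\<close>)+
  show "\<forall>\<^sub>F \<epsilon> in at_right 0. 0 < weight \<epsilon>"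
    using ev by eventually_elim (use weight_pos in auto)
qed

text \<open>Laplace's method. Close to H0 continuity controls f. Indices beyond H0 + 2\<delta>
  contribute at most a multiple of \<epsilon>^(2(H0 + 2\<delta>)), while the weight is at least a
  multiple of \<epsilon>^(2(H0 + \<delta>)); their quotient tends to 0.\<close>

lemma weighted_mean_tendsto:
  fixes f :: "real \<Rightarrow> real"
  assumes f: "continuous_on {H0..H1} f"
  shows "((\<lambda>\<epsilon>. inverse (weight \<epsilon>) * (\<integral>H. \<epsilon> powr (2 * H) * f H \<partial>\<mu>)) \<longlongrightarrow> f H0) (at_right 0)"
proof (rule tendstoI)
  fix e :: real assume e: "0 < e"
  have "compact (f ` {H0..H1})" using f by (intro compact_continuous_image) auto
  then obtain B where B: "\<And>H. H \<in> {H0..H1} \<Longrightarrow> \<bar>f H\<bar> \<le> B"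
    using compact_imp_bounded bounded_iff by (metis imageI real_norm_def)
  have B0: "0 \<le> B" using B[of H0] H0_less_H1 by auto
  have "\<exists>d>0. \<forall>H\<in>{H0..H1}. dist H H0 < d \<longrightarrow> dist (f H) (f H0) < e / 2"
    using f[unfolded continuous_on_iff, rule_format, of H0 "e / 2"] H0_less_H1 e by auto
  then obtain d where d: "0 < d" "\<And>H. H \<in> {H0..H1} \<Longrightarrow> dist H H0 < d \<Longrightarrow> \<bar>f H - f H0\<bar> < e / 2"
    by (auto simp: dist_real_def)
  \<comment> \<open>Half the radius of continuity, so that the mass in the lower bound sits strictly
    closer to H0 than the indices to be discarded.\<close>
  define \<delta> where "\<delta> = d / 2"
  have \<delta>: "0 < \<delta>" using d(1) by (simp add: \<delta>_def)
  define m where "m = measure \<mu> ({..<H0 + \<delta>} \<inter> space \<mu>)"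
  have m: "0 < m" unfolding m_def by (rule support_measure_pos[OF \<delta>])
  define c where "c = 2 * B * measure \<mu> (space \<mu>) / m"
  have "((\<lambda>\<epsilon>. c * \<epsilon> powr (2 * \<delta>)) \<longlongrightarrow> c * 0) (at_right 0)"
    using \<delta> by (intro tendsto_intros tendsto_powr_at_right_0) auto
  then have "\<forall>\<^sub>F \<epsilon> in at_right 0. c * \<epsilon> powr (2 * \<delta>) < e / 2"
    using e by (intro order_tendstoD(2)[where y = 0]) auto
  with eventually_in_unit
  show "\<forall>\<^sub>F \<epsilon> in at_right 0. dist (inverse (weight \<epsilon>) * (\<integral>H. \<epsilon> powr (2 * H) * f H \<partial>\<mu>)) (f H0) < e"
  proof eventually_elim
    case (elim \<epsilon>)
    then have \<epsilon>: "0 < \<epsilon>" "\<epsilon> \<le> 1" by auto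
    have W: "0 < weight \<epsilon>" by (rule weight_pos[OF \<epsilon>])
    note cont = continuous_on_powr_exponent[OF \<epsilon>(1)]
    have i1: "integrable \<mu> (\<lambda>H. \<epsilon> powr (2 * H) * f H)" by (intro integrable_\<mu> continuous_on_mult cont f)
    have i2: "integrable \<mu> (\<lambda>H. \<epsilon> powr (2 * H))" by (intro integrable_\<mu> cont)
    have i3: "integrable \<mu> (\<lambda>H. \<bar>\<epsilon> powr (2 * H) * (f H - f H0)\<bar>)"
      by (intro integrable_\<mu> continuous_intros cont f)
    have "\<bar>(\<integral>H. \<epsilon> powr (2 * H) * f H \<partial>\<mu>) - f H0 * weight \<epsilon>\<bar> = \<bar>\<integral>H. \<epsilon> powr (2 * H) * (f H - f H0) \<partial>\<mu>\<bar>"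
    proof -
      have "(\<lambda>H. \<epsilon> powr (2 * H) * (f H - f H0)) = (\<lambda>H. \<epsilon> powr (2 * H) * f H - f H0 * \<epsilon> powr (2 * H))"
        by (simp add: algebra_simps)
      then show ?thesis using i1 i2 by (simp add: weight_def)
    qed
    also have "\<dots> \<le> (\<integral>H. \<bar>\<epsilon> powr (2 * H) * (f H - f H0)\<bar> \<partial>\<mu>)" by (rule integral_abs_bound)
    also have "\<dots> \<le> (\<integral>H. e / 2 * \<epsilon> powr (2 * H) + 2 * B * \<epsilon> powr (2 * (H0 + 2 * \<delta>)) \<partial>\<mu>)"
    proof (rule integral_mono[OF i3])
      show "integrable \<mu> (\<lambda>H. e / 2 * \<epsilon> powr (2 * H) + 2 * B * \<epsilon> powr (2 * (H0 + 2 * \<delta>)))"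
        using i2 by simp
      fix H assume "H \<in> space \<mu>"
      then have H: "H \<in> {H0..H1}" by (simp add: space_\<mu>)
      show "\<bar>\<epsilon> powr (2 * H) * (f H - f H0)\<bar> \<le> e / 2 * \<epsilon> powr (2 * H) + 2 * B * \<epsilon> powr (2 * (H0 + 2 * \<delta>))"
      proof (cases "H < H0 + 2 * \<delta>")
        case True
        then have "\<bar>f H - f H0\<bar> \<le> e / 2" using d(2)[OF H] H by (auto simp: dist_real_def \<delta>_def)
        then have "\<epsilon> powr (2 * H) * \<bar>f H - f H0\<bar> \<le> \<epsilon> powr (2 * H) * (e / 2)" by (intro mult_left_mono) auto
        moreover have "0 \<le> 2 * B * \<epsilon> powr (2 * (H0 + 2 * \<delta>))" using B0 by simp
        ultimately show ?thesis by (simp add: abs_mult mult.commute)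
      next
        case False
        then have "\<epsilon> powr (2 * H) \<le> \<epsilon> powr (2 * (H0 + 2 * \<delta>))" using \<epsilon> by (intro powr_mono') auto
        moreover have "\<bar>f H - f H0\<bar> \<le> 2 * B" using B[OF H] B[of H0] H0_less_H1 by auto
        ultimately have "\<bar>f H - f H0\<bar> * \<epsilon> powr (2 * H) \<le> 2 * B * \<epsilon> powr (2 * (H0 + 2 * \<delta>))"
          using B0 by (intro mult_mono) auto
        moreover have "0 \<le> e / 2 * \<epsilon> powr (2 * H)" using e by simp
        ultimately show ?thesis by (simp add: abs_mult mult.commute)
      qed
    qed
    also have "\<dots> = e / 2 * weight \<epsilon> + 2 * B * measure \<mu> (space \<mu>) * \<epsilon> powr (2 * (H0 + 2 * \<delta>))"
      using i2 by (simp add: weight_def)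
    also have "2 * B * measure \<mu> (space \<mu>) * \<epsilon> powr (2 * (H0 + 2 * \<delta>)) =
        c * \<epsilon> powr (2 * \<delta>) * (\<epsilon> powr (2 * (H0 + \<delta>)) * m)"
      using m by (simp add: c_def powr_add[symmetric] algebra_simps)
    also have "\<dots> \<le> c * \<epsilon> powr (2 * \<delta>) * weight \<epsilon>"
      using weight_ge[OF \<epsilon>, of \<delta>] B0 m by (intro mult_left_mono) (auto simp: c_def m_def)
    also have "\<dots> < e / 2 * weight \<epsilon>" using elim(2) W by simp
    finally have "\<bar>(\<integral>H. \<epsilon> powr (2 * H) * f H \<partial>\<mu>) - f H0 * weight \<epsilon>\<bar> < e * weight \<epsilon>" by simp
    moreover have "inverse (weight \<epsilon>) * x - f H0 = (x - f H0 * weight \<epsilon>) / weight \<epsilon>" for x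
      using W by (simp add: field_simps)
    ultimately show ?case using W by (simp add: dist_real_def abs_divide pos_divide_less_eq)
  qed
qed

end

section \<open>Application to the rescaled process\<close>

theorem mainTheorem5:
  fixes H0 H1 C \<beta> :: real
    and k :: "real \<Rightarrow> real \<Rightarrow> real \<Rightarrow> real"
    and \<mu> :: "real measure"
    and N :: "real \<Rightarrow> 'b measure" and Y :: "real \<Rightarrow> real \<Rightarrow> 'b \<Rightarrow> real"
    and M :: "'a measure" and X :: "real \<Rightarrow> 'a \<Rightarrow> real"
    and g :: "real \<Rightarrow> real"
  assumes "0 < H0" and "H0 < H1"
    and "\<And>H. H \<in> {H0..H1} \<Longrightarrow> continuous_centered_gaussian_process (N H) (Y H) (k H)"
    and "\<And>H. H \<in> {H0..H1} \<Longrightarrow> self_similar_cov H (k H)"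
    and "\<And>s t. s \<in> {0..1} \<Longrightarrow> t \<in> {0..1} \<Longrightarrow> continuous_on {H0..H1} (\<lambda>H. k H s t)"
    and "C > 0" and "\<beta> > 0"
    and "\<And>H s t. H \<in> {H0..H1} \<Longrightarrow> s \<in> {0..1} \<Longrightarrow> t \<in> {0..1} \<Longrightarrow>
          k H t t + k H s s - 2 * k H s t \<le> C * \<bar>t - s\<bar> powr \<beta>"
    and "finite_measure \<mu>" and "sets \<mu> = sets (restrict_space borel {H0..H1})"
    and "H0 \<in> measure_support \<mu>"
    and "continuous_centered_gaussian_process M X (\<lambda>s t. \<integral>H. k H s t \<partial>\<mu>)"
    and "\<And>\<epsilon>. 0 < \<epsilon> \<Longrightarrow> g \<epsilon> = inverse (\<integral>H. \<epsilon> powr (2 * H) \<partial>\<mu>)"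
  shows "tight_family {0<..1} (\<lambda>\<epsilon>. path_law M (\<lambda>t \<omega>. sqrt (g \<epsilon>) * X (\<epsilon> * t) \<omega>))
    \<and> weakly_converges (\<lambda>\<epsilon>. path_law M (\<lambda>t \<omega>. sqrt (g \<epsilon>) * X (\<epsilon> * t) \<omega>))
           (path_law (N H0) (Y H0)) (at_right 0)
    \<and> satisfies_LDP (\<lambda>\<epsilon>. path_law M (\<lambda>t. X (\<epsilon> * t))) g
           (\<lambda>h. if h \<in> rkhs (N H0) (sample_path (Y H0))
                then ennreal (1/2 * (rkhs_norm (N H0) (sample_path (Y H0)) h)\<^sup>2) else \<infinity>)"
proof -
  note H0 = assms(1) and H01 = assms(2) and proc = assms(3) and self = assms(4) and cont = assms(5)
    and C = assms(6) and \<beta> = assms(7) and incr = assms(8) and X = assms(12) and g = assms(13)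
  interpret hurst_measure \<mu> H0 H1
    using assms(1,2,9-11) by (simp add: hurst_measure_def hurst_measure_axioms_def)
  interpret X: centered_gaussian_process M X "\<lambda>s t. \<integral>H. k H s t \<partial>\<mu>"
    using X by unfold_locales
  have H0': "H0 \<in> {H0..H1}" using H01 by simp
  have k0: "k H 0 0 = 0" if "H \<in> {H0..H1}" for H
    using self_similar_cov_0[OF self[OF that]] that H0 by auto
  interpret Y: centered_gaussian_process "N H0" "Y H0" "k H0"
    using proc[OF H0'] by unfold_locales
  define Z0 where "Z0 = sample_path (Y H0)"
  have Z0: "gaussian_path (N H0) Z0 C \<beta>"
    unfolding Z0_def using C \<beta> k0[OF H0'] incr[OF H0'] by (rule Y.gaussian_path_sample_path)
  define Z where "Z \<epsilon> = sample_path (\<lambda>t w. sqrt (g \<epsilon>) * X (\<epsilon> * t) w)" for \<epsilon>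
  \<comment> \<open>The kernel of the normalized path in the form of a weighted mean, to which
    \<open>weighted_mean_tendsto\<close> applies.\<close>
  define k' where "k' \<epsilon> s t = inverse (weight \<epsilon>) * (\<integral>H. \<epsilon> powr (2 * H) * k H s t \<partial>\<mu>)" for \<epsilon> s t
  have g_eq: "g \<epsilon> = inverse (weight \<epsilon>)" "0 < g \<epsilon>" "(sqrt (g \<epsilon>))\<^sup>2 = g \<epsilon>" if "\<epsilon> \<in> {0<..1}" for \<epsilon>
    using that g[of \<epsilon>] weight_pos[of \<epsilon>] by (auto simp: weight_def)
  have kernel: "(sqrt (g \<epsilon>))\<^sup>2 * (\<integral>H. k H (\<epsilon> * s) (\<epsilon> * t) \<partial>\<mu>) = k' \<epsilon> s t"
    if \<epsilon>: "\<epsilon> \<in> {0<..1}" and st: "s \<in> {0..1}" "t \<in> {0..1}" for \<epsilon> s t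
  proof -
    have "(\<integral>H. k H (\<epsilon> * s) (\<epsilon> * t) \<partial>\<mu>) = (\<integral>H. \<epsilon> powr (2 * H) * k H s t \<partial>\<mu>)"
    proof (rule Bochner_Integration.integral_cong[OF refl])
      fix H assume "H \<in> space \<mu>"
      then have H: "H \<in> {H0..H1}" by (simp add: space_\<mu>)
      have "\<epsilon> * s \<in> {0..1}" "\<epsilon> * t \<in> {0..1}" using \<epsilon> st by (auto simp: mult_le_one)
      then show "k H (\<epsilon> * s) (\<epsilon> * t) = \<epsilon> powr (2 * H) * k H s t"
        using self[OF H] \<epsilon> st unfolding self_similar_cov_def by auto
    qed
    then show ?thesis unfolding g_eq(3)[OF \<epsilon>] unfolding g_eq(1)[OF \<epsilon>] by (simp add: k'_def)
  qed
  have scaled: "centered_gaussian_process M (\<lambda>t w. sqrt (g \<epsilon>) * X (\<epsilon> * t) w) (k' \<epsilon>)" if \<epsilon>: "\<epsilon> \<in> {0<..1}" for \<epsilon>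
  proof
    have "continuous_centered_gaussian_process M (\<lambda>t w. sqrt (g \<epsilon>) * X (\<epsilon> * t) w)
        (\<lambda>s t. (sqrt (g \<epsilon>))\<^sup>2 * (\<integral>H. k H (\<epsilon> * s) (\<epsilon> * t) \<partial>\<mu>))"
      using \<epsilon> by (intro X.scaled_process) auto
    \<comment> \<open>The two kernels agree only on the unit square, which is all that the
      definition inspects.\<close>
    then show "continuous_centered_gaussian_process M (\<lambda>t w. sqrt (g \<epsilon>) * X (\<epsilon> * t) w) (k' \<epsilon>)"
      unfolding continuous_centered_gaussian_process_def using kernel[OF \<epsilon>] by simp
  qed
  have path: "gaussian_path M (Z \<epsilon>) C \<beta>" if \<epsilon>: "\<epsilon> \<in> {0<..1}" for \<epsilon>
    unfolding Z_def
  proof (rule centered_gaussian_process.gaussian_path_sample_path[OF scaled[OF \<epsilon>] C \<beta>])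
    have "(\<integral>H. \<epsilon> powr (2 * H) * k H 0 0 \<partial>\<mu>) = (\<integral>H. 0 \<partial>\<mu>)"
      by (rule Bochner_Integration.integral_cong) (auto simp: space_\<mu> k0)
    then show "k' \<epsilon> 0 0 = 0" by (simp add: k'_def)
  next
    fix s t :: real assume st: "s \<in> {0..1}" "t \<in> {0..1}"
    have \<epsilon>0: "0 < \<epsilon>" using \<epsilon> by simp
    note ip = continuous_on_powr_exponent[OF \<epsilon>0]
    have i: "integrable \<mu> (\<lambda>H. \<epsilon> powr (2 * H) * k H x y)" if "x \<in> {0..1}" "y \<in> {0..1}" for x y
      by (intro integrable_\<mu> continuous_on_mult ip cont that)
    have ie: "integrable \<mu> (\<lambda>H. \<epsilon> powr (2 * H))" by (intro integrable_\<mu> ip)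
    have "(\<integral>H. \<epsilon> powr (2 * H) * k H t t \<partial>\<mu>) + (\<integral>H. \<epsilon> powr (2 * H) * k H s s \<partial>\<mu>)
        - 2 * (\<integral>H. \<epsilon> powr (2 * H) * k H s t \<partial>\<mu>) =
        (\<integral>H. \<epsilon> powr (2 * H) * k H t t + \<epsilon> powr (2 * H) * k H s s - 2 * (\<epsilon> powr (2 * H) * k H s t) \<partial>\<mu>)"
      using i st by simp
    also have "\<dots> \<le> (\<integral>H. \<epsilon> powr (2 * H) * (C * \<bar>t - s\<bar> powr \<beta>) \<partial>\<mu>)"
    proof (rule integral_mono)
      show "integrable \<mu> (\<lambda>H. \<epsilon> powr (2 * H) * k H t t + \<epsilon> powr (2 * H) * k H s s - 2 * (\<epsilon> powr (2 * H) * k H s t))"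
        using i st by simp
      show "integrable \<mu> (\<lambda>H. \<epsilon> powr (2 * H) * (C * \<bar>t - s\<bar> powr \<beta>))" using ie by simp
      fix H assume "H \<in> space \<mu>"
      then have "\<epsilon> powr (2 * H) * (k H t t + k H s s - 2 * k H s t) \<le> \<epsilon> powr (2 * H) * (C * \<bar>t - s\<bar> powr \<beta>)"
        using incr st by (intro mult_left_mono) (auto simp: space_\<mu>)
      then show "\<epsilon> powr (2 * H) * k H t t + \<epsilon> powr (2 * H) * k H s s - 2 * (\<epsilon> powr (2 * H) * k H s t)
          \<le> \<epsilon> powr (2 * H) * (C * \<bar>t - s\<bar> powr \<beta>)"
        by (simp add: algebra_simps)
    qed
    \<comment> \<open>The increment bound does not depend on H, so averaging reproduces it times the
      total weight, which the normalization cancels.\<close>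
    also have "\<dots> = weight \<epsilon> * (C * \<bar>t - s\<bar> powr \<beta>)" using ie by (simp add: weight_def)
    finally have "inverse (weight \<epsilon>) * ((\<integral>H. \<epsilon> powr (2 * H) * k H t t \<partial>\<mu>) + (\<integral>H. \<epsilon> powr (2 * H) * k H s s \<partial>\<mu>)
        - 2 * (\<integral>H. \<epsilon> powr (2 * H) * k H s t \<partial>\<mu>)) \<le> inverse (weight \<epsilon>) * (weight \<epsilon> * (C * \<bar>t - s\<bar> powr \<beta>))"
      using weight_pos \<epsilon> by (intro mult_left_mono) (auto intro: less_imp_le)
    also have "\<dots> = C * \<bar>t - s\<bar> powr \<beta>" using weight_pos[of \<epsilon>] \<epsilon> by simp
    finally show "k' \<epsilon> t t + k' \<epsilon> s s - 2 * k' \<epsilon> s t \<le> C * \<bar>t - s\<bar> powr \<beta>"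
      by (simp add: k'_def algebra_simps)
  qed
  interpret F: gaussian_path_family "N H0" Z0 C \<beta> M Z g
  proof (intro gaussian_path_family.intro gaussian_path_family_axioms.intro Z0 path)
    fix \<alpha> :: "C01 \<Rightarrow>\<^sub>L real" assume \<alpha>: "\<alpha> \<in> eval_span"
    obtain T a where T: "finite T" "T \<subseteq> {0..1}"
      and a: "\<And>f. blinfun_apply \<alpha> f = (\<Sum>t\<in>T. a t * apply_bcontfun f (Unit_interval t))"
      using eval_span_as_sum[OF \<alpha>] by metis
    have "((\<lambda>\<epsilon>. \<Sum>s\<in>T. \<Sum>t\<in>T. a s * a t * k' \<epsilon> s t) \<longlongrightarrow> (\<Sum>s\<in>T. \<Sum>t\<in>T. a s * a t * k H0 s t)) (at_right 0)"
      unfolding k'_def using T(2) by (intro tendsto_intros weighted_mean_tendsto cont) auto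
    moreover have "\<forall>\<^sub>F \<epsilon> in at_right 0. (\<Sum>s\<in>T. \<Sum>t\<in>T. a s * a t * k' \<epsilon> s t) = covar M (Z \<epsilon>) \<alpha> \<alpha>"
      using eventually_in_unit
      by eventually_elim (simp add: Z_def centered_gaussian_process.covar_sum[OF scaled T a])
    ultimately show "((\<lambda>\<epsilon>. covar M (Z \<epsilon>) \<alpha> \<alpha>) \<longlongrightarrow> covar (N H0) Z0 \<alpha> \<alpha>) (at_right 0)"
      unfolding Z0_def Y.covar_sum[OF T a] by (rule Lim_transform_eventually)
  next
    have "\<forall>\<^sub>F \<epsilon> in at_right 0. g \<epsilon> = inverse (weight \<epsilon>)"
      using eventually_in_unit by eventually_elim (rule g_eq(1))
    then show "filterlim g at_top (at_right 0)"
      using inverse_weight_at_top filterlim_cong[OF refl refl] by metis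
  qed
  \<comment> \<open>\<open>sample_path\<close> returns the actual path only for continuous
    functions, hence the continuity check before the two paths are compared pointwise.\<close>
  have law: "path_law M (\<lambda>t. X (\<epsilon> * t)) = distr M borel (\<lambda>w. (1 / sqrt (g \<epsilon>)) *\<^sub>R Z \<epsilon> w)"
    if \<epsilon>: "\<epsilon> \<in> {0<..1}" for \<epsilon>
    unfolding path_law_def
  proof (rule distr_cong[OF refl refl], rule bcontfun_eqI)
    fix w u assume w: "w \<in> space M"
    have "continuous_on {0..1} (\<lambda>t. X (\<epsilon> * t) w)"
      by (rule continuous_on_compose2[OF X.continuous_paths[OF w]])
        (use \<epsilon> in \<open>auto intro!: continuous_intros simp: mult_le_one\<close>)
    then show "apply_bcontfun (sample_path (\<lambda>t. X (\<epsilon> * t)) w) u =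
        apply_bcontfun ((1 / sqrt (g \<epsilon>)) *\<^sub>R Z \<epsilon> w) u"
      using g_eq(2)[OF \<epsilon>]
      by (simp add: apply_sample_path Z_def centered_gaussian_process.sample_path_eval[OF scaled[OF \<epsilon>] w])
  qed
  show ?thesis
    using F.tight_family_law F.weakly_converges_law F.satisfies_LDP_scaled[OF law]
    unfolding path_law_def Z_def Z0_def rkhs_rate_def[abs_def] by simp
qed

end
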